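(* Consider test functions $\boldsymbol{\beta}_h,\boldsymbol{w}_h\in\boldsymbol{W}_h$, and the trilinear form $$\begin{aligned}c_h(\boldsymbol{\beta}_h;\boldsymbol{v}_h,\boldsymbol{w}_h)=\;&\sum_{K\in\mathcal{T}_h}\int_K(\boldsymbol{\beta}_h\cdot\nabla_h\boldsymbol{v}_h)\cdot\boldsymbol{w}_h\,dV+\frac12\sum_{K\in\mathcal{T}_h}\int_K(\nabla\cdot\boldsymbol{\beta}_h)\,\boldsymbol{v}_h\cdot\boldsymbol{w}_h\,dV\\&-\sum_{F\in\mathcal{F}_h^i}\int_F(\boldsymbol{\beta}_h\cdot\boldsymbol{n}_F)\,[\![\boldsymbol{v}_h]\!]\cdot\{\!\{\boldsymbol{w}_h\}\!\}\,dA+\zeta\sum_{F\in\mathcal{F}_h^i}\int_F|\boldsymbol{\beta}_h\cdot\boldsymbol{n}_F|\,[\![\boldsymbol{v}_h]\!]\cdot[\![\boldsymbol{w}_h]\!]\,dA .\end{aligned}$$ Then $c_h$ is semi-coercive on $\boldsymbol{W}_h$, in the sense that $$\forall(\boldsymbol{\beta}_h,\boldsymbol{w}_h)\in\boldsymbol{W}_h\times\boldsymbol{W}_h,\qquad c_h(\boldsymbol{\beta}_h;\boldsymbol{w}_h,\boldsymbol{w}_h)=|\boldsymbol{w}_h|_{\boldsymbol{\beta}_h}^2,$$ where $$|\boldsymbol{w}_h|_{\boldsymbol{\beta}_h}=\left(\zeta\sum_{F\in\mathcal{F}_h^i}\int_F|\boldsymbol{\beta}_h\cdot\boldsymbol{n}_F|\,[\![\boldsymbol{w}_h]\!]\cdot[\![\boldsymbol{w}_h]\!]\,dA\right)^{1/2}$$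 is a seminorm (for vector fields $\boldsymbol{w}_h\in\boldsymbol{W}_h$ on $\Omega$).
   Context: $\Omega\subset\mathbb{R}^d$ ($d=2$ or $3$) is a bounded domain whose boundary $\partial\Omega$ is composed of straight edges (or faces). $\mathcal{T}_h$ is a mesh of $\Omega$ into non-overlapping elements $K$, conforming to the domain and without hanging nodes. $\mathcal{F}_h^i$ is the collection of interior faces, each shared by two elements. For $F\in\mathcal{F}_h^i$, $\boldsymbol{n}_F$ is a unit normal to $F$ pointing from its $+$ side to its $-$ side, $[\![\boldsymbol{w}]\!]=\boldsymbol{w}_+-\boldsymbol{w}_-$ and $\{\!\{\boldsymbol{w}\}\!\}=\frac12(\boldsymbol{w}_++\boldsymbol{w}_-)$. $\boldsymbol{W}_h\subset\boldsymbol{H}_0(\mathrm{div};\Omega)$ is the discrete (finite element) velocity space, where $\boldsymbol{H}_0(\mathrm{div};\Omega)=\{\boldsymbol{w}\in L^2(\Omega)^d:\nabla\cdot\boldsymbol{w}\in L^2(\Omega),\ \boldsymbol{w}\cdot\boldsymbol{n}|_{\partial\Omega}=0\}$; functions in $\boldsymbol{W}_h$ have continuous normal components across interior faces. Integrands are assumed to be well-defined so that the integrals (and elementwise integrations by parts) make sense. $\nabla_h$ is the elementwise gradient, and $(\boldsymbol{\beta}\cdot\nabla_h\boldsymbol{v})_i=\sum_j\beta_j\,\partial_j v_i$ on each element. $\zeta$ is a user-specified parameter that controls the amount of dissipation added to the scheme. *)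

theory Defs
  imports "HOL-Analysis.Analysis"
begin

definition polyhedral_domain :: "(real^'n::finite) set \<Rightarrow> bool" where
  "polyhedral_domain \<Omega> \<longleftrightarrow>
     open \<Omega> \<and> connected \<Omega> \<and> \<Omega> \<noteq> {} \<and> bounded \<Omega> \<and>
     (\<exists>P. finite P \<and> (\<forall>F\<in>P. polytope F \<and> aff_dim F = int CARD('n) - 1) \<and> frontier \<Omega> = \<Union>P)"

text \<open>Elements are closed convex polytopes with nonempty interior. The absence of hanging nodes is
  the condition that two elements meet in a common (possibly empty) face. Conformity to the domain
  means that no facet of an element lies partly inside the domain and partly on its boundary; cracks
  in the domain along facets are allowed.\<close>

definition mesh :: "(real^'n::finite) set \<Rightarrow> (real^'n) set set \<Rightarrow> bool" where
  "mesh \<Omega> T \<longleftrightarrow>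
     finite T \<and>
     (\<forall>K\<in>T. polytope K \<and> interior K \<noteq> {} \<and> interior K \<subseteq> \<Omega>) \<and>
     \<Union>T = closure \<Omega> \<and>
     (\<forall>K\<in>T. \<forall>L\<in>T. K \<noteq> L \<longrightarrow>
        interior K \<inter> interior L = {} \<and> (K \<inter> L) face_of K \<and> (K \<inter> L) face_of L) \<and>
     (\<forall>K\<in>T. \<forall>F. F facet_of K \<longrightarrow> F \<subseteq> frontier \<Omega> \<or> rel_interior F \<subseteq> \<Omega>)"

definition interior_faces :: "(real^'n::finite) set \<Rightarrow> (real^'n) set set \<Rightarrow> (real^'n) set set" where
  "interior_faces \<Omega> T =
     {F. rel_interior F \<subseteq> \<Omega> \<and> (\<exists>K\<in>T. \<exists>L\<in>T. K \<noteq> L \<and> F facet_of K \<and> F facet_of L)}"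

text \<open>A choice, for every interior face, of its plus and minus elements and of the unit normal
  pointing from the former to the latter.\<close>

definition face_orientation ::
  "(real^'n::finite) set \<Rightarrow> (real^'n) set set \<Rightarrow> ((real^'n) set \<Rightarrow> (real^'n) set) \<Rightarrow>
   ((real^'n) set \<Rightarrow> (real^'n) set) \<Rightarrow> ((real^'n) set \<Rightarrow> real^'n) \<Rightarrow> bool" where
  "face_orientation \<Omega> T Kp Km nF \<longleftrightarrow>
     (\<forall>F\<in>interior_faces \<Omega> T.
        Kp F \<in> T \<and> Km F \<in> T \<and> Kp F \<noteq> Km F \<and> F facet_of Kp F \<and> F facet_of Km F \<and>
        norm (nF F) = 1 \<and>
        (\<forall>x\<in>F. (\<forall>y\<in>Kp F. nF F \<bullet> (y - x) \<le> 0) \<and> (\<forall>y\<in>Km F. nF F \<bullet> (y - x) \<ge> 0)))"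

text \<open>Surface measure on a flat face with unit normal n: the area of a subset of the face is the
  Lebesgue measure of the right prism of height 1 erected over it (\<open>closest_point F\<close> sends a point of
  the prism to its foot in the face).\<close>

definition face_measure :: "real^'n::finite \<Rightarrow> (real^'n) set \<Rightarrow> (real^'n) measure" where
  "face_measure n F =
     distr (restrict_space lborel {x + t *\<^sub>R n | x t. x \<in> F \<and> 0 \<le> t \<and> t \<le> 1}) borel
       (closest_point F)"

definition square_integrable :: "(real^'n::finite) set \<Rightarrow> (real^'n \<Rightarrow> 'b::euclidean_space) \<Rightarrow> bool" where
  "square_integrable \<Omega> f \<longleftrightarrow>
     f \<in> borel_measurable (lebesgue_on \<Omega>) \<and> integrable (lebesgue_on \<Omega>) (\<lambda>x. (norm (f x))\<^sup>2)"

definition C1_with_gradient ::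
  "(real^'n::finite) set \<Rightarrow> (real^'n \<Rightarrow> real) \<Rightarrow> (real^'n \<Rightarrow> real^'n) \<Rightarrow> bool" where
  "C1_with_gradient \<Omega> \<phi> G \<longleftrightarrow>
     (\<forall>x\<in>\<Omega>. (\<phi> has_derivative (\<lambda>h. G x \<bullet> h)) (at x)) \<and> continuous_on \<Omega> G"

text \<open>Continuously differentiable test functions give the same weak divergence as smooth ones, by
  mollification.\<close>

definition weak_divergence ::
  "(real^'n::finite) set \<Rightarrow> (real^'n \<Rightarrow> real^'n) \<Rightarrow> (real^'n \<Rightarrow> real) \<Rightarrow> bool" where
  "weak_divergence \<Omega> w q \<longleftrightarrow>
     (\<forall>\<phi> G C. C1_with_gradient \<Omega> \<phi> G \<and> compact C \<and> C \<subseteq> \<Omega> \<and> (\<forall>x\<in>\<Omega> - C. \<phi> x = 0) \<longrightarrow>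
        (LINT x:\<Omega>|lebesgue. w x \<bullet> G x) = - (LINT x:\<Omega>|lebesgue. q x * \<phi> x))"

text \<open>The normal trace of a field w with divergence q is the functional that sends a function
  \<open>\<phi>\<close> in the Sobolev space \<open>H\<^sup>1(\<Omega>)\<close> to the integral of \<open>w \<bullet> \<nabla>\<phi> + q \<phi>\<close>. By the Meyers-Serrin
  theorem the continuously differentiable functions are dense in that space for every open set, so
  it suffices to test with those.\<close>

definition zero_normal_trace ::
  "(real^'n::finite) set \<Rightarrow> (real^'n \<Rightarrow> real^'n) \<Rightarrow> (real^'n \<Rightarrow> real) \<Rightarrow> bool" where
  "zero_normal_trace \<Omega> w q \<longleftrightarrow>
     (\<forall>\<phi> G. C1_with_gradient \<Omega> \<phi> G \<and> square_integrable \<Omega> \<phi> \<and> square_integrable \<Omega> G \<longrightarrow>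
        (LINT x:\<Omega>|lebesgue. w x \<bullet> G x + q x * \<phi> x) = 0)"

definition H0_div :: "(real^'n::finite) set \<Rightarrow> (real^'n \<Rightarrow> real^'n) set" where
  "H0_div \<Omega> =
     {w. square_integrable \<Omega> w \<and>
         (\<exists>q. square_integrable \<Omega> q \<and> weak_divergence \<Omega> w q \<and> zero_normal_trace \<Omega> w q)}"

text \<open>Continuous differentiability up to the boundary of a closed element. The values of w on the
  boundary of the element are irrelevant, since w is in general discontinuous there.\<close>

definition C1_up_to_boundary :: "(real^'n::finite) set \<Rightarrow> (real^'n \<Rightarrow> real^'n) \<Rightarrow> bool" where
  "C1_up_to_boundary K w \<longleftrightarrow>
     (\<exists>g J. (\<forall>x\<in>interior K. g x = w x) \<and>
        (\<forall>x\<in>K. (g has_derivative (\<lambda>h. (J x :: real^'n^'n) *v h)) (at x within K)) \<and>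
        continuous_on K J)"

definition function_subspace :: "('a \<Rightarrow> 'b::real_vector) set \<Rightarrow> bool" where
  "function_subspace W \<longleftrightarrow>
     (\<lambda>x. 0) \<in> W \<and> (\<forall>u\<in>W. \<forall>v\<in>W. (\<lambda>x. u x + v x) \<in> W) \<and> (\<forall>a. \<forall>u\<in>W. (\<lambda>x. a *\<^sub>R u x) \<in> W)"

definition finite_dimensional :: "('a \<Rightarrow> 'b::real_vector) set \<Rightarrow> bool" where
  "finite_dimensional W \<longleftrightarrow>
     (\<exists>B. finite B \<and> B \<subseteq> W \<and> (\<forall>w\<in>W. \<exists>c. w = (\<lambda>x. \<Sum>b\<in>B. c b *\<^sub>R b x)))"

definition discrete_velocity_space ::
  "(real^'n::finite) set \<Rightarrow> (real^'n) set set \<Rightarrow> (real^'n \<Rightarrow> real^'n) set \<Rightarrow> bool" where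
  "discrete_velocity_space \<Omega> T W \<longleftrightarrow>
     function_subspace W \<and> finite_dimensional W \<and> W \<subseteq> H0_div \<Omega> \<and>
     (\<forall>w\<in>W. \<forall>K\<in>T. C1_up_to_boundary K w)"

definition seminorm_on :: "('a \<Rightarrow> 'b::real_vector) set \<Rightarrow> (('a \<Rightarrow> 'b) \<Rightarrow> real) \<Rightarrow> bool" where
  "seminorm_on W p \<longleftrightarrow>
     (\<forall>u\<in>W. 0 \<le> p u) \<and>
     (\<forall>a. \<forall>u\<in>W. p (\<lambda>x. a *\<^sub>R u x) = \<bar>a\<bar> * p u) \<and>
     (\<forall>u\<in>W. \<forall>v\<in>W. p (\<lambda>x. u x + v x) \<le> p u + p v)"

text \<open>The entry in row i and column j is the derivative of the i-th component in direction j. It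
  matters only in the interior of elements, whose boundaries are null sets; there it is the elementwise
  gradient, and its matrix trace is the elementwise divergence.\<close>

definition jacobian :: "(real^'n::finite \<Rightarrow> real^'n) \<Rightarrow> real^'n \<Rightarrow> real^'n^'n" where
  "jacobian v x = matrix (frechet_derivative v (at x))"

definition divergence :: "(real^'n::finite \<Rightarrow> real^'n) \<Rightarrow> real^'n \<Rightarrow> real" where
  "divergence v x = (\<Sum>i\<in>UNIV. jacobian v x $ i $ i)"

definition directional :: "(real^'n::finite \<Rightarrow> real^'n) \<Rightarrow> (real^'n \<Rightarrow> real^'n) \<Rightarrow> real^'n \<Rightarrow> real^'n" where
  "directional \<beta> v x = (\<chi> i. \<Sum>j\<in>UNIV. \<beta> x $ j * jacobian v x $ i $ j)"

definition side_value :: "(real^'n::finite) set \<Rightarrow> (real^'n \<Rightarrow> real^'n) \<Rightarrow> real^'n \<Rightarrow> real^'n" where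
  "side_value K w x = Lim (at x within interior K) w"

definition jump ::
  "(real^'n::finite) set \<Rightarrow> (real^'n) set \<Rightarrow> (real^'n \<Rightarrow> real^'n) \<Rightarrow> real^'n \<Rightarrow> real^'n" where
  "jump Kp Km w x = side_value Kp w x - side_value Km w x"

definition average ::
  "(real^'n::finite) set \<Rightarrow> (real^'n) set \<Rightarrow> (real^'n \<Rightarrow> real^'n) \<Rightarrow> real^'n \<Rightarrow> real^'n" where
  "average Kp Km w x = (1/2) *\<^sub>R (side_value Kp w x + side_value Km w x)"

text \<open>The normal component of \<open>\<beta>\<close> on a face is single-valued for fields in \<open>H\<^sub>0(div)\<close>; it is
  evaluated from the plus side.\<close>

definition dissipation ::
  "(real^'n::finite) set \<Rightarrow> (real^'n) set set \<Rightarrow> ((real^'n) set \<Rightarrow> (real^'n) set) \<Rightarrow>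
   ((real^'n) set \<Rightarrow> (real^'n) set) \<Rightarrow> ((real^'n) set \<Rightarrow> real^'n) \<Rightarrow> real \<Rightarrow>
   (real^'n \<Rightarrow> real^'n) \<Rightarrow> (real^'n \<Rightarrow> real^'n) \<Rightarrow> (real^'n \<Rightarrow> real^'n) \<Rightarrow> real" where
  "dissipation \<Omega> T Kp Km nF \<zeta> \<beta> v w =
     \<zeta> * (\<Sum>F\<in>interior_faces \<Omega> T. LINT x:F|face_measure (nF F) F.
       \<bar>side_value (Kp F) \<beta> x \<bullet> nF F\<bar> * (jump (Kp F) (Km F) v x \<bullet> jump (Kp F) (Km F) w x))"

definition conv_form ::
  "(real^'n::finite) set \<Rightarrow> (real^'n) set set \<Rightarrow> ((real^'n) set \<Rightarrow> (real^'n) set) \<Rightarrow>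
   ((real^'n) set \<Rightarrow> (real^'n) set) \<Rightarrow> ((real^'n) set \<Rightarrow> real^'n) \<Rightarrow> real \<Rightarrow>
   (real^'n \<Rightarrow> real^'n) \<Rightarrow> (real^'n \<Rightarrow> real^'n) \<Rightarrow> (real^'n \<Rightarrow> real^'n) \<Rightarrow> real" where
  "conv_form \<Omega> T Kp Km nF \<zeta> \<beta> v w =
     (\<Sum>K\<in>T. LINT x:K|lebesgue. directional \<beta> v x \<bullet> w x)
   + 1/2 * (\<Sum>K\<in>T. LINT x:K|lebesgue. divergence \<beta> x * (v x \<bullet> w x))
   - (\<Sum>F\<in>interior_faces \<Omega> T. LINT x:F|face_measure (nF F) F.
        (side_value (Kp F) \<beta> x \<bullet> nF F) * (jump (Kp F) (Km F) v x \<bullet> average (Kp F) (Km F) w x))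
   + dissipation \<Omega> T Kp Km nF \<zeta> \<beta> v w"

definition beta_seminorm ::
  "(real^'n::finite) set \<Rightarrow> (real^'n) set set \<Rightarrow> ((real^'n) set \<Rightarrow> (real^'n) set) \<Rightarrow>
   ((real^'n) set \<Rightarrow> (real^'n) set) \<Rightarrow> ((real^'n) set \<Rightarrow> real^'n) \<Rightarrow> real \<Rightarrow>
   (real^'n \<Rightarrow> real^'n) \<Rightarrow> (real^'n \<Rightarrow> real^'n) \<Rightarrow> real" where
  "beta_seminorm \<Omega> T Kp Km nF \<zeta> \<beta> w = sqrt (dissipation \<Omega> T Kp Km nF \<zeta> \<beta> w w)"

end

theory Submission
  imports Defs
begin

text \<open>On each element the volume terms are half of the divergence of \<open>|w|\<^sup>2 \<beta>\<close>, so the divergence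
  theorem turns them into facet integrals of \<open>(\<beta> \<bullet> n) |w|\<^sup>2 / 2\<close>. Membership of \<open>\<beta>\<close> in
  \<open>H\<^sub>0(div)\<close> makes \<open>\<beta> \<bullet> n\<close> vanish on boundary facets and single-valued on interior ones, where
  the two sides combine to \<open>(\<beta> \<bullet> n)\<close> times jump times average and cancel the face term of the form.
  What remains is the dissipation, a positive semidefinite symmetric bilinear form in w.

  The divergence theorem on a polytope is obtained by integrating a derivative of the field times a
  piecewise linear cutoff, which is zero by translation invariance; as the cutoff steepens, its
  gradient concentrates in layers over the facets. Normal continuity comes from testing with bumps that
  are fixed on the facet and shrink to zero off it.\<close>

subsection \<open>Surface integrals over flat faces\<close>

text \<open>The data live at different levels: \<open>H0_div\<close> is a statement about integrals
  over \<Omega>, the face terms involve one-sided limits, and the values of a field on element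
  boundaries are arbitrary. Hence each field is replaced on every closed element by a C1
  representative, and the weak identity is turned into pointwise statements at relative interior
  points of facets, which extend to whole facets by density. Cracks are allowed, so a facet in the
  frontier of \<Omega> may have elements on both sides. A test function has to be C1 only inside
  \<Omega>; it may therefore be multiplied by the indicator of one side of a crack, which isolates
  the trace from that side. The surface measure is the volume of a prism of height 1. This suits the
  cutoff argument: a layer of thickness 1/N, weighted by N, amounts to N translated copies that tile
  a layer of thickness 1. The limit then needs translation invariance and dominated convergence, and
  no iterated integrals.\<close>

text \<open>On a flat face with normal n the choice of the point p is immaterial; the depth is positive on the
  side that n points away from.\<close>

definition depth :: "real^'n::finite \<Rightarrow> (real^'n) set \<Rightarrow> real^'n \<Rightarrow> real" where
  "depth n F x = n \<bullet> ((SOME p. p \<in> F) - x)"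

definition foot :: "real^'n::finite \<Rightarrow> (real^'n) set \<Rightarrow> real^'n \<Rightarrow> real^'n" where
  "foot n F x = x + depth n F x *\<^sub>R n"

definition flat_face :: "real^'n::finite \<Rightarrow> (real^'n) set \<Rightarrow> bool" where
  "flat_face n F \<longleftrightarrow> compact F \<and> convex F \<and> F \<noteq> {} \<and> norm n = 1 \<and> (\<forall>x\<in>F. \<forall>y\<in>F. n \<bullet> (x - y) = 0)"

lemma depth_minus: "depth (-n) F x = - depth n F x"
  by (simp add: depth_def)

lemma foot_minus: "foot (-n) F x = foot n F x"
  by (simp add: foot_def depth_minus)

lemma flat_face_minus: "flat_face (-n) F \<longleftrightarrow> flat_face n F"
  by (simp add: flat_face_def)

lemma depth_add: "depth n F (x + y) = depth n F x - n \<bullet> y"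
  by (simp add: depth_def inner_diff_right inner_add_right)

lemma depth_normal: "norm n = 1 \<Longrightarrow> depth n F (x + t *\<^sub>R n) = depth n F x - t"
  by (simp add: depth_add norm_eq_1)

lemma foot_normal: "norm n = 1 \<Longrightarrow> foot n F (x + t *\<^sub>R n) = foot n F x"
  by (simp add: foot_def depth_normal algebra_simps)

lemma depth_foot: "norm n = 1 \<Longrightarrow> depth n F (foot n F x) = 0"
  by (simp add: foot_def depth_normal)

lemma depth_on_face: "flat_face n F \<Longrightarrow> x \<in> F \<Longrightarrow> depth n F x = 0"
  unfolding depth_def flat_face_def by (metis someI_ex)

lemma foot_on_face: "flat_face n F \<Longrightarrow> x \<in> F \<Longrightarrow> foot n F x = x"
  by (simp add: foot_def depth_on_face)

lemma continuous_on_depth [continuous_intros]: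
  "continuous_on S f \<Longrightarrow> continuous_on S (\<lambda>x. depth n F (f x))"
  unfolding depth_def by (intro continuous_intros)

lemma continuous_on_foot [continuous_intros]:
  "continuous_on S f \<Longrightarrow> continuous_on S (\<lambda>x. foot n F (f x))"
  unfolding foot_def by (intro continuous_intros)

lemma measurable_depth [measurable]: "depth n F \<in> borel_measurable borel"
  by (intro borel_measurable_continuous_onI continuous_intros)

lemma measurable_foot [measurable]: "foot n F \<in> borel_measurable borel"
  by (intro borel_measurable_continuous_onI continuous_intros)

text \<open>The set that carries \<open>face_measure\<close>, written in the coordinates foot and
  depth. The sign appears because depth decreases along n.\<close>

definition prism :: "real^'n::finite \<Rightarrow> (real^'n) set \<Rightarrow> (real^'n) set" where
  "prism n F = {x. foot n F x \<in> F \<and> - depth n F x \<in> {0..1}}"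

lemma prism_eq:
  assumes "flat_face n F"
  shows "{x + t *\<^sub>R n | x t. x \<in> F \<and> 0 \<le> t \<and> t \<le> 1} = prism n F"
proof -
  have n: "norm n = 1" using assms by (simp add: flat_face_def)
  have "y \<in> {x + t *\<^sub>R n | x t. x \<in> F \<and> 0 \<le> t \<and> t \<le> 1}" if "y \<in> prism n F" for y
  proof -
    have "y = foot n F y + (- depth n F y) *\<^sub>R n" by (simp add: foot_def)
    moreover have "foot n F y \<in> F" "0 \<le> - depth n F y" "- depth n F y \<le> 1"
      using that by (auto simp: prism_def)
    ultimately show ?thesis by blast
  qed
  moreover have "y \<in> prism n F" if "y \<in> {x + t *\<^sub>R n | x t. x \<in> F \<and> 0 \<le> t \<and> t \<le> 1}" for y
    using that n assms by (auto simp: prism_def foot_normal depth_normal foot_on_face depth_on_face)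
  ultimately show ?thesis by blast
qed

lemma closed_prism: "flat_face n F \<Longrightarrow> closed (prism n F)"
proof -
  assume F: "flat_face n F"
  have c: "closed F" using F by (simp add: flat_face_def compact_imp_closed)
  have "prism n F = (foot n F -` F) \<inter> ((\<lambda>x. - depth n F x) -` {0..1})"
    by (simp add: prism_def vimage_def Int_def)
  moreover have "closed (foot n F -` F)" using c by (intro closed_vimage continuous_intros)
  moreover have "closed ((\<lambda>x. - depth n F x) -` {0..1})" by (intro closed_vimage continuous_intros closed_atLeastAtMost)
  ultimately show ?thesis by auto
qed

lemma compact_prism: assumes "flat_face n F" shows "compact (prism n F)"
proof -
  have "bounded F" "norm n = 1" using assms by (auto simp: flat_face_def compact_imp_bounded)
  then obtain B where B: "\<And>x. x \<in> F \<Longrightarrow> norm x \<le> B" by (meson bounded_iff)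
  have "norm y \<le> B + 1" if "y \<in> prism n F" for y
  proof -
    have "norm y = norm (foot n F y - depth n F y *\<^sub>R n)" by (simp add: foot_def)
    also have "\<dots> \<le> norm (foot n F y) + norm (depth n F y *\<^sub>R n)" by (rule norm_triangle_ineq4)
    also have "\<dots> \<le> B + 1" using that B \<open>norm n = 1\<close> by (intro add_mono) (auto simp: prism_def)
    finally show ?thesis .
  qed
  then have "bounded (prism n F)" by (meson bounded_iff)
  then show ?thesis using closed_prism[OF assms] compact_eq_bounded_closed by blast
qed

text \<open>The distance from x to its foot is the absolute value of the depth, and by
  Cauchy-Schwarz no point of the hyperplane is nearer.\<close>

lemma closest_point_prism:
  assumes "flat_face n F" "x \<in> prism n F"
  shows "closest_point F x = foot n F x"
proof (rule closest_point_unique[symmetric])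
  show "convex F" "closed F" using assms by (auto simp: flat_face_def compact_imp_closed)
  show fF: "foot n F x \<in> F" using assms by (auto simp: prism_def)
  show "\<forall>z\<in>F. dist x (foot n F x) \<le> dist x z"
  proof
    fix z assume z: "z \<in> F"
    have "depth n F x = n \<bullet> (z - x)"
      using depth_add[of n F x "z - x"] depth_on_face[OF assms(1) z] by simp
    then have "\<bar>depth n F x\<bar> \<le> norm n * norm (z - x)" using Cauchy_Schwarz_ineq2 by metis
    then show "dist x (foot n F x) \<le> dist x z" using assms
      by (simp add: dist_norm foot_def norm_minus_commute flat_face_def)
  qed
qed

section \<open>Face integrals as volume integrals over unit layers\<close>

lemma lint_translation:
  fixes h :: "'a::euclidean_space \<Rightarrow> real"
  assumes "h \<in> borel_measurable borel"
  shows "(LINT x|lborel. h (x + c)) = (LINT x|lborel. h x)"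
proof -
  have "(LINT x|lborel. h x) = (LINT x|distr lborel borel ((+) c). h x)"
    by (simp add: lborel_distr_plus)
  also have "\<dots> = (LINT x|lborel. h (c + x))" by (rule integral_distr) (use assms in auto)
  finally show ?thesis by (simp add: add.commute)
qed

lemma integrable_translation:
  fixes h :: "'a::euclidean_space \<Rightarrow> real"
  assumes "integrable lborel h"
  shows "integrable lborel (\<lambda>x. h (x + c))"
proof -
  have m: "h \<in> borel_measurable borel" using borel_measurable_integrable[OF assms] by simp
  have "integrable (distr lborel borel ((+) c)) h" by (simp add: lborel_distr_plus assms)
  then have "integrable lborel (\<lambda>x. h (c + x))" by (subst (asm) integrable_distr_eq) (use m in auto)
  then show ?thesis by (simp add: add.commute)
qed

text \<open>The mirror image of the prism. For an outward normal the prism lies outside the element,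
  whereas the cutoffs vary in a layer inside it.\<close>

definition face_layer :: "real^'n::finite \<Rightarrow> (real^'n) set \<Rightarrow> (real^'n) set" where
  "face_layer n F = {x. foot n F x \<in> F \<and> depth n F x \<in> {0..1}}"

lemma face_layer_minus: "face_layer n F = prism (-n) F"
  by (simp add: face_layer_def prism_def foot_minus depth_minus)

lemma closest_point_measurable: 
  assumes "flat_face n F" 
  shows "closest_point F \<in> borel_measurable borel"
  using assms by (intro borel_measurable_continuous_onI continuous_on_closest_point)
    (auto simp: flat_face_def compact_imp_closed)

lemma measurable_on_face:
  fixes u :: "real^'n::finite \<Rightarrow> real"
  assumes "flat_face n F" "continuous_on F u"
  shows "(\<lambda>x. indicator F x * u x) \<in> borel_measurable borel"
  using borel_measurable_continuous_on_indicator[of F u] assms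
  by (auto simp: flat_face_def compact_imp_closed)

lemma face_integral_prism:
  fixes u :: "real^'n::finite \<Rightarrow> real"
  assumes F: "flat_face n F" and u: "continuous_on F u"
  shows "(LINT x:F|face_measure n F. u x) = (LINT x|lborel. indicator (prism n F) x * u (foot n F x))"
proof -
  note m = measurable_on_face[OF F u]
  have P: "prism n F \<in> sets borel" using closed_prism[OF F] by auto
  have "(LINT x:F|face_measure n F. u x) = (LINT x|distr (restrict_space lborel (prism n F)) borel (closest_point F). indicator F x * u x)"
    by (simp add: set_lebesgue_integral_def face_measure_def prism_eq[OF F])
  also have "\<dots> = (LINT x|restrict_space lborel (prism n F). indicator F (closest_point F x) * u (closest_point F x))"
    by (rule integral_distr) (use m closest_point_measurable[OF F] P in \<open>auto intro: measurable_restrict_space1\<close>)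
  also have "\<dots> = (LINT x:prism n F|lborel. indicator F (closest_point F x) * u (closest_point F x))"
    using P by (subst integral_restrict_space) (auto simp: set_lebesgue_integral_def)
  also have "\<dots> = (LINT x|lborel. indicator (prism n F) x * u (foot n F x))"
    unfolding set_lebesgue_integral_def
    by (rule Bochner_Integration.integral_cong)
      (auto simp: closest_point_prism[OF F] indicator_def, auto simp: prism_def)
  finally show ?thesis .
qed

lemma prism_integrand_measurable:
  fixes u :: "real^'n::finite \<Rightarrow> real"
  assumes F: "flat_face n F" and u: "continuous_on F u"
  shows "(\<lambda>x. indicator (prism n F) x * u (foot n F x)) \<in> borel_measurable borel"
proof -
  have "continuous_on (prism n F) (\<lambda>x. u (foot n F x))"
    by (rule continuous_on_compose2[OF u]) (auto simp: prism_def intro!: continuous_intros)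
  then show ?thesis
    using borel_measurable_continuous_on_indicator[of "prism n F"] closed_prism[OF F] by fastforce
qed

text \<open>Translation by n carries the layer onto the prism and leaves feet unchanged.\<close>

lemma face_integral_layer:
  fixes u :: "real^'n::finite \<Rightarrow> real"
  assumes F: "flat_face n F" and u: "continuous_on F u"
  shows "(LINT x:F|face_measure n F. u x) = (LINT x|lborel. indicator (face_layer n F) x * u (foot n F x))"
proof -
  have n: "norm n = 1" using F by (simp add: flat_face_def)
  have "(LINT x|lborel. indicator (prism n F) x * u (foot n F x))
      = (LINT x|lborel. indicator (prism n F) (x + 1 *\<^sub>R n) * u (foot n F (x + 1 *\<^sub>R n)))"
    by (rule lint_translation[symmetric]) (rule prism_integrand_measurable[OF F u])
  also have "\<dots> = (LINT x|lborel. indicator (face_layer n F) x * u (foot n F x))"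
    unfolding foot_normal[OF n]
    by (rule Bochner_Integration.integral_cong)
      (auto simp: indicator_def prism_def face_layer_def foot_normal[OF n] depth_normal[OF n] simp del: scaleR_one)
  finally show ?thesis using face_integral_prism[OF F u] by simp
qed

text \<open>Reversing n exchanges prism and layer, so the area of a face does not depend on its
  orientation. This lets the two elements at an interior face share one measure.\<close>

lemma face_integral_minus:
  fixes u :: "real^'n::finite \<Rightarrow> real"
  assumes F: "flat_face n F" and u: "continuous_on F u"
  shows "(LINT x:F|face_measure (-n) F. u x) = (LINT x:F|face_measure n F. u x)"
  using face_integral_prism[of "-n" F u] face_integral_layer[OF F u] u F
  by (simp add: flat_face_minus face_layer_minus foot_minus)

text \<open>The prism is bounded, so the surface measure is finite, and a continuous function on the
  compact face is bounded.\<close>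

lemma face_integrable:
  fixes u :: "real^'n::finite \<Rightarrow> real"
  assumes F: "flat_face n F" and u: "continuous_on F u"
  shows "set_integrable (face_measure n F) F u"
proof -
  have P: "prism n F \<in> sets borel" using closed_prism[OF F] by auto
  have "emeasure (face_measure n F) UNIV = emeasure (restrict_space lborel (prism n F)) (prism n F)"
    unfolding face_measure_def prism_eq[OF F]
    using closest_point_measurable[OF F] P
    by (subst emeasure_distr) (auto intro: measurable_restrict_space1 simp: space_restrict_space)
  also have "\<dots> = emeasure lborel (prism n F)" using P by (subst emeasure_restrict_space) auto
  also have "\<dots> < \<infinity>" using compact_prism[OF F] by (metis compact_imp_bounded emeasure_bounded_finite infinity_ennreal_def)
  finally have fin: "emeasure (face_measure n F) UNIV < \<infinity>" .
  interpret finite_measure "face_measure n F"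
    using fin by (intro finite_measureI) (simp add: face_measure_def)
  have "compact (u ` F)" using F u by (intro compact_continuous_image) (auto simp: flat_face_def)
  then obtain B where B: "\<And>x. x \<in> F \<Longrightarrow> norm (u x) \<le> B" by (meson bounded_iff compact_imp_bounded imageI)
  have "norm (indicator F x *\<^sub>R u x) \<le> \<bar>B\<bar>" for x
    using B[of x] by (auto simp: indicator_def)
  then show ?thesis unfolding set_integrable_def
    using measurable_on_face[OF F u]
    by (intro integrable_const_bound[where B="\<bar>B\<bar>"]) (auto simp: face_measure_def)
qed

text \<open>If the integral vanished, the nonnegative integrand over the prism would be zero almost
  everywhere, but it is positive on a nonempty open set.\<close>

lemma face_integral_pos:
  fixes u :: "real^'n::finite \<Rightarrow> real"
  assumes F: "flat_face n F" and u: "continuous_on F u" and nn: "\<And>x. x \<in> F \<Longrightarrow> 0 \<le> u x"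
    and r: "r > 0" and x0: "x0 \<in> F" and pos: "\<And>x. depth n F x = 0 \<Longrightarrow> dist x0 x < r \<Longrightarrow> x \<in> F \<and> u x > 0"
  shows "(LINT x:F|face_measure n F. u x) > 0"
proof (rule ccontr)
  assume neg: "\<not> ?thesis"
  have n: "norm n = 1" using F by (simp add: flat_face_def)
  let ?g = "\<lambda>x. indicator (prism n F) x * u (foot n F x)"
  have g0: "0 \<le> ?g x" for x using nn by (auto simp: indicator_def prism_def)
  have "(LINT x|lborel. ?g x) = 0"
    using neg face_integral_prism[OF F u] Bochner_Integration.integral_nonneg[of lborel ?g, OF g0] by linarith
  moreover have "integrable lborel ?g"
  proof -
    have "continuous_on (prism n F) (\<lambda>x. u (foot n F x))"
      by (rule continuous_on_compose2[OF u]) (auto simp: prism_def intro!: continuous_intros)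
    then show ?thesis using borel_integrable_compact[of "prism n F" "\<lambda>x. u (foot n F x)"] compact_prism[OF F]
      by (simp add: indicator_scaleR_eq_if if_distrib cong: if_cong)
  qed
  ultimately have ae: "AE x in lborel. ?g x = 0"
    using g0 by (subst (asm) integral_nonneg_eq_0_iff_AE) auto
  \<comment> \<open>The open cylinder over the relative ball around \<open>x0\<close>; it contains
    the point at height 1/2 above \<open>x0\<close>.\<close>
  let ?U = "(foot n F -` ball x0 r) \<inter> ((\<lambda>x. - depth n F x) -` {0<..<1})"
  have "open ?U" by (intro open_Int open_vimage continuous_intros) auto
  moreover have "x0 + (1/2) *\<^sub>R n \<in> ?U"
    using n r x0 F by (simp add: foot_normal depth_normal depth_on_face foot_on_face)
  moreover have "?g x \<noteq> 0" if "x \<in> ?U" for x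
  proof -
    have "foot n F x \<in> F \<and> u (foot n F x) > 0"
      using that n by (intro pos) (auto simp: depth_foot)
    then show ?thesis using that by (auto simp: prism_def)
  qed
  moreover have "{x. ?g x \<noteq> 0} \<in> null_sets lborel"
  proof -
    have [measurable]: "?g \<in> borel_measurable borel" by (rule prism_integrand_measurable[OF F u])
    have "{x \<in> space lborel. \<not> ?g x = 0} \<in> sets lborel" by measurable
    then show ?thesis using ae AE_iff_null[of lborel "\<lambda>x. ?g x = 0"] by (simp del: mult_eq_0_iff)
  qed
  ultimately have U: "open ?U" "?U \<noteq> {}" "?U \<subseteq> {x. ?g x \<noteq> 0}" "{x. ?g x \<noteq> 0} \<in> null_sets lborel"
    by blast+
  have "negligible {x. ?g x \<noteq> 0}"
    unfolding negligible_iff_null_sets using U(4) by (rule null_sets_completionI)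
  then have "negligible ?U" using U(3) by (rule negligible_subset)
  then show False using U(1,2) open_not_negligible by blast
qed

subsection \<open>Thin layers and directional derivatives\<close>

lemma AE_lborel_negligible:
  fixes N :: "'a::euclidean_space set"
  assumes "negligible N" "N \<in> sets borel"
  shows "AE x in lborel. x \<notin> N"
proof (rule AE_not_in)
  show "N \<in> null_sets lborel"
    using assms null_sets_completion_iff[of N lborel] by (simp add: negligible_iff_null_sets)
qed

lemma AE_lborel_hyperplane:
  fixes a :: "'a::euclidean_space"
  assumes "a \<noteq> 0"
  shows "AE x in lborel. a \<bullet> x \<noteq> b"
  using AE_lborel_negligible[OF negligible_hyperplane[of a b]] assms closed_hyperplane[of a b]
  by auto

lemma AE_depth_neq:
  assumes "n \<noteq> 0"
  shows "AE x in lborel. depth n F x \<noteq> c"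
  using AE_lborel_hyperplane[OF assms, of "n \<bullet> (SOME p. p \<in> F) - c"]
  by eventually_elim (auto simp: depth_def inner_diff_right)

lemma integrable_indicator_cball:
  "integrable lborel (indicator (cball a r :: 'a::euclidean_space set) :: 'a \<Rightarrow> real)"
  by (intro integrable_real_indicator) (auto intro: emeasure_bounded_finite simp: infinity_ennreal_def[symmetric] simp del: infinity_ennreal_def)

text \<open>The layer of thickness 1 is tiled by N slabs of thickness 1/N. Slab number j is moved to
  the bottom slab by j/N along n, and the floor is the number of the slab that contains x. Half-open
  slabs make the tiling exact.\<close>

lemma integral_layer_shift:
  fixes h :: "real^'n::finite \<Rightarrow> real"
  assumes n: "norm n = 1" and h: "integrable lborel h" and N: "N > 0"
  shows "real N * (LINT x|lborel. indicator {x. 0 \<le> depth n F x \<and> depth n F x < 1 / N} x * h x)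
    = (LINT x|lborel. indicator {x. 0 \<le> depth n F x \<and> depth n F x < 1} x
         * h (x + (\<lfloor>N * depth n F x\<rfloor> / N) *\<^sub>R n))"
proof -
  define k where "k = (\<lambda>x. indicator {x. 0 \<le> depth n F x \<and> depth n F x < 1 / N} x * h x)"
  have k: "integrable lborel k"
    using integrable_mult_indicator[OF _ h, of "{x. 0 \<le> depth n F x \<and> depth n F x < 1 / N}"]
    by (simp add: k_def)
  have km: "k \<in> borel_measurable borel" using borel_measurable_integrable[OF k] by simp
  have "indicator {x. 0 \<le> depth n F x \<and> depth n F x < 1} x * h (x + (\<lfloor>N * depth n F x\<rfloor> / N) *\<^sub>R n)
      = (\<Sum>j<N. k (x + (j / N) *\<^sub>R n))" for x
  proof -
    let ?s = "depth n F x"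
    have kj: "k (x + (j / N) *\<^sub>R n) = (if \<lfloor>N * ?s\<rfloor> = int j then h (x + (j / N) *\<^sub>R n) else 0)" for j :: nat
    proof -
      have "0 \<le> ?s - j / N \<and> ?s - j / N < 1 / N \<longleftrightarrow> real j \<le> N * ?s \<and> N * ?s < real j + 1"
      proof -
        have "0 \<le> ?s - j / N \<longleftrightarrow> real j \<le> N * ?s" using N by (simp add: field_simps)
        moreover have "?s - j / N < 1 / N \<longleftrightarrow> ?s < (real j + 1) / N"
          by (simp add: add_divide_distrib) linarith
        moreover have "\<dots> \<longleftrightarrow> N * ?s < real j + 1" using N by (simp add: pos_less_divide_eq mult.commute)
        ultimately show ?thesis by simp
      qed
      also have "\<dots> \<longleftrightarrow> \<lfloor>N * ?s\<rfloor> = int j" by (auto simp: floor_eq_iff)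
      finally show ?thesis by (simp add: k_def depth_normal[OF n] indicator_def)
    qed
    show ?thesis
    proof (cases "0 \<le> ?s \<and> ?s < 1")
      case True
      define i where "i = nat \<lfloor>N * ?s\<rfloor>"
      have i: "\<lfloor>N * ?s\<rfloor> = int i" using True by (simp add: i_def)
      have "real i \<le> N * ?s" using i by linarith
      also have "\<dots> < N" using True N by simp
      finally have "i < N" by simp
      have "(\<Sum>j<N. k (x + (j / N) *\<^sub>R n)) = (\<Sum>j<N. if i = j then h (x + (j / N) *\<^sub>R n) else 0)"
        by (rule sum.cong) (auto simp: kj i)
      also have "\<dots> = h (x + (i / N) *\<^sub>R n)" using \<open>i < N\<close> by simp
      finally show ?thesis using True i by simp
    next
      case False
      have "\<lfloor>N * ?s\<rfloor> \<noteq> int j" if "j < N" for j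
      proof
        assume "\<lfloor>N * ?s\<rfloor> = int j"
        then have "real j \<le> N * ?s \<and> N * ?s < real j + 1" by (auto simp: floor_eq_iff)
        moreover have "real j + 1 \<le> N" using that by linarith
        ultimately have "0 \<le> N * ?s" "N * ?s < N * 1" by linarith+
        then show False using False N by (simp add: zero_le_mult_iff mult_less_cancel_left)
      qed
      then show ?thesis using False by (auto simp: kj)
    qed
  qed
  then have "(LINT x|lborel. indicator {x. 0 \<le> depth n F x \<and> depth n F x < 1} x
         * h (x + (\<lfloor>N * depth n F x\<rfloor> / N) *\<^sub>R n))
      = (LINT x|lborel. (\<Sum>j<N. k (x + (j / N) *\<^sub>R n)))" by presburger
  also have "\<dots> = (\<Sum>j<N. LINT x|lborel. k (x + (j / N) *\<^sub>R n))"
    by (rule Bochner_Integration.integral_sum) (rule integrable_translation[OF k])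
  also have "\<dots> = real N * (LINT x|lborel. k x)"
    by (simp add: lint_translation[OF km])
  finally show ?thesis by (simp add: k_def)
qed

text \<open>After the slabs are rearranged the domain of integration no longer depends on N, so
  dominated convergence applies to the shifted integrands.\<close>

lemma integral_layer_limit:
  fixes h :: "nat \<Rightarrow> real^'n::finite \<Rightarrow> real"
  assumes n: "norm n = 1"
    and meas [measurable]: "\<And>N. h N \<in> borel_measurable borel"
    and bound: "\<And>N x. \<bar>h N x\<bar> \<le> C"
    and supp: "\<And>N x. norm x > R \<Longrightarrow> h N x = 0"
    and lim: "AE x in lborel. 0 \<le> depth n F x \<longrightarrow> depth n F x < 1 \<longrightarrow>
       (\<lambda>N. h N (x + (\<lfloor>Suc N * depth n F x\<rfloor> / Suc N) *\<^sub>R n)) \<longlonglongrightarrow> g x"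
    and gm: "(\<lambda>x. indicator {x. 0 \<le> depth n F x \<and> depth n F x < 1} x * g x) \<in> borel_measurable borel"
  shows "(\<lambda>N. real (Suc N) * (LINT x|lborel. indicator {x. 0 \<le> depth n F x \<and> depth n F x < 1 / Suc N} x * h N x))
     \<longlonglongrightarrow> (LINT x|lborel. indicator {x. 0 \<le> depth n F x \<and> depth n F x < 1} x * g x)"
proof -
  have ih: "integrable lborel (h N)" for N
  proof (rule Bochner_Integration.integrable_bound)
    show "integrable lborel (\<lambda>x::real^'n. C * indicator (cball 0 R) x)"
      by (intro integrable_mult_right integrable_indicator_cball)
    show "AE x in lborel. norm (h N x) \<le> norm (C * indicator (cball 0 R) x)"
      using bound supp by (intro AE_I2) (auto simp: indicator_def intro: order_trans[OF bound abs_ge_self] abs_ge_self)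
  qed auto
  have eq: "real (Suc N) * (LINT x|lborel. indicator {x. 0 \<le> depth n F x \<and> depth n F x < 1 / Suc N} x * h N x)
     = (LINT x|lborel. indicator {x. 0 \<le> depth n F x \<and> depth n F x < 1} x
          * h N (x + (\<lfloor>Suc N * depth n F x\<rfloor> / Suc N) *\<^sub>R n))" for N
    by (rule integral_layer_shift[OF n ih]) simp
  show ?thesis unfolding eq
  proof (rule integral_dominated_convergence)
    \<comment> \<open>Inside the layer a point is shifted by at most 1, which enlarges the radius of
      the support from R to R + 1.\<close>
    show "integrable lborel (\<lambda>x::real^'n. C * indicator (cball 0 (R + 1)) x)"
      by (intro integrable_mult_right integrable_indicator_cball)
    show "(\<lambda>x. indicator {x. 0 \<le> depth n F x \<and> depth n F x < 1} x * g x) \<in> borel_measurable lborel"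
      using gm by simp
    show "(\<lambda>x. indicator {x. 0 \<le> depth n F x \<and> depth n F x < 1} x
          * h N (x + (\<lfloor>Suc N * depth n F x\<rfloor> / Suc N) *\<^sub>R n)) \<in> borel_measurable lborel" for N
      by measurable
    show "AE x in lborel. (\<lambda>N. indicator {x. 0 \<le> depth n F x \<and> depth n F x < 1} x
          * h N (x + (\<lfloor>Suc N * depth n F x\<rfloor> / Suc N) *\<^sub>R n))
        \<longlonglongrightarrow> indicator {x. 0 \<le> depth n F x \<and> depth n F x < 1} x * g x"
      using lim by eventually_elim (auto simp: indicator_def)
    show "AE x in lborel. norm (indicator {x. 0 \<le> depth n F x \<and> depth n F x < 1} x
          * h N (x + (\<lfloor>Suc N * depth n F x\<rfloor> / Suc N) *\<^sub>R n)) \<le> C * indicator (cball 0 (R + 1)) x" for N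
    proof (intro AE_I2)
      fix x :: "real^'n"
      let ?t = "\<lfloor>Suc N * depth n F x\<rfloor> / Suc N"
      have C: "0 \<le> C" using bound[of 0 0] by linarith
      show "norm (indicator {x. 0 \<le> depth n F x \<and> depth n F x < 1} x * h N (x + ?t *\<^sub>R n))
          \<le> C * indicator (cball 0 (R + 1)) x"
      proof (cases "0 \<le> depth n F x \<and> depth n F x < 1 \<and> norm x > R + 1")
        case True
        have "real_of_int \<lfloor>Suc N * depth n F x\<rfloor> \<le> Suc N * depth n F x" by (rule of_int_floor_le)
        then have "?t \<le> depth n F x" by (simp add: field_simps)
        moreover have "0 \<le> ?t" using True by simp
        moreover have "norm (?t *\<^sub>R n) = \<bar>?t\<bar>" using n by simp
        ultimately have "norm (?t *\<^sub>R n) \<le> 1" using True by linarith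
        moreover have "norm x \<le> norm (x + ?t *\<^sub>R n) + norm (?t *\<^sub>R n)"
          by (metis add_diff_cancel_right' norm_triangle_ineq4)
        ultimately have "norm (x + ?t *\<^sub>R n) > R" using True by linarith
        then show ?thesis using supp C by simp
      next
        case False
        then show ?thesis using bound C by (auto simp: indicator_def)
      qed
    qed
  qed
qed

text \<open>Difference quotients of an integrable function have integral zero by translation
  invariance. The Lipschitz bound and the bounded support dominate them, so the limit may be taken
  under the integral.\<close>

lemma integral_directional_derivative_zero:
  fixes f D :: "'a::euclidean_space \<Rightarrow> real"
  assumes lip: "\<And>x y. \<bar>f x - f y\<bar> \<le> L * norm (x - y)"
    and supp: "\<And>x. norm x > R \<Longrightarrow> f x = 0"
    and D: "D \<in> borel_measurable borel"
    and deriv: "AE x in lborel. ((\<lambda>t. f (x + t *\<^sub>R e)) has_real_derivative D x) (at 0)"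
  shows "(LINT x|lborel. D x) = 0"
proof -
  have c: "continuous_on UNIV f"
  proof -
    have "\<bar>L\<bar>-lipschitz_on UNIV f"
      by (rule lipschitz_onI) (auto simp: dist_norm intro!: order_trans[OF lip] mult_right_mono)
    then show ?thesis by (rule lipschitz_on_continuous_on)
  qed
  have fm [measurable]: "f \<in> borel_measurable borel" using c by (rule borel_measurable_continuous_onI)
  have fi: "integrable lborel f"
  proof -
    have "integrable lborel (\<lambda>x. indicator (cball 0 R) x *\<^sub>R f x)"
      by (rule borel_integrable_compact) (auto intro: continuous_on_subset[OF c])
    moreover have "(\<lambda>x. indicator (cball 0 R) x *\<^sub>R f x) = f"
      using supp by (force simp: indicator_def)
    ultimately show ?thesis by simp
  qed
  let ?q = "\<lambda>k x. real (Suc k) * (f (x + (1 / Suc k) *\<^sub>R e) - f x)"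
  have "(\<lambda>k. LINT x|lborel. ?q k x) \<longlonglongrightarrow> (LINT x|lborel. D x)"
  proof (rule integral_dominated_convergence)
    show "integrable lborel (\<lambda>x::'a. (\<bar>L\<bar> * norm e) * indicator (cball 0 (R + norm e)) x)"
      by (intro integrable_mult_right integrable_indicator_cball)
    show "D \<in> borel_measurable lborel" using D by simp
    show "?q k \<in> borel_measurable lborel" for k by measurable
    show "AE x in lborel. (\<lambda>k. ?q k x) \<longlonglongrightarrow> D x" using deriv
    proof eventually_elim
      fix x assume "((\<lambda>t. f (x + t *\<^sub>R e)) has_real_derivative D x) (at 0)"
      then have "((\<lambda>h. (f (x + h *\<^sub>R e) - f x) / h) \<longlongrightarrow> D x) (at 0)"
        by (simp add: has_field_derivative_iff)
      moreover have "filterlim (\<lambda>k. 1 / real (Suc k)) (at 0) sequentially"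
        unfolding filterlim_at using LIMSEQ_inverse_real_of_nat by (auto simp: inverse_eq_divide)
      ultimately have "(\<lambda>k. (f (x + (1 / real (Suc k)) *\<^sub>R e) - f x) / (1 / real (Suc k))) \<longlonglongrightarrow> D x"
        by (rule filterlim_compose)
      then show "(\<lambda>k. ?q k x) \<longlonglongrightarrow> D x" by (simp add: mult.commute)
    qed
    show "AE x in lborel. norm (?q k x) \<le> (\<bar>L\<bar> * norm e) * indicator (cball 0 (R + norm e)) x" for k
    proof (intro AE_I2)
      fix x :: 'a
      have le: "norm ((1 / Suc k) *\<^sub>R e) \<le> norm e"
        by (simp add: divide_le_eq mult_le_cancel_left1)
      have "norm (?q k x) \<le> \<bar>L\<bar> * norm e"
      proof -
        have "\<bar>f (x + (1 / Suc k) *\<^sub>R e) - f x\<bar> \<le> L * norm ((1 / Suc k) *\<^sub>R e)"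
          using lip[of "x + (1 / Suc k) *\<^sub>R e" x] by simp
        also have "\<dots> \<le> \<bar>L\<bar> * norm e / Suc k"
          by (simp add: divide_right_mono mult_right_mono)
        finally have "real (Suc k) * \<bar>f (x + (1 / Suc k) *\<^sub>R e) - f x\<bar> \<le> real (Suc k) * (\<bar>L\<bar> * norm e / Suc k)"
          by (rule mult_left_mono) simp
        then show ?thesis by (simp add: abs_mult)
      qed
      moreover have "?q k x = 0" if "norm x > R + norm e"
      proof -
        have "norm x \<le> norm (x + (1 / Suc k) *\<^sub>R e) + norm ((1 / Suc k) *\<^sub>R e)"
          by (metis add_diff_cancel_right' norm_triangle_ineq4)
        then have "norm (x + (1 / Suc k) *\<^sub>R e) > R" "norm x > R"
          using that le norm_ge_zero[of e] by linarith+
        then show ?thesis using supp by simp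
      qed
      ultimately show "norm (?q k x) \<le> (\<bar>L\<bar> * norm e) * indicator (cball 0 (R + norm e)) x"
        by (cases "norm x > R + norm e") (auto simp: indicator_def)
    qed
  qed
  moreover have q0: "(LINT x|lborel. ?q k x) = 0" for k
    using integrable_translation[OF fi, of "(1 / Suc k) *\<^sub>R e"] fi lint_translation[OF fm, of "(1 / Suc k) *\<^sub>R e"]
    by simp
  ultimately show ?thesis by (simp only: LIMSEQ_const_iff)
qed

subsection \<open>Polytopes described by the depth below their facets\<close>

definition outward_normals :: "(real^'n::finite) set \<Rightarrow> ((real^'n) set \<Rightarrow> real^'n) \<Rightarrow> bool" where
  "outward_normals K n \<longleftrightarrow>
     (\<forall>F. F facet_of K \<longrightarrow> norm (n F) = 1 \<and> (\<forall>x\<in>F. \<forall>y\<in>K. n F \<bullet> (y - x) \<le> 0))"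

lemma depth_eq: "flat_face n F \<Longrightarrow> p \<in> F \<Longrightarrow> depth n F x = n \<bullet> (p - x)"
  using depth_add[of n F p "x - p"] by (simp add: depth_on_face inner_diff_right)

lemma flat_face_facet:
  assumes K: "polytope K" and F: "F facet_of K" and n: "norm n = 1" "\<And>x y. x \<in> F \<Longrightarrow> y \<in> K \<Longrightarrow> n \<bullet> (y - x) \<le> 0"
  shows "flat_face n F"
proof -
  have "polytope F" using K F by (meson face_of_polytope_polytope facet_of_imp_face_of)
  moreover have "n \<bullet> (x - y) = 0" if "x \<in> F" "y \<in> F" for x y
    using n(2)[of x y] n(2)[of y x] that subsetD[OF facet_of_imp_subset[OF F]]
    by (auto simp: inner_diff_right intro: antisym)
  ultimately show ?thesis using F n(1)
    by (auto simp: flat_face_def polytope_imp_compact polytope_imp_convex facet_of_def)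
qed

context
  fixes K :: "(real^'n::finite) set" and n :: "(real^'n) set \<Rightarrow> real^'n"
  assumes K: "polytope K" and int: "interior K \<noteq> {}" and n: "outward_normals K n"
begin

lemma norm_outward: "F facet_of K \<Longrightarrow> norm (n F) = 1"
  using n by (simp add: outward_normals_def)

lemma facet_flat: "F facet_of K \<Longrightarrow> flat_face (n F) F"
  using flat_face_facet[OF K, of F "n F"] n by (simp add: outward_normals_def)

lemma depth_nonneg:
  assumes F: "F facet_of K" and x: "x \<in> K"
  shows "0 \<le> depth (n F) F x"
proof -
  obtain p where "p \<in> F" using F by (auto simp: facet_of_def)
  then show ?thesis using n F x depth_eq[OF facet_flat[OF F], of p x]
    unfolding outward_normals_def by (metis inner_minus_right minus_diff_eq neg_0_le_iff_le)
qed

lemma interior_depth_pos: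
  assumes F: "F facet_of K" and x: "x \<in> interior K"
  shows "0 < depth (n F) F x"
proof -
  obtain e where e: "e > 0" "cball x e \<subseteq> K" using x mem_interior_cball by blast
  have "x + e *\<^sub>R n F \<in> K" using e norm_outward[OF F] by (auto simp: dist_norm subset_iff)
  then have "0 \<le> depth (n F) F (x + e *\<^sub>R n F)" by (rule depth_nonneg[OF F])
  then show ?thesis using e depth_normal[OF norm_outward[OF F]] by simp
qed

text \<open>The supporting hyperplane cuts K in a face that contains F and misses the interior. A
  proper face has dimension at most that of a facet, so it cannot be larger than F.\<close>

lemma facet_eq_depth_zero:
  assumes F: "F facet_of K"
  shows "F = {x \<in> K. depth (n F) F x = 0}"
proof -
  obtain p where p: "p \<in> F" using F by (auto simp: facet_of_def)
  have de: "depth (n F) F x = n F \<bullet> p - n F \<bullet> x" for x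
    using depth_eq[OF facet_flat[OF F] p] by (simp add: inner_diff_right)
  let ?G = "K \<inter> {x. n F \<bullet> x = n F \<bullet> p}"
  have G: "?G face_of K"
    using depth_nonneg[OF F] de polytope_imp_convex[OF K]
    by (intro face_of_Int_supporting_hyperplane_le) auto
  have FG: "F \<subseteq> ?G"
  proof
    fix x assume x: "x \<in> F"
    then show "x \<in> ?G" using facet_of_imp_subset[OF F] depth_on_face[OF facet_flat[OF F] x] de[of x] by auto
  qed
  have "?G \<noteq> K"
  proof
    assume eq: "?G = K"
    obtain z where z: "z \<in> interior K" using int by blast
    then have "z \<in> ?G" using eq interior_subset by blast
    then show False using interior_depth_pos[OF F z] de[of z] by simp
  qed
  then have lt: "aff_dim ?G < aff_dim K" using face_of_aff_dim_lt polytope_imp_convex[OF K] G by blast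
  have fG: "F face_of ?G" using F FG G facet_of_def
    by (metis face_of_imp_subset face_of_subset)
  have "F = ?G"
  proof (rule ccontr)
    assume "F \<noteq> ?G"
    then have "aff_dim F < aff_dim ?G"
      using face_of_aff_dim_lt[OF _ fG] G polytope_imp_convex[OF K] face_of_imp_convex by blast
    then show False using lt F by (simp add: facet_of_def)
  qed
  moreover have "?G = {x \<in> K. depth (n F) F x = 0}" using de by auto
  ultimately show ?thesis by (rule trans)
qed

lemma mem_facet_iff: "F facet_of K \<Longrightarrow> x \<in> F \<longleftrightarrow> x \<in> K \<and> depth (n F) F x = 0"
  by (subst facet_eq_depth_zero) auto

text \<open>The half-space description of K. A segment from an interior point to a point outside
  would leave K through some facet; the depth below that facet is affine along the segment, positive
  at the start and nonnegative at the end, hence positive at the crossing, where it should be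
  zero.\<close>

lemma mem_polytope_depth:
  assumes x: "\<And>F. F facet_of K \<Longrightarrow> 0 \<le> depth (n F) F x"
  shows "x \<in> K"
proof (rule ccontr)
  assume xK: "x \<notin> K"
  obtain z where z: "z \<in> interior K" using int by blast
  have "closed_segment z x \<inter> frontier K \<noteq> {}"
    using z interior_subset xK by (intro connected_Int_frontier) auto
  then obtain y where y: "y \<in> closed_segment z x" "y \<in> frontier K" by blast
  have "frontier K = \<Union>{F. F facet_of K}"
    using rel_frontier_of_polyhedron[OF polytope_imp_polyhedron[OF K]]
      rel_frontier_nonempty_interior[OF int] by simp
  then obtain F where F: "F facet_of K" "y \<in> F" using y by blast
  obtain u where u: "0 \<le> u" "u \<le> 1" "y = (1 - u) *\<^sub>R z + u *\<^sub>R x"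
    using y(1) by (auto simp: in_segment)
  have "u \<noteq> 1" using u xK F facet_of_imp_subset by fastforce
  have "depth (n F) F y = (1 - u) * depth (n F) F z + u * depth (n F) F x"
    unfolding u(3) depth_def by (simp add: algebra_simps inner_diff_right inner_add_right)
  moreover have "(1 - u) * depth (n F) F z > 0"
    using u \<open>u \<noteq> 1\<close> interior_depth_pos[OF F(1) z] by simp
  moreover have "u * depth (n F) F x \<ge> 0" using u x[OF F(1)] by simp
  ultimately show False using depth_on_face[OF facet_flat[OF F(1)] F(2)] by linarith
qed

lemma interior_polytope_depth:
  "interior K = {x. \<forall>F. F facet_of K \<longrightarrow> 0 < depth (n F) F x}" (is "_ = ?U")
proof
  show "interior K \<subseteq> ?U" using interior_depth_pos by blast
  have eq: "?U = (\<Inter>F\<in>{F. F facet_of K}. {x. 0 < depth (n F) F x})" by auto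
  have "open ?U" unfolding eq
    using finite_polytope_facets[OF K] by (intro open_INT ballI open_Collect_less continuous_intros)
  moreover have "?U \<subseteq> K" by (auto intro: mem_polytope_depth less_imp_le)
  ultimately show "?U \<subseteq> interior K" by (simp add: interior_maximal)
qed

text \<open>The points whose foot on F lies in the hyperplane of G form a hyperplane, normal to the
  part of \<open>n G\<close> tangential to F, unless the two facets are parallel. Thus almost
  everywhere in the layer over F the cutoff factors of the other facets tend to 1.\<close>

lemma AE_foot_in_one_facet:
  assumes F: "F facet_of K" and G: "G facet_of K" and ne: "F \<noteq> G"
  shows "AE x in lborel. foot (n F) F x \<in> F \<longrightarrow> 0 < depth (n G) G (foot (n F) F x)"
proof -
  let ?c = "n G \<bullet> n F" and ?v = "n G - (n G \<bullet> n F) *\<^sub>R n F"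
  have FK: "F \<subseteq> K" by (rule facet_of_imp_subset[OF F])
  have "AE x in lborel. foot (n F) F x \<in> F \<longrightarrow> depth (n G) G (foot (n F) F x) \<noteq> 0"
  proof (cases "?v = 0")
    case False
    let ?p = "SOME p. p \<in> F" and ?q = "SOME q. q \<in> G"
    have "depth (n G) G (foot (n F) F x) = n G \<bullet> ?q - ?c * (n F \<bullet> ?p) - ?v \<bullet> x" for x
      unfolding foot_def depth_add by (simp add: depth_def algebra_simps inner_diff_right inner_diff_left)
    moreover have "AE x in lborel. ?v \<bullet> x \<noteq> n G \<bullet> ?q - ?c * (n F \<bullet> ?p)"
      by (rule AE_lborel_hyperplane[OF False])
    ultimately show ?thesis by (auto elim: eventually_mono)
  next
    case True
    then have nG: "n G = ?c *\<^sub>R n F" by simp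
    then have "\<bar>?c\<bar> = 1" using norm_outward[OF F] norm_outward[OF G]
      by (metis mult.right_neutral norm_scaleR)
    have "depth (n G) G y \<noteq> 0" if y: "y \<in> F" for y
    proof
      assume "depth (n G) G y = 0"
      then have yG: "y \<in> G" using facet_eq_depth_zero[OF G] y FK by blast
      have dG: "depth (n G) G z = ?c * depth (n F) F z" for z
        using depth_eq[OF facet_flat[OF F] y] depth_eq[OF facet_flat[OF G] yG] nG
        by (metis inner_scaleR_left)
      \<comment> \<open>Parallel facets with a common point span the same hyperplane; comparing the
        depths of an interior point rules out opposite normals, and then F = G.\<close>
      obtain z where z: "z \<in> interior K" using int by blast
      have "?c > 0" using interior_depth_pos[OF F z] interior_depth_pos[OF G z] dG
        by (metis zero_less_mult_pos2)
      then have "F = G" using facet_eq_depth_zero[OF F] facet_eq_depth_zero[OF G] dG by auto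
      then show False using ne by simp
    qed
    then show ?thesis by auto
  qed
  then show ?thesis
  proof eventually_elim
    fix x assume *: "foot (n F) F x \<in> F \<longrightarrow> depth (n G) G (foot (n F) F x) \<noteq> 0"
    show "foot (n F) F x \<in> F \<longrightarrow> 0 < depth (n G) G (foot (n F) F x)"
      using * depth_nonneg[OF G, of "foot (n F) F x"] FK by auto
  qed
qed

end

subsection \<open>The divergence theorem on polytopes\<close>

definition ramp :: "real \<Rightarrow> real" where
  "ramp s = min 1 (max 0 s)"

lemma ramp_bounds: "0 \<le> ramp s" "ramp s \<le> 1" "\<bar>ramp s\<bar> \<le> 1"
  by (auto simp: ramp_def)

lemma ramp_lipschitz: "\<bar>ramp s - ramp t\<bar> \<le> \<bar>s - t\<bar>"
  by (auto simp: ramp_def)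

lemma continuous_on_ramp [continuous_intros]:
  "continuous_on S f \<Longrightarrow> continuous_on S (\<lambda>x. ramp (f x))"
  unfolding ramp_def by (intro continuous_intros)

text \<open>The argument grows like a multiple of N, so the ramp is eventually equal to 1. The
  sequence t may vary because the ramps are evaluated at moving points.\<close>

lemma ramp_scaled_tendsto:
  assumes "t \<longlonglongrightarrow> l" "0 < l"
  shows "(\<lambda>N. ramp (real (Suc N) * t N)) \<longlonglongrightarrow> 1"
proof -
  have 1: "eventually (\<lambda>N. l / 2 < t N) sequentially"
    using assms by (intro order_tendstoD(1)) auto
  obtain M :: nat where M: "2 / l < M" using reals_Archimedean2 by blast
  have 2: "eventually (\<lambda>N. ramp (real (Suc N) * t N) = 1) sequentially"
    using 1 eventually_ge_at_top[of M]
  proof eventually_elim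
    fix N assume N: "l / 2 < t N" "M \<le> N"
    have "1 = (2 / l) * (l / 2)" using assms by simp
    also have "\<dots> \<le> real (Suc N) * t N" using N M assms by (intro mult_mono) auto
    finally show "ramp (real (Suc N) * t N) = 1" by (simp add: ramp_def)
  qed
  then show ?thesis by (rule tendsto_eventually)
qed

lemma ramp_has_derivative:
  assumes "0 < a" "a \<noteq> 1"
  shows "((\<lambda>t. ramp (a - t * b)) has_real_derivative (if a < 1 then - b else 0)) (at 0)"
proof (cases "a < 1")
  case True
  have "((\<lambda>t. a - t * b) has_real_derivative - b) (at 0)" by (auto intro!: derivative_eq_intros)
  then have "((\<lambda>t. ramp (a - t * b)) has_real_derivative - b) (at 0)"
  proof (rule has_field_derivative_transform_within_open)
    show "open ((\<lambda>t. a - t * b) -` {0<..<1})" by (auto intro!: open_vimage continuous_intros)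
  qed (use assms True in \<open>auto simp: ramp_def\<close>)
  then show ?thesis using True by simp
next
  case False
  have "((\<lambda>t. 1) has_real_derivative 0) (at 0)" by auto
  then have "((\<lambda>t. ramp (a - t * b)) has_real_derivative 0) (at 0)"
  proof (rule has_field_derivative_transform_within_open)
    show "open ((\<lambda>t. a - t * b) -` {1<..})" by (auto intro!: open_vimage continuous_intros)
  qed (use assms False in \<open>auto simp: ramp_def\<close>)
  then show ?thesis using False by simp
qed

section \<open>Cutoff integrals on one polytope and their limits\<close>

context
  fixes K :: "(real^'n::finite) set" and n :: "(real^'n) set \<Rightarrow> real^'n"
    and u :: "real^'n \<Rightarrow> real" and G :: "real^'n \<Rightarrow> real^'n"
  assumes K: "polytope K" and int: "interior K \<noteq> {}" and n: "outward_normals K n"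
    and u: "\<And>x. x \<in> K \<Longrightarrow> (u has_derivative (\<lambda>h. G x \<bullet> h)) (at x within K)"
    and G: "continuous_on K G"
begin

text \<open>Zero outside K, and equal to 1 wherever all depths are at least
  \<open>1 / Suc N\<close>; \<open>Suc N\<close> keeps the slope positive for every index.\<close>

definition cutoff :: "nat \<Rightarrow> real^'n \<Rightarrow> real" where
  "cutoff N x = (\<Prod>F | F facet_of K. ramp (Suc N * depth (n F) F x))"

text \<open>The factor that the product rule leaves when the ramp of F is differentiated.\<close>

definition cutoff_except :: "nat \<Rightarrow> (real^'n) set \<Rightarrow> real^'n \<Rightarrow> real" where
  "cutoff_except N F x = (\<Prod>H\<in>{H. H facet_of K} - {F}. ramp (Suc N * depth (n H) H x))"

text \<open>Outside K nothing is known about u. Composing with the nearest-point projection yields a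
  bounded function on the whole space that is still Lipschitz, so its product with the cutoff is
  globally Lipschitz.\<close>

definition extension :: "real^'n \<Rightarrow> real" where
  "extension x = u (closest_point K x)"

lemma finite_facets: "finite {F. F facet_of K}"
  by (rule finite_polytope_facets[OF K])

lemma compact_K: "compact K" and closed_K: "closed K" and convex_K: "convex K" and nonempty_K: "K \<noteq> {}"
  using K int interior_subset by (auto simp: polytope_imp_compact polytope_imp_closed polytope_imp_convex)

lemma extension_eq: "x \<in> K \<Longrightarrow> extension x = u x"
  by (simp add: extension_def closest_point_self)

lemma continuous_u: "continuous_on K u"
  using u has_derivative_continuous continuous_on_eq_continuous_within by blast

lemma continuous_extension: "continuous_on S extension"
proof -
  have "continuous_on UNIV (\<lambda>x. u (closest_point K x))"
    by (rule continuous_on_compose2[OF continuous_u continuous_on_closest_point[OF convex_K closed_K nonempty_K]])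
      (auto intro: closest_point_in_set[OF closed_K nonempty_K])
  then show ?thesis by (auto simp: extension_def[abs_def] intro: continuous_on_subset)
qed

lemma extension_bounded: "\<exists>C\<ge>0. \<forall>x. \<bar>extension x\<bar> \<le> C"
proof -
  have "bounded (u ` K)"
    by (intro compact_imp_bounded compact_continuous_image continuous_u compact_K)
  then obtain C where C: "\<And>x. x \<in> K \<Longrightarrow> \<bar>u x\<bar> \<le> C" by (auto simp: bounded_iff)
  have "\<bar>extension x\<bar> \<le> C" for x
    unfolding extension_def by (intro C closest_point_in_set closed_K nonempty_K)
  then show ?thesis by (metis abs_ge_zero order_trans)
qed

text \<open>The gradient is bounded on the compact convex K, which gives a Lipschitz bound for u by
  the mean value inequality; the projection is nonexpansive.\<close>

lemma extension_lipschitz: "\<exists>L\<ge>0. \<forall>x y. \<bar>extension x - extension y\<bar> \<le> L * norm (x - y)"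
proof -
  have "bounded (G ` K)"
    by (intro compact_imp_bounded compact_continuous_image G compact_K)
  then obtain L where L: "\<And>x. x \<in> K \<Longrightarrow> norm (G x) \<le> L" by (auto simp: bounded_iff)
  have L0: "0 \<le> L" using L nonempty_K norm_ge_zero order_trans by blast
  have lip: "norm (u x - u y) \<le> L * norm (x - y)" if "x \<in> K" "y \<in> K" for x y
  proof (rule differentiable_bound[OF convex_K u _ that])
    show "onorm (\<lambda>h. G z \<bullet> h) \<le> L" if "z \<in> K" for z
    proof (rule onorm_le)
      fix h
      have "norm (G z \<bullet> h) \<le> norm (G z) * norm h" using Cauchy_Schwarz_ineq2 by auto
      also have "\<dots> \<le> L * norm h" using L[OF that] by (intro mult_right_mono) auto
      finally show "norm (G z \<bullet> h) \<le> L * norm h" .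
    qed
  qed
  have "\<bar>extension x - extension y\<bar> \<le> L * norm (x - y)" for x y
  proof -
    have "\<bar>extension x - extension y\<bar> \<le> L * norm (closest_point K x - closest_point K y)"
      using lip[of "closest_point K x" "closest_point K y"]
      by (simp add: extension_def closest_point_in_set closed_K nonempty_K)
    also have "\<dots> \<le> L * norm (x - y)"
      using closest_point_lipschitz[OF convex_K closed_K nonempty_K] L0
      by (intro mult_left_mono) (auto simp: dist_norm)
    finally show ?thesis .
  qed
  then show ?thesis using L0 by blast
qed

lemma cutoff_bounds: "\<bar>cutoff N x\<bar> \<le> 1" "\<bar>cutoff_except N F x\<bar> \<le> 1"
  unfolding cutoff_def cutoff_except_def abs_prod by (auto intro!: prod_le_1 simp: ramp_bounds)

lemma cutoff_outside: "x \<notin> K \<Longrightarrow> cutoff N x = 0"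
proof -
  assume "x \<notin> K"
  then obtain F where F: "F facet_of K" "depth (n F) F x < 0"
    using mem_polytope_depth[OF K int n] not_le by blast
  have "ramp (Suc N * depth (n F) F x) = 0"
    using F(2) mult_pos_neg[of "real (Suc N)" "depth (n F) F x"] by (simp add: ramp_def)
  then show ?thesis unfolding cutoff_def using finite_facets F(1) by (intro prod_zero) auto
qed

lemma continuous_cutoff: "continuous_on S (cutoff N)" "continuous_on S (cutoff_except N F)"
  unfolding cutoff_def[abs_def] cutoff_except_def[abs_def]
  by (intro continuous_intros)+

lemma cutoff_lipschitz:
  "\<bar>cutoff N x - cutoff N y\<bar> \<le> (real (card {F. F facet_of K}) * Suc N) * norm (x - y)"
proof -
  have "\<bar>cutoff N x - cutoff N y\<bar>
      \<le> (\<Sum>F | F facet_of K. \<bar>ramp (Suc N * depth (n F) F x) - ramp (Suc N * depth (n F) F y)\<bar>)"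
    unfolding cutoff_def using norm_prod_diff[of "{F. F facet_of K}"
      "\<lambda>F. ramp (Suc N * depth (n F) F x)" "\<lambda>F. ramp (Suc N * depth (n F) F y)"] ramp_bounds by simp
  also have "\<dots> \<le> (\<Sum>F | F facet_of K. Suc N * norm (x - y))"
  proof (rule sum_mono)
    fix F assume "F \<in> {F. F facet_of K}"
    then have nF: "norm (n F) = 1" using norm_outward[OF K int n] by simp
    have "\<bar>ramp (Suc N * depth (n F) F x) - ramp (Suc N * depth (n F) F y)\<bar>
        \<le> \<bar>Suc N * depth (n F) F x - Suc N * depth (n F) F y\<bar>" by (rule ramp_lipschitz)
    also have "\<dots> = Suc N * \<bar>n F \<bullet> (x - y)\<bar>"
      unfolding right_diff_distrib[symmetric] abs_mult
      by (simp add: depth_def inner_diff_right abs_minus_commute)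
    also have "\<dots> \<le> Suc N * norm (x - y)"
      using Cauchy_Schwarz_ineq2[of "n F" "x - y"] nF by (intro mult_left_mono) auto
    finally show "\<bar>ramp (Suc N * depth (n F) F x) - ramp (Suc N * depth (n F) F y)\<bar> \<le> Suc N * norm (x - y)" .
  qed
  finally show ?thesis by (simp add: mult.assoc)
qed

lemma cut_extension_lipschitz:
  "\<exists>L. \<forall>x y. \<bar>cutoff N x * extension x - cutoff N y * extension y\<bar> \<le> L * norm (x - y)"
proof -
  obtain C where C: "C \<ge> 0" "\<And>x. \<bar>extension x\<bar> \<le> C" using extension_bounded by blast
  obtain L where L: "L \<ge> 0" "\<And>x y. \<bar>extension x - extension y\<bar> \<le> L * norm (x - y)"
    using extension_lipschitz by blast
  let ?M = "real (card {F. F facet_of K}) * Suc N"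
  have "\<bar>cutoff N x * extension x - cutoff N y * extension y\<bar> \<le> (L + ?M * C) * norm (x - y)" for x y
  proof -
    have "cutoff N x * extension x - cutoff N y * extension y
        = cutoff N x * (extension x - extension y) + (cutoff N x - cutoff N y) * extension y"
      by (simp add: algebra_simps)
    also have "\<bar>\<dots>\<bar> \<le> \<bar>cutoff N x\<bar> * \<bar>extension x - extension y\<bar> + \<bar>cutoff N x - cutoff N y\<bar> * \<bar>extension y\<bar>"
      using abs_triangle_ineq by (simp add: abs_mult[symmetric])
    also have "\<dots> \<le> 1 * (L * norm (x - y)) + (?M * norm (x - y)) * C"
      using cutoff_bounds C L cutoff_lipschitz by (intro add_mono mult_mono) auto
    finally show ?thesis by (simp add: algebra_simps)
  qed
  then show ?thesis by blast
qed

text \<open>The product rule for \<open>cutoff N x * extension x\<close> in direction e. The facet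
  terms carry a minus sign because depth decreases along the outward normal, and each lives where
  the ramp of its facet has not yet reached 1.\<close>

definition cut_derivative :: "nat \<Rightarrow> real^'n \<Rightarrow> real^'n \<Rightarrow> real" where
  "cut_derivative N e x = indicator K x * (cutoff N x * (G x \<bullet> e))
     - (\<Sum>F | F facet_of K. (n F \<bullet> e) * (Suc N *
         (indicator {x. 0 \<le> depth (n F) F x \<and> depth (n F) F x < 1 / Suc N} x *
           (indicator K x * (extension x * cutoff_except N F x)))))"

text \<open>The excluded points are the frontier of K and the upper kinks of the ramps, all
  contained in null sets.\<close>

lemma cut_extension_has_derivative:
  assumes x: "x \<notin> frontier K" "\<And>F. F facet_of K \<Longrightarrow> depth (n F) F x \<noteq> 1 / Suc N"
  shows "((\<lambda>t. cutoff N (x + t *\<^sub>R e) * extension (x + t *\<^sub>R e)) has_real_derivative cut_derivative N e x) (at 0)"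
proof (cases "x \<in> K")
  case False
  have "((\<lambda>t. 0) has_real_derivative 0) (at 0)" by simp
  then have "((\<lambda>t. cutoff N (x + t *\<^sub>R e) * extension (x + t *\<^sub>R e)) has_real_derivative 0) (at 0)"
  proof (rule has_field_derivative_transform_within_open)
    show "open ((\<lambda>t. x + t *\<^sub>R e) -` (- K))" using closed_K by (auto intro!: open_vimage continuous_intros)
  qed (use False in \<open>auto simp: cutoff_outside\<close>)
  then show ?thesis using False by (simp add: cut_derivative_def)
next
  case True
  then have xi: "x \<in> interior K" using x(1) closed_K by (simp add: frontier_def)
  have pos: "0 < depth (n F) F x" if "F facet_of K" for F
    using interior_depth_pos[OF K int n that xi] .
  let ?I = "(\<lambda>t. x + t *\<^sub>R e) -` interior K"
  have oI: "open ?I" by (auto intro!: open_vimage continuous_intros)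
  have du: "((\<lambda>t. u (x + t *\<^sub>R e)) has_real_derivative (G x \<bullet> e)) (at 0)"
  proof -
    have 1: "(u has_derivative (\<lambda>h. G x \<bullet> h)) (at (x + 0 *\<^sub>R e))"
      using u[OF True] at_within_interior[OF xi] by simp
    have 2: "((\<lambda>t. x + t *\<^sub>R e) has_derivative (\<lambda>t. t *\<^sub>R e)) (at 0)"
      by (auto intro!: derivative_eq_intros)
    have "((\<lambda>t. u (x + t *\<^sub>R e)) has_derivative (\<lambda>t. G x \<bullet> (t *\<^sub>R e))) (at 0)"
      by (rule has_derivative_compose[OF 2 1])
    then show ?thesis by (simp add: has_field_derivative_def mult.commute[of _ "G x \<bullet> e"])
  qed
  have dext: "((\<lambda>t. extension (x + t *\<^sub>R e)) has_real_derivative (G x \<bullet> e)) (at 0)"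
    using du oI by (rule has_field_derivative_transform_within_open)
      (use xi interior_subset[of K] in \<open>auto simp: extension_eq subset_iff\<close>)
  define c where "c F = (if depth (n F) F x < 1 / Suc N then - (Suc N * (n F \<bullet> e)) else 0)" for F
  have dr: "((\<lambda>t. ramp (Suc N * depth (n F) F (x + t *\<^sub>R e))) has_real_derivative c F) (at 0)"
    if F: "F facet_of K" for F
  proof -
    have "((\<lambda>t. ramp (Suc N * depth (n F) F x - t * (Suc N * (n F \<bullet> e)))) has_real_derivative
        (if Suc N * depth (n F) F x < 1 then - (Suc N * (n F \<bullet> e)) else 0)) (at 0)"
    proof (rule ramp_has_derivative)
      show "0 < Suc N * depth (n F) F x" using pos[OF F] by simp
      show "Suc N * depth (n F) F x \<noteq> 1" using x(2)[OF F] by (auto simp: field_simps)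
    qed
    moreover have "Suc N * depth (n F) F x < 1 \<longleftrightarrow> depth (n F) F x < 1 / Suc N"
      by (auto simp: field_simps)
    moreover have "Suc N * depth (n F) F x - t * (Suc N * (n F \<bullet> e)) = Suc N * depth (n F) F (x + t *\<^sub>R e)" for t
      by (simp add: depth_add algebra_simps)
    ultimately show ?thesis by (simp only: c_def)
  qed
  have dc: "((\<lambda>t. cutoff N (x + t *\<^sub>R e)) has_real_derivative (\<Sum>F | F facet_of K. c F * cutoff_except N F x)) (at 0)"
  proof -
    have "((\<lambda>t. \<Prod>F | F facet_of K. ramp (Suc N * depth (n F) F (x + t *\<^sub>R e))) has_derivative
      (\<lambda>t. \<Sum>F | F facet_of K. (c F * t) * (\<Prod>H\<in>{H. H facet_of K} - {F}. ramp (Suc N * depth (n H) H (x + 0 *\<^sub>R e))))) (at 0)"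
      by (rule has_derivative_prod) (use dr in \<open>simp add: has_field_derivative_def\<close>)
    moreover have "(\<lambda>t. \<Sum>F | F facet_of K. (c F * t) * (\<Prod>H\<in>{H. H facet_of K} - {F}. ramp (Suc N * depth (n H) H (x + 0 *\<^sub>R e))))
        = (*) (\<Sum>F | F facet_of K. c F * cutoff_except N F x)"
      by (rule ext) (simp add: cutoff_except_def sum_distrib_right sum_distrib_left mult_ac)
    ultimately show ?thesis
      unfolding has_field_derivative_def cutoff_def by (simp only:)
  qed
  have "((\<lambda>t. cutoff N (x + t *\<^sub>R e) * extension (x + t *\<^sub>R e)) has_real_derivative
      ((\<Sum>F | F facet_of K. c F * cutoff_except N F x) * extension (x + 0 *\<^sub>R e)
        + (G x \<bullet> e) * cutoff N (x + 0 *\<^sub>R e))) (at 0)"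
    by (rule DERIV_mult[OF dc dext])
  moreover have "(\<Sum>F | F facet_of K. c F * cutoff_except N F x) * extension (x + 0 *\<^sub>R e)
        + (G x \<bullet> e) * cutoff N (x + 0 *\<^sub>R e) = cut_derivative N e x"
  proof -
    have "(\<Sum>F | F facet_of K. c F * cutoff_except N F x) * extension x
      = (\<Sum>F | F facet_of K. - ((n F \<bullet> e) * (Suc N *
         (indicator {x. 0 \<le> depth (n F) F x \<and> depth (n F) F x < 1 / Suc N} x *
           (indicator K x * (extension x * cutoff_except N F x))))))"
      unfolding sum_distrib_right
      by (rule sum.cong) (use True pos in \<open>auto simp: c_def indicator_def less_imp_le\<close>)
    then show ?thesis using True by (simp add: cut_derivative_def sum_negf mult.commute)
  qed
  ultimately show ?thesis by simp
qed

lemma borel_K: "K \<in> sets borel" using closed_K by simp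

lemma measurable_parts [measurable]:
  "cutoff N \<in> borel_measurable borel" "cutoff_except N F \<in> borel_measurable borel"
  "extension \<in> borel_measurable borel" "K \<in> sets borel"
  using borel_K by (auto intro!: borel_measurable_continuous_onI continuous_cutoff continuous_extension)

lemma measurable_gradient [measurable]: "(\<lambda>x. indicator K x * (G x \<bullet> e)) \<in> borel_measurable borel"
  using borel_measurable_continuous_on_indicator[OF borel_K, of "\<lambda>x. G x \<bullet> e"] G
  by (simp add: continuous_intros)

lemma integrable_gradient_part: "integrable lborel (\<lambda>x. indicator K x * (cutoff N x * (G x \<bullet> e)))"
  using borel_integrable_compact[OF compact_K, of "\<lambda>x. cutoff N x * (G x \<bullet> e)"]
  by (simp add: continuous_intros G continuous_cutoff)

lemma integrable_facet_part: "integrable lborel (\<lambda>x.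
    indicator {x. 0 \<le> depth (n F) F x \<and> depth (n F) F x < 1 / Suc N} x *
           (indicator K x * (extension x * cutoff_except N F x)))"
proof -
  have "integrable lborel (\<lambda>x. indicator K x * (extension x * cutoff_except N F x))"
    using borel_integrable_compact[OF compact_K, of "\<lambda>x. extension x * cutoff_except N F x"]
    by (simp add: continuous_intros continuous_extension continuous_cutoff)
  from integrable_mult_indicator[OF _ this, of "{x. 0 \<le> depth (n F) F x \<and> depth (n F) F x < 1 / Suc N}"]
  show ?thesis by simp
qed

text \<open>The integral of \<open>cut_derivative\<close> is zero, and its two parts are separated.
  This is the divergence theorem before the limit, with layers in place of facets.\<close>

lemma cut_integral_identity:
  "(LINT x|lborel. indicator K x * (cutoff N x * (G x \<bullet> e)))
    = (\<Sum>F | F facet_of K. (n F \<bullet> e) * (Suc N * (LINT x|lborel.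
         indicator {x. 0 \<le> depth (n F) F x \<and> depth (n F) F x < 1 / Suc N} x *
           (indicator K x * (extension x * cutoff_except N F x)))))"
proof -
  obtain L where L: "\<And>x y. \<bar>cutoff N x * extension x - cutoff N y * extension y\<bar> \<le> L * norm (x - y)"
    using cut_extension_lipschitz by blast
  obtain R where R: "\<And>x. x \<in> K \<Longrightarrow> norm x \<le> R"
    using compact_K compact_imp_bounded bounded_iff by metis
  have "(LINT x|lborel. cut_derivative N e x) = 0"
  proof (rule integral_directional_derivative_zero[OF L])
    show "cutoff N x * extension x = 0" if "norm x > R" for x
      using that R[of x] cutoff_outside[of x N] by force
    have "(\<lambda>x. indicator K x * (cutoff N x * (G x \<bullet> e))) \<in> borel_measurable borel"
      using borel_measurable_integrable[OF integrable_gradient_part] by simp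
    moreover have "(\<lambda>x. (n F \<bullet> e) * (Suc N * (indicator {x. 0 \<le> depth (n F) F x \<and> depth (n F) F x < 1 / Suc N} x *
           (indicator K x * (extension x * cutoff_except N F x))))) \<in> borel_measurable borel" for F
      using borel_measurable_integrable[OF integrable_facet_part[of F N]]
      by (intro borel_measurable_times[OF borel_measurable_const borel_measurable_times[OF borel_measurable_const]]) simp
    ultimately show "cut_derivative N e \<in> borel_measurable borel"
      unfolding cut_derivative_def[abs_def]
      by (rule borel_measurable_diff[OF _ borel_measurable_sum])
    have "AE x in lborel. x \<notin> frontier K"
      by (rule AE_lborel_negligible) (auto simp: negligible_convex_frontier convex_K)
    moreover have "AE x in lborel. \<forall>F\<in>{F. F facet_of K}. depth (n F) F x \<noteq> 1 / Suc N"
      using finite_facets norm_outward[OF K int n] by (intro AE_finite_allI AE_depth_neq) force+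
    ultimately show "AE x in lborel. ((\<lambda>t. cutoff N (x + t *\<^sub>R e) * extension (x + t *\<^sub>R e))
        has_real_derivative cut_derivative N e x) (at 0)"
      by eventually_elim (rule cut_extension_has_derivative, auto)
  qed
  moreover have "(LINT x|lborel. cut_derivative N e x) =
      (LINT x|lborel. indicator K x * (cutoff N x * (G x \<bullet> e)))
    - (\<Sum>F | F facet_of K. (n F \<bullet> e) * (Suc N * (LINT x|lborel.
         indicator {x. 0 \<le> depth (n F) F x \<and> depth (n F) F x < 1 / Suc N} x *
           (indicator K x * (extension x * cutoff_except N F x)))))"
    unfolding cut_derivative_def
    by (subst Bochner_Integration.integral_diff, rule integrable_gradient_part,
      intro Bochner_Integration.integrable_sum integrable_mult_right integrable_facet_part,
      subst Bochner_Integration.integral_sum, intro integrable_mult_right integrable_facet_part,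
      subst integral_mult_right_zero, subst integral_mult_right_zero, rule refl)
  ultimately show ?thesis by simp
qed

text \<open>At an interior point all depths are positive, so every ramp eventually equals 1; the
  frontier is a null set.\<close>

lemma gradient_part_limit:
  "(\<lambda>N. LINT x|lborel. indicator K x * (cutoff N x * (G x \<bullet> e))) \<longlonglongrightarrow> (LINT x|lborel. indicator K x * (G x \<bullet> e))"
proof (rule integral_dominated_convergence)
  show "integrable lborel (\<lambda>x. indicator K x * \<bar>G x \<bullet> e\<bar>)"
    using borel_integrable_compact[OF compact_K, of "\<lambda>x. \<bar>G x \<bullet> e\<bar>"] G by (simp add: continuous_intros)
  show "(\<lambda>x. indicator K x * (G x \<bullet> e)) \<in> borel_measurable lborel" by simp
  show "(\<lambda>x. indicator K x * (cutoff N x * (G x \<bullet> e))) \<in> borel_measurable lborel" for N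
    using borel_measurable_integrable[OF integrable_gradient_part] .
  show "AE x in lborel. norm (indicator K x * (cutoff N x * (G x \<bullet> e))) \<le> indicator K x * \<bar>G x \<bullet> e\<bar>" for N
    using cutoff_bounds(1) by (intro AE_I2) (auto simp: abs_mult indicator_def intro: mult_left_le_one_le)
  have "AE x in lborel. x \<notin> frontier K"
    by (rule AE_lborel_negligible) (auto simp: negligible_convex_frontier convex_K)
  then show "AE x in lborel. (\<lambda>N. indicator K x * (cutoff N x * (G x \<bullet> e))) \<longlonglongrightarrow> indicator K x * (G x \<bullet> e)"
  proof eventually_elim
    fix x assume x: "x \<notin> frontier K"
    show "(\<lambda>N. indicator K x * (cutoff N x * (G x \<bullet> e))) \<longlonglongrightarrow> indicator K x * (G x \<bullet> e)"
    proof (cases "x \<in> K")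
      case True
      then have xi: "x \<in> interior K" using x closed_K by (simp add: frontier_def)
      have "(\<lambda>N. cutoff N x) \<longlonglongrightarrow> (\<Prod>F | F facet_of K. 1)" unfolding cutoff_def
        using interior_depth_pos[OF K int n _ xi] by (intro tendsto_prod ramp_scaled_tendsto[OF tendsto_const]) auto
      then have "(\<lambda>N. cutoff N x) \<longlonglongrightarrow> 1" by simp
      then have "(\<lambda>N. indicator K x * (cutoff N x * (G x \<bullet> e))) \<longlonglongrightarrow> indicator K x * (1 * (G x \<bullet> e))"
        by (intro tendsto_intros)
      then show ?thesis by simp
    qed simp
  qed
qed

lemma floor_div_tendsto: "(\<lambda>N. \<lfloor>real (Suc N) * s\<rfloor> / real (Suc N)) \<longlonglongrightarrow> s"
proof (rule tendsto_sandwich)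
  show "eventually (\<lambda>N. s - 1 / real (Suc N) \<le> \<lfloor>real (Suc N) * s\<rfloor> / real (Suc N)) sequentially"
  proof (rule always_eventually, rule allI)
    fix N
    have "real (Suc N) * s - 1 \<le> \<lfloor>real (Suc N) * s\<rfloor>" by linarith
    then have "(real (Suc N) * s - 1) / real (Suc N) \<le> \<lfloor>real (Suc N) * s\<rfloor> / real (Suc N)"
      by (intro divide_right_mono) auto
    then show "s - 1 / real (Suc N) \<le> \<lfloor>real (Suc N) * s\<rfloor> / real (Suc N)"
      by (simp add: diff_divide_distrib)
  qed
  show "eventually (\<lambda>N. \<lfloor>real (Suc N) * s\<rfloor> / real (Suc N) \<le> s) sequentially"
  proof (rule always_eventually, rule allI)
    fix N
    have "\<lfloor>real (Suc N) * s\<rfloor> \<le> real (Suc N) * s" by linarith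
    then show "\<lfloor>real (Suc N) * s\<rfloor> / real (Suc N) \<le> s" by (simp add: field_simps)
  qed
  have "(\<lambda>N. 1 / real (Suc N)) \<longlonglongrightarrow> 0" using LIMSEQ_inverse_real_of_nat by (simp add: inverse_eq_divide)
  then show "(\<lambda>N. s - 1 / real (Suc N)) \<longlonglongrightarrow> s" using tendsto_diff[OF tendsto_const[of s]] by fastforce
qed simp

text \<open>The shifted points converge to the foot of x. A foot outside F lies outside K too, since
  its depth is zero, and closedness of K makes the left side eventually zero. A foot in F that
  avoids the other facets has the shifted points eventually in K and the other ramps eventually
  equal to 1.\<close>

lemma facet_part_pointwise:
  assumes F: "F facet_of K" and s: "0 \<le> depth (n F) F x"
    and others: "\<And>H. H facet_of K \<Longrightarrow> H \<noteq> F \<Longrightarrow> foot (n F) F x \<in> F \<Longrightarrow> 0 < depth (n H) H (foot (n F) F x)"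
  defines "y N \<equiv> x + (\<lfloor>real (Suc N) * depth (n F) F x\<rfloor> / real (Suc N)) *\<^sub>R n F"
  shows "(\<lambda>N. indicator K (y N) * (extension (y N) * cutoff_except N F (y N)))
    \<longlonglongrightarrow> indicator F (foot (n F) F x) * u (foot (n F) F x)"
proof -
  let ?p = "foot (n F) F x"
  have nF: "norm (n F) = 1" using norm_outward[OF K int n F] .
  have y: "y \<longlonglongrightarrow> ?p"
    unfolding y_def[abs_def] foot_def by (intro tendsto_intros floor_div_tendsto)
  have dep: "(\<lambda>N. depth (n H) H (y N)) \<longlonglongrightarrow> depth (n H) H ?p" for H
    unfolding depth_def by (intro tendsto_intros y)
  show ?thesis
  proof (cases "?p \<in> F")
    case False
    have "?p \<notin> K" using False facet_eq_depth_zero[OF K int n F] depth_foot[OF nF] by blast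
    then have "eventually (\<lambda>N. y N \<in> - K) sequentially"
      using y closed_K by (intro topological_tendstoD) auto
    then have "eventually (\<lambda>N. indicator K (y N) * (extension (y N) * cutoff_except N F (y N)) = 0) sequentially"
      by eventually_elim simp
    then show ?thesis using False by (simp add: tendsto_eventually)
  next
    case True
    have "eventually (\<lambda>N. \<forall>H\<in>{H. H facet_of K} - {F}. 0 < depth (n H) H (y N)) sequentially"
      using finite_facets others True
      by (intro eventually_ball_finite ballI order_tendstoD(1)[OF dep]) auto
    then have "eventually (\<lambda>N. y N \<in> K) sequentially"
    proof eventually_elim
      fix N assume *: "\<forall>H\<in>{H. H facet_of K} - {F}. 0 < depth (n H) H (y N)"
      show "y N \<in> K"
      proof (rule mem_polytope_depth[OF K int n])
        fix H assume H: "H facet_of K"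
        show "0 \<le> depth (n H) H (y N)"
        proof (cases "H = F")
          case True
          \<comment> \<open>Rounding down shifts the point by at most its depth, so it does not pass
            through F.\<close>
          have "\<lfloor>real (Suc N) * depth (n F) F x\<rfloor> \<le> real (Suc N) * depth (n F) F x" by linarith
          then have "\<lfloor>real (Suc N) * depth (n F) F x\<rfloor> / real (Suc N) \<le> depth (n F) F x" by (simp add: field_simps)
          then show ?thesis using True by (simp add: y_def depth_normal[OF nF])
        next
          case False
          then show ?thesis using * H less_imp_le by blast
        qed
      qed
    qed
    then have 1: "(\<lambda>N. indicator K (y N) :: real) \<longlonglongrightarrow> 1"
      by (intro tendsto_eventually) (auto elim: eventually_mono)
    have 2: "(\<lambda>N. extension (y N)) \<longlonglongrightarrow> extension ?p"
      using continuous_extension[of UNIV] y by (simp add: continuous_on_eq_continuous_at isCont_tendsto_compose)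
    have 3: "(\<lambda>N. cutoff_except N F (y N)) \<longlonglongrightarrow> (\<Prod>H\<in>{H. H facet_of K} - {F}. 1)"
      unfolding cutoff_except_def using others True by (intro tendsto_prod ramp_scaled_tendsto[OF dep]) auto
    have "(\<lambda>N. indicator K (y N) * (extension (y N) * cutoff_except N F (y N))) \<longlonglongrightarrow> 1 * (extension ?p * (\<Prod>H\<in>{H. H facet_of K} - {F}. 1))"
      by (intro tendsto_mult 1 2 3)
    then show ?thesis using True facet_of_imp_subset[OF F] by (simp add: extension_eq subset_iff)
  qed
qed

lemma facet_part_limit:
  assumes F: "F facet_of K"
  shows "(\<lambda>N. Suc N * (LINT x|lborel.
         indicator {x. 0 \<le> depth (n F) F x \<and> depth (n F) F x < 1 / Suc N} x *
           (indicator K x * (extension x * cutoff_except N F x))))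
    \<longlonglongrightarrow> (LINT x:F|face_measure (n F) F. u x)"
proof -
  note flat = facet_flat[OF K int n F]
  have nF: "norm (n F) = 1" using norm_outward[OF K int n F] .
  have uF: "continuous_on F u" using continuous_u facet_of_imp_subset[OF F] continuous_on_subset by blast
  note m = measurable_on_face[OF flat uF]
  have gm: "(\<lambda>x. indicator F (foot (n F) F x) * u (foot (n F) F x)) \<in> borel_measurable borel"
    using measurable_compose[OF measurable_foot m] .
  obtain C where C: "C \<ge> 0" "\<And>x. \<bar>extension x\<bar> \<le> C" using extension_bounded by blast
  obtain R where R: "\<And>x. x \<in> K \<Longrightarrow> norm x \<le> R"
    using compact_K compact_imp_bounded bounded_iff by metis
  have "(\<lambda>N. Suc N * (LINT x|lborel.
         indicator {x. 0 \<le> depth (n F) F x \<and> depth (n F) F x < 1 / Suc N} x *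
           (indicator K x * (extension x * cutoff_except N F x))))
    \<longlonglongrightarrow> (LINT x|lborel. indicator {x. 0 \<le> depth (n F) F x \<and> depth (n F) F x < 1} x *
          (indicator F (foot (n F) F x) * u (foot (n F) F x)))"
  proof (rule integral_layer_limit[OF nF])
    show "(\<lambda>x. indicator K x * (extension x * cutoff_except N F x)) \<in> borel_measurable borel" for N
      by measurable
    show "\<bar>indicator K x * (extension x * cutoff_except N F x)\<bar> \<le> C" for N x
    proof -
      have "\<bar>indicator K x * (extension x * cutoff_except N F x)\<bar> \<le> 1 * (C * 1)"
        unfolding abs_mult using C cutoff_bounds(2) by (intro mult_mono) (auto simp: indicator_def)
      then show ?thesis by simp
    qed
    show "indicator K x * (extension x * cutoff_except N F x) = 0" if "norm x > R" for N x
      using R[of x] that by (auto simp: indicator_def)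
    show "(\<lambda>x. indicator {x. 0 \<le> depth (n F) F x \<and> depth (n F) F x < 1} x *
          (indicator F (foot (n F) F x) * u (foot (n F) F x))) \<in> borel_measurable borel"
      using gm by measurable
    have "AE x in lborel. \<forall>H\<in>{H. H facet_of K} - {F}. foot (n F) F x \<in> F \<longrightarrow> 0 < depth (n H) H (foot (n F) F x)"
      using finite_facets F by (intro AE_finite_allI AE_foot_in_one_facet[OF K int n]) auto
    then show "AE x in lborel. 0 \<le> depth (n F) F x \<longrightarrow> depth (n F) F x < 1 \<longrightarrow>
        (\<lambda>N. indicator K (x + (\<lfloor>Suc N * depth (n F) F x\<rfloor> / Suc N) *\<^sub>R n F) *
          (extension (x + (\<lfloor>Suc N * depth (n F) F x\<rfloor> / Suc N) *\<^sub>R n F) *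
           cutoff_except N F (x + (\<lfloor>Suc N * depth (n F) F x\<rfloor> / Suc N) *\<^sub>R n F)))
        \<longlonglongrightarrow> indicator F (foot (n F) F x) * u (foot (n F) F x)"
      by eventually_elim (intro impI facet_part_pointwise[OF F], auto)
  qed
  \<comment> \<open>The half-open layer of the tiling and the closed \<open>face_layer\<close>
    differ only within the hyperplane of depth 1.\<close>
  also have "(LINT x|lborel. indicator {x. 0 \<le> depth (n F) F x \<and> depth (n F) F x < 1} x *
          (indicator F (foot (n F) F x) * u (foot (n F) F x)))
      = (LINT x|lborel. indicator (face_layer (n F) F) x * u (foot (n F) F x))"
  proof (rule integral_cong_AE)
    show "(\<lambda>x. indicator {x. 0 \<le> depth (n F) F x \<and> depth (n F) F x < 1} x *
          (indicator F (foot (n F) F x) * u (foot (n F) F x))) \<in> borel_measurable lborel"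
      using gm by measurable
    show "(\<lambda>x. indicator (face_layer (n F) F) x * u (foot (n F) F x)) \<in> borel_measurable lborel"
      using prism_integrand_measurable[of "- n F" F u] flat uF
      by (simp add: face_layer_minus flat_face_minus foot_minus)
    have "n F \<noteq> 0" using nF by auto
    from AE_depth_neq[OF this, of F 1]
    show "AE x in lborel. indicator {x. 0 \<le> depth (n F) F x \<and> depth (n F) F x < 1} x *
          (indicator F (foot (n F) F x) * u (foot (n F) F x))
        = indicator (face_layer (n F) F) x * u (foot (n F) F x)"
      by eventually_elim (auto simp: indicator_def face_layer_def)
  qed
  finally show ?thesis by (simp only: face_integral_layer[OF flat uF])
qed

lemma gauss_directional:
  "(LINT x:K|lborel. G x \<bullet> e) = (\<Sum>F | F facet_of K. (n F \<bullet> e) * (LINT x:F|face_measure (n F) F. u x))"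
proof -
  have "(\<lambda>N. LINT x|lborel. indicator K x * (cutoff N x * (G x \<bullet> e)))
      \<longlonglongrightarrow> (\<Sum>F | F facet_of K. (n F \<bullet> e) * (LINT x:F|face_measure (n F) F. u x))"
    unfolding cut_integral_identity by (intro tendsto_sum tendsto_mult tendsto_const facet_part_limit) auto
  from LIMSEQ_unique[OF gradient_part_limit this] show ?thesis
    by (simp add: set_lebesgue_integral_def)
qed

end

text \<open>The witnesses of \<open>C1_up_to_boundary\<close> made explicit. On the boundary of K
  the field w is arbitrary, and all facet values are read off from g.\<close>

definition C1_extension ::
  "(real^'n::finite) set \<Rightarrow> (real^'n \<Rightarrow> real^'n) \<Rightarrow> (real^'n \<Rightarrow> real^'n) \<Rightarrow> (real^'n \<Rightarrow> real^'n^'n) \<Rightarrow> bool" where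
  "C1_extension K w g J \<longleftrightarrow>
     (\<forall>x\<in>interior K. g x = w x) \<and>
     (\<forall>x\<in>K. (g has_derivative (\<lambda>h. J x *v h)) (at x within K)) \<and> continuous_on K J"

lemma C1_extension_continuous: "C1_extension K w g J \<Longrightarrow> continuous_on K g"
  unfolding C1_extension_def using has_derivative_continuous continuous_on_eq_continuous_within by blast

text \<open>\<open>gauss_directional\<close> for the scalar \<phi> times the i-th component of g, in
  the i-th coordinate direction, summed over i. It serves twice: with concentrating bumps for the
  normal traces, and with the squared length of the velocity for the energy.\<close>

lemma gauss_weighted:
  fixes K :: "(real^'n::finite) set"
  assumes K: "polytope K" and int: "interior K \<noteq> {}" and n: "outward_normals K n"
    and g: "\<And>x. x \<in> K \<Longrightarrow> (g has_derivative (\<lambda>h. J x *v h)) (at x within K)" and J: "continuous_on K J"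
    and \<phi>: "\<And>x. x \<in> K \<Longrightarrow> (\<phi> has_derivative (\<lambda>h. P x \<bullet> h)) (at x within K)" and P: "continuous_on K P"
  shows "(LINT x:K|lborel. g x \<bullet> P x + trace (J x) * \<phi> x)
     = (\<Sum>F | F facet_of K. LINT x:F|face_measure (n F) F. (g x \<bullet> n F) * \<phi> x)"
proof -
  have cg: "continuous_on K g" and c\<phi>: "continuous_on K \<phi>"
    using g \<phi> has_derivative_continuous continuous_on_eq_continuous_within by blast+
  \<comment> \<open>The gradient of \<phi> times the i-th component of g; row i of the Jacobian is
    the gradient of that component.\<close>
  let ?G = "\<lambda>i x. \<phi> x *\<^sub>R (J x $ i) + (g x $ i) *\<^sub>R P x"
  have eqi: "(LINT x:K|lborel. ?G i x \<bullet> axis i 1)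
      = (\<Sum>F | F facet_of K. (n F \<bullet> axis i 1) * (LINT x:F|face_measure (n F) F. \<phi> x * g x $ i))" for i
  proof (rule gauss_directional[OF K int n])
    show "continuous_on K (?G i)" by (intro continuous_intros c\<phi> cg J P)
    fix x assume x: "x \<in> K"
    have gi: "((\<lambda>y. g y $ i) has_derivative (\<lambda>h. (J x *v h) $ i)) (at x within K)"
      by (rule bounded_linear.has_derivative[OF bounded_linear_vec_nth g[OF x]])
    show "((\<lambda>y. \<phi> y * g y $ i) has_derivative (\<lambda>h. ?G i x \<bullet> h)) (at x within K)"
      by (rule has_derivative_eq_rhs[OF has_derivative_mult[OF \<phi>[OF x] gi]])
        (auto simp: matrix_vector_mul_component inner_add_left)
  qed
  have "(LINT x:K|lborel. g x \<bullet> P x + trace (J x) * \<phi> x) = (LINT x:K|lborel. \<Sum>i\<in>UNIV. ?G i x \<bullet> axis i 1)"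
  proof (rule arg_cong[where f="\<lambda>f. LINT x:K|lborel. f x"], rule ext)
    fix x
    have "?G i x \<bullet> axis i 1 = J x $ i $ i * \<phi> x + g x $ i * P x $ i" for i
      by (simp add: inner_axis mult.commute)
    then show "g x \<bullet> P x + trace (J x) * \<phi> x = (\<Sum>i\<in>UNIV. ?G i x \<bullet> axis i 1)"
      by (simp add: trace_def inner_vec_def[of "g x"] sum.distrib sum_distrib_right)
  qed
  also have "\<dots> = (\<Sum>i\<in>UNIV. LINT x:K|lborel. ?G i x \<bullet> axis i 1)"
    unfolding set_lebesgue_integral_def scaleR_sum_right
    by (intro Bochner_Integration.integral_sum borel_integrable_compact polytope_imp_compact K continuous_intros c\<phi> cg J P)
  also have "\<dots> = (\<Sum>F | F facet_of K. \<Sum>i\<in>UNIV. (n F \<bullet> axis i 1) * (LINT x:F|face_measure (n F) F. \<phi> x * g x $ i))"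
    unfolding eqi by (rule sum.swap)
  also have "\<dots> = (\<Sum>F | F facet_of K. LINT x:F|face_measure (n F) F. (g x \<bullet> n F) * \<phi> x)"
  proof (rule sum.cong)
    fix F assume "F \<in> {F. F facet_of K}"
    then have F: "F facet_of K" by simp
    have c: "continuous_on F (\<lambda>x. \<phi> x * g x $ i)" for i
      using facet_of_imp_subset[OF F] c\<phi> cg by (intro continuous_intros) (auto intro: continuous_on_subset)
    have "(\<Sum>i\<in>UNIV. (n F \<bullet> axis i 1) * (LINT x:F|face_measure (n F) F. \<phi> x * g x $ i))
       = (\<Sum>i\<in>UNIV. (LINT x|face_measure (n F) F. (n F \<bullet> axis i 1) * (indicator F x *\<^sub>R (\<phi> x * g x $ i))))"
      by (simp add: set_lebesgue_integral_def)
    also have "\<dots> = (LINT x|face_measure (n F) F. (\<Sum>i\<in>UNIV. (n F \<bullet> axis i 1) * (indicator F x *\<^sub>R (\<phi> x * g x $ i))))"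
      by (rule Bochner_Integration.integral_sum[symmetric], intro integrable_mult_right)
        (use face_integrable[OF facet_flat[OF K int n F] c] in \<open>simp add: set_integrable_def\<close>)
    also have "\<dots> = (LINT x:F|face_measure (n F) F. (g x \<bullet> n F) * \<phi> x)"
      unfolding set_lebesgue_integral_def
      by (rule Bochner_Integration.integral_cong)
        (auto simp: inner_axis inner_vec_def[of "g _"] sum_distrib_right sum_distrib_left mult_ac intro!: sum.cong)
    finally show "(\<Sum>i\<in>UNIV. (n F \<bullet> axis i 1) * (LINT x:F|face_measure (n F) F. \<phi> x * g x $ i))
       = (LINT x:F|face_measure (n F) F. (g x \<bullet> n F) * \<phi> x)" .
  qed simp
  finally show ?thesis .
qed

section \<open>Local shape of a polytope at a facet, and admissible test functions\<close>

lemma relint_facet_unique: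
  assumes K: "polytope K" and F: "F facet_of K" and H: "H facet_of K" and x: "x \<in> rel_interior F" "x \<in> H"
  shows "F = H"
proof -
  have FH: "F \<subseteq> H"
    by (rule subset_of_face_of[OF facet_of_imp_face_of[OF H] facet_of_imp_subset[OF F]]) (use x in blast)
  have "F face_of H"
    using face_of_subset[OF facet_of_imp_face_of[OF F] FH facet_of_imp_subset[OF H]] .
  moreover have "convex H"
    using face_of_imp_convex[OF facet_of_imp_face_of[OF H]] polytope_imp_convex[OF K] by blast
  ultimately show ?thesis using face_of_aff_dim_lt[of H F] F H by (auto simp: facet_of_def)
qed

text \<open>At a relative interior point of F the inequalities of all other facets are strict, hence
  they stay strict in a small ball, where only the inequality of F decides membership in K.\<close>

lemma facet_half_ball:
  fixes K :: "(real^'n::finite) set"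
  assumes K: "polytope K" and int: "interior K \<noteq> {}" and n: "outward_normals K n"
    and F: "F facet_of K" and x0: "x0 \<in> rel_interior F"
  obtains r where "r > 0" "\<And>x. dist x0 x < r \<Longrightarrow> x \<in> K \<longleftrightarrow> 0 \<le> depth (n F) F x"
    "\<And>x. dist x0 x < r \<Longrightarrow> x \<in> interior K \<longleftrightarrow> 0 < depth (n F) F x"
    "\<And>H. H facet_of K \<Longrightarrow> H \<noteq> F \<Longrightarrow> H \<inter> ball x0 r = {}"
proof -
  let ?U = "\<Inter>H\<in>{H. H facet_of K} - {F}. {x. 0 < depth (n H) H x}"
  have "open ?U" using finite_polytope_facets[OF K]
    by (intro open_INT ballI open_Collect_less continuous_intros) auto
  moreover have "x0 \<in> ?U"
  proof (intro INT_I CollectI)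
    fix H assume H: "H \<in> {H. H facet_of K} - {F}"
    have x0K: "x0 \<in> K" using x0 rel_interior_subset facet_of_imp_subset[OF F] by blast
    have "x0 \<notin> H" using relint_facet_unique[OF K F _ x0] H by blast
    moreover have Hf: "H facet_of K" using H by simp
    ultimately have "\<not> (x0 \<in> K \<and> depth (n H) H x0 = 0)"
      using mem_facet_iff[OF K int n Hf] by blast
    then have "depth (n H) H x0 \<noteq> 0" "0 \<le> depth (n H) H x0"
      using x0K depth_nonneg[OF K int n Hf x0K] by simp_all
    then show "0 < depth (n H) H x0" by simp
  qed
  ultimately obtain r where r: "r > 0" "ball x0 r \<subseteq> ?U" by (rule openE)
  have pos: "0 < depth (n H) H x" if "dist x0 x < r" "H facet_of K" "H \<noteq> F" for x H
    using r(2) that by auto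
  show ?thesis
  proof (rule that[OF r(1)])
    show "x \<in> K \<longleftrightarrow> 0 \<le> depth (n F) F x" if "dist x0 x < r" for x
      using pos[OF that] depth_nonneg[OF K int n F] mem_polytope_depth[OF K int n] by (metis less_imp_le)
    show "x \<in> interior K \<longleftrightarrow> 0 < depth (n F) F x" if "dist x0 x < r" for x
      using pos[OF that] F unfolding interior_polytope_depth[OF K int n] by auto
    show "H \<inter> ball x0 r = {}" if H: "H facet_of K" "H \<noteq> F" for H
    proof -
      have "\<not> dist x0 x < r" if "x \<in> H" for x
        using pos[OF _ H, of x] depth_on_face[OF facet_flat[OF K int n H(1)] that] by auto
      then show ?thesis by auto
    qed
  qed
qed

text \<open>Squaring removes the kink of the positive part; this supplies C1 bumps of compact
  support without exponentials. At 0 the difference quotient is bounded by the absolute value of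
  h.\<close>

lemma pos_part_square_derivative: "((\<lambda>v::real. (max 0 v)\<^sup>2) has_real_derivative 2 * max 0 v) (at v)"
proof (cases v "0::real" rule: linorder_cases)
  case less
  have "((\<lambda>v::real. 0) has_real_derivative 0) (at v)" by simp
  then have "((\<lambda>v::real. (max 0 v)\<^sup>2) has_real_derivative 0) (at v)"
    by (rule has_field_derivative_transform_within_open[where S="{..<0}"]) (use less in auto)
  then show ?thesis using less by (simp add: max_def)
next
  case greater
  have "((\<lambda>v::real. v\<^sup>2) has_real_derivative 2 * v) (at v)" by (auto intro!: derivative_eq_intros)
  then have "((\<lambda>v::real. (max 0 v)\<^sup>2) has_real_derivative 2 * v) (at v)"
    by (rule has_field_derivative_transform_within_open[where S="{0<..}"]) (use greater in auto)
  then show ?thesis using greater by (simp add: max_def)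
next
  case equal
  have "((\<lambda>h::real. ((max 0 h)\<^sup>2 - 0) / h) \<longlongrightarrow> 0) (at 0)"
  proof (rule tendsto_rabs_zero_cancel, rule tendsto_sandwich[OF _ _ tendsto_const])
    show "\<forall>\<^sub>F h::real in at 0. 0 \<le> \<bar>((max 0 h)\<^sup>2 - 0) / h\<bar>" by simp
    show "\<forall>\<^sub>F h::real in at 0. \<bar>((max 0 h)\<^sup>2 - 0) / h\<bar> \<le> \<bar>h\<bar>"
      by (rule always_eventually) (auto simp: max_def power2_eq_square)
    show "((\<lambda>h::real. \<bar>h\<bar>) \<longlongrightarrow> 0) (at 0)" by (rule tendsto_rabs_zero) (rule tendsto_ident_at)
  qed
  then show ?thesis using equal by (simp add: has_field_derivative_iff)
qed

text \<open>Test functions that agree on the hyperplane of a face but tend to zero off it, so that volume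
  terms disappear in the limit while the face terms stay.\<close>

lemma concentrating_bumps:
  fixes m x0 :: "real^'n::finite"
  assumes \<rho>: "\<rho> > 0"
  obtains \<phi> :: "nat \<Rightarrow> real^'n \<Rightarrow> real" and \<Phi> C where
    "\<And>k x. (\<phi> k has_derivative (\<lambda>h. \<Phi> k x \<bullet> h)) (at x)"
    "\<And>k. continuous_on UNIV (\<Phi> k)"
    "\<And>k x. 0 \<le> \<phi> k x" "\<And>k x. \<phi> k x \<le> C"
    "\<And>k x. \<rho> \<le> dist x0 x \<Longrightarrow> \<phi> k x = 0 \<and> \<Phi> k x = 0"
    "\<And>x. dist x0 x < \<rho> \<Longrightarrow> 0 < \<phi> 0 x"
    "\<And>k x. depth m F x = 0 \<Longrightarrow> \<phi> k x = \<phi> 0 x"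
    "\<And>x. depth m F x \<noteq> 0 \<Longrightarrow> (\<lambda>k. \<phi> k x) \<longlonglongrightarrow> 0"
proof -
  \<comment> \<open>The radial factor v vanishes outside the ball of radius \<rho> and enters
    squared to be C1. The denominator a is 1 on the hyperplane and grows without bound off
    it.\<close>
  define v where "v x = max 0 (\<rho>\<^sup>2 - (x - x0) \<bullet> (x - x0))" for x
  define a where "a k x = 1 + real k * (depth m F x)\<^sup>2" for k x
  define \<phi> where "\<phi> k x = (v x)\<^sup>2 * inverse (a k x)" for k x
  define \<Phi> where "\<Phi> k x = (- 4 * v x * inverse (a k x)) *\<^sub>R (x - x0)
      + ((v x)\<^sup>2 * (inverse (a k x) * (2 * real k * depth m F x) * inverse (a k x))) *\<^sub>R m" for k x
  have a1: "1 \<le> a k x" for k x by (simp add: a_def)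
  then have a0: "a k x \<noteq> 0" and apos: "0 < a k x" for k x by (smt (verit))+
  have inv: "0 < inverse (a k x)" "inverse (a k x) \<le> 1" for k x
    using apos a1 by (auto simp: inverse_le_1_iff)
  have cv: "continuous_on UNIV v" unfolding v_def[abs_def] by (intro continuous_intros)
  have ca: "continuous_on UNIV (a k)" for k unfolding a_def[abs_def] by (intro continuous_intros)
  have v_le: "v x \<le> \<rho>\<^sup>2" "0 \<le> v x" for x by (auto simp: v_def)
  have dv: "((\<lambda>x. (v x)\<^sup>2) has_derivative (\<lambda>h. 2 * v x * (- 2 * ((x - x0) \<bullet> h)))) (at x)" for x
  proof -
    have 1: "((\<lambda>x. \<rho>\<^sup>2 - (x - x0) \<bullet> (x - x0)) has_derivative (\<lambda>h. - 2 * ((x - x0) \<bullet> h))) (at x)"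
      by (auto intro!: derivative_eq_intros simp: inner_commute)
    have 2: "((\<lambda>v::real. (max 0 v)\<^sup>2) has_derivative (\<lambda>h. 2 * v x * h)) (at (\<rho>\<^sup>2 - (x - x0) \<bullet> (x - x0)))"
      using pos_part_square_derivative[of "\<rho>\<^sup>2 - (x - x0) \<bullet> (x - x0)"]
      by (simp add: has_field_derivative_def v_def)
    show ?thesis using has_derivative_compose[OF 1 2] by (simp add: v_def)
  qed
  have da: "((\<lambda>x. inverse (a k x)) has_derivative
      (\<lambda>h. - (inverse (a k x) * (2 * real k * depth m F x * (- (m \<bullet> h))) * inverse (a k x)))) (at x)" for k x
  proof -
    have "(a k has_derivative (\<lambda>h. 2 * real k * depth m F x * (- (m \<bullet> h)))) (at x)"
      unfolding a_def[abs_def] depth_def by (auto intro!: derivative_eq_intros)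
    then show ?thesis by (rule Deriv.has_derivative_inverse[of "a k" x, OF a0])
  qed
  show ?thesis
  proof (rule that[of \<phi> \<Phi> "(\<rho>\<^sup>2)\<^sup>2"])
    show "(\<phi> k has_derivative (\<lambda>h. \<Phi> k x \<bullet> h)) (at x)" for k x
      unfolding \<phi>_def[abs_def] \<Phi>_def
      by (rule has_derivative_eq_rhs[OF has_derivative_mult[OF dv da]])
        (auto simp: inner_add_left inner_diff_left algebra_simps)
    show "continuous_on UNIV (\<Phi> k)" for k
      unfolding \<Phi>_def[abs_def] by (intro continuous_intros cv ca) (use a0 in auto)
    show "0 \<le> \<phi> k x" for k x using inv[of k x] by (simp add: \<phi>_def)
    show "\<phi> k x \<le> (\<rho>\<^sup>2)\<^sup>2" for k x
    proof -
      have "\<phi> k x \<le> (v x)\<^sup>2 * 1" unfolding \<phi>_def using inv[of k x] by (intro mult_left_mono) auto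
      also have "\<dots> \<le> (\<rho>\<^sup>2)\<^sup>2" unfolding mult_1_right using v_le by (rule power_mono)
      finally show ?thesis .
    qed
    show "\<phi> k x = 0 \<and> \<Phi> k x = 0" if "\<rho> \<le> dist x0 x" for k x
    proof -
      have "\<rho>\<^sup>2 \<le> (dist x0 x)\<^sup>2" using that \<rho> by (intro power_mono) auto
      also have "\<dots> = (x - x0) \<bullet> (x - x0)" by (simp only: dist_norm norm_minus_commute[of x0] power2_norm_eq_inner)
      finally have "v x = 0" by (simp add: v_def)
      then show ?thesis by (simp add: \<phi>_def \<Phi>_def)
    qed
    show "0 < \<phi> 0 x" if "dist x0 x < \<rho>" for x
    proof -
      have "(x - x0) \<bullet> (x - x0) = (dist x0 x)\<^sup>2" by (simp only: dist_norm norm_minus_commute[of x0] power2_norm_eq_inner)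
      also have "\<dots> < \<rho>\<^sup>2" using that by (intro power_strict_mono) auto
      finally have "0 < v x" by (simp add: v_def)
      then show ?thesis by (simp add: \<phi>_def a_def)
    qed
    show "\<phi> k x = \<phi> 0 x" if "depth m F x = 0" for k x using that by (simp add: \<phi>_def a_def)
    show "(\<lambda>k. \<phi> k x) \<longlonglongrightarrow> 0" if "depth m F x \<noteq> 0" for x
    proof -
      have "filterlim (\<lambda>k. (depth m F x)\<^sup>2 * real k) at_top sequentially"
        using that by (intro filterlim_tendsto_pos_mult_at_top[OF tendsto_const _ filterlim_real_sequentially]) auto
      then have "filterlim (\<lambda>k. a k x) at_top sequentially" unfolding a_def
        by (intro filterlim_tendsto_add_at_top[OF tendsto_const]) (simp add: mult.commute)
      then have "(\<lambda>k. inverse (a k x)) \<longlonglongrightarrow> 0" by (rule tendsto_inverse_0_at_top)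
      from tendsto_mult[OF tendsto_const[of "(v x)\<^sup>2"] this] show ?thesis by (simp add: \<phi>_def)
    qed
  qed
qed

text \<open>The indicator is locally constant off the frontier of M. A point of \<Omega> on that
  frontier is at distance at least r from \<open>x0\<close>, and since \<rho> < r the bump vanishes
  in a neighbourhood of it.\<close>

lemma C1_with_gradient_cut:
  fixes \<Omega> M :: "(real^'n::finite) set"
  assumes M: "closed M" and loc: "\<Omega> \<inter> frontier M \<inter> ball x0 r = {}" and \<rho>: "\<rho> < r"
    and \<phi>: "\<And>x. (\<phi> has_derivative (\<lambda>h. \<Phi> x \<bullet> h)) (at x)" and \<Phi>: "continuous_on UNIV \<Phi>"
    and supp: "\<And>x. \<rho> \<le> dist x0 x \<Longrightarrow> \<phi> x = 0 \<and> \<Phi> x = 0"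
  shows "C1_with_gradient \<Omega> (\<lambda>x. indicator M x * \<phi> x) (\<lambda>x. indicator M x *\<^sub>R \<Phi> x)"
proof -
  have loceq: "\<exists>c U. open U \<and> x \<in> U \<and> (\<forall>y\<in>U. indicator M y * \<phi> y = c * \<phi> y \<and> indicator M y *\<^sub>R \<Phi> y = c *\<^sub>R \<Phi> y)"
    if x: "x \<in> \<Omega>" for x
  proof -
    consider "x \<in> interior M" | "x \<notin> M" | "x \<in> frontier M" using M by (auto simp: frontier_def)
    then show ?thesis
    proof cases
      case 1
      then show ?thesis using interior_subset[of M]
        by (intro exI[of _ 1] exI[of _ "interior M"]) auto
    next
      case 2
      then show ?thesis using M by (intro exI[of _ 0] exI[of _ "- M"]) auto
    next
      case 3
      then have "\<rho> < dist x0 x" using loc x \<rho> by (auto simp: disjoint_iff)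
      moreover have "open {y. \<rho> < dist x0 y}" by (intro open_Collect_less continuous_intros)
      ultimately show ?thesis using supp by (intro exI[of _ 0] exI[of _ "{y. \<rho> < dist x0 y}"]) auto
    qed
  qed
  show ?thesis unfolding C1_with_gradient_def
  proof (intro conjI ballI continuous_at_imp_continuous_on)
    fix x assume "x \<in> \<Omega>"
    from loceq[OF this] obtain c U where U: "open U" "x \<in> U"
      "\<And>y. y \<in> U \<Longrightarrow> indicator M y * \<phi> y = c * \<phi> y" "\<And>y. y \<in> U \<Longrightarrow> indicator M y *\<^sub>R \<Phi> y = c *\<^sub>R \<Phi> y"
      by blast
    have "((\<lambda>y. c * \<phi> y) has_derivative (\<lambda>h. c * (\<Phi> x \<bullet> h))) (at x)"
      by (rule has_derivative_mult_right[OF \<phi>])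
    then have "((\<lambda>y. indicator M y * \<phi> y) has_derivative (\<lambda>h. c * (\<Phi> x \<bullet> h))) (at x)"
      by (rule has_derivative_transform_within_open[OF _ U(1,2)]) (simp add: U(3))
    then show "((\<lambda>y. indicator M y * \<phi> y) has_derivative (\<lambda>h. (indicator M x *\<^sub>R \<Phi> x) \<bullet> h)) (at x)"
      by (simp add: U(2,4))
    have "isCont (\<lambda>y. c *\<^sub>R \<Phi> y) x"
      using \<Phi> by (intro continuous_intros) (simp add: continuous_on_eq_continuous_at)
    moreover have "eventually (\<lambda>y. indicator M y *\<^sub>R \<Phi> y = c *\<^sub>R \<Phi> y) (nhds x)"
      using U by (auto simp: eventually_nhds)
    ultimately show "isCont (\<lambda>y. indicator M y *\<^sub>R \<Phi> y) x" 
      using isCont_cong[of "\<lambda>y. indicator M y *\<^sub>R \<Phi> y" "\<lambda>y. c *\<^sub>R \<Phi> y" x] by (simp only:)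
  qed
qed

lemma square_integrable_bounded:
  fixes f :: "real^'n::finite \<Rightarrow> 'b::euclidean_space"
  assumes "open \<Omega>" "bounded \<Omega>" "f \<in> borel_measurable borel" "\<And>x. norm (f x) \<le> C"
  shows "square_integrable \<Omega> f"
proof -
  have lm: "\<Omega> \<in> lmeasurable" using assms by (simp add: lmeasurable_open)
  interpret finite_measure "lebesgue_on \<Omega>" using lm by (rule finite_measure_lebesgue_on)
  have f: "f \<in> borel_measurable (lebesgue_on \<Omega>)"
    using assms(3) by (intro measurable_restrict_space1 measurable_completion) simp
  have "norm ((norm (f x))\<^sup>2) \<le> C\<^sup>2" for x
    using assms(4)[of x] by (simp add: power_mono)
  then have "integrable (lebesgue_on \<Omega>) (\<lambda>x. (norm (f x))\<^sup>2)"
    using f by (intro integrable_const_bound[where B="C\<^sup>2"]) auto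
  then show ?thesis using f by (simp add: square_integrable_def)
qed

text \<open>On a set of finite measure 1 plus the square is integrable and dominates the absolute
  value.\<close>

lemma square_integrable_imp_integrable:
  fixes q :: "real^'n::finite \<Rightarrow> real"
  assumes "open \<Omega>" "bounded \<Omega>" "square_integrable \<Omega> q"
  shows "integrable lebesgue (\<lambda>x. indicator \<Omega> x * q x)"
proof -
  have lm: "\<Omega> \<in> lmeasurable" using assms by (simp add: lmeasurable_open)
  interpret finite_measure "lebesgue_on \<Omega>" using lm by (rule finite_measure_lebesgue_on)
  have "integrable (lebesgue_on \<Omega>) q"
  proof (rule Bochner_Integration.integrable_bound)
    show "integrable (lebesgue_on \<Omega>) (\<lambda>x. 1 + (norm (q x))\<^sup>2)"
      using assms(3) by (simp add: square_integrable_def)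
    show "q \<in> borel_measurable (lebesgue_on \<Omega>)" using assms(3) by (simp add: square_integrable_def)
    have "\<bar>t\<bar> \<le> 1 + t\<^sup>2" for t :: real
      using sum_squares_bound[of 1 "\<bar>t\<bar>"] by simp
    then show "AE x in lebesgue_on \<Omega>. norm (q x) \<le> norm (1 + (norm (q x))\<^sup>2)"
      by (intro AE_I2) (simp add: abs_of_nonneg)
  qed
  then show ?thesis using lm by (subst (asm) integrable_restrict_space) (auto simp: fmeasurableD)
qed

subsection \<open>Normal traces\<close>

text \<open>A nonzero sum h of outward fluxes keeps its sign on F near \<open>x0\<close>. Testing
  the zero trace with bumps restricted to the union of S and integrating by parts on each element
  gives a face integral of h that is the same for every bump, plus a volume integral that tends to
  zero; so the face integral is zero, which contradicts the sign. S consists of one element for a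
  boundary facet and of the two neighbours for an interior face.\<close>

lemma normal_trace_sum_zero:
  fixes \<Omega> :: "(real^'n::finite) set"
  assumes \<Omega>: "open \<Omega>" "bounded \<Omega>" and S: "finite S"
    and poly: "\<And>K. K \<in> S \<Longrightarrow> polytope K" and int: "\<And>K. K \<in> S \<Longrightarrow> interior K \<noteq> {}"
    and sub: "\<And>K. K \<in> S \<Longrightarrow> interior K \<subseteq> \<Omega>"
    and disj: "\<And>K L. K \<in> S \<Longrightarrow> L \<in> S \<Longrightarrow> K \<noteq> L \<Longrightarrow> interior K \<inter> interior L = {}"
    and n: "\<And>K. K \<in> S \<Longrightarrow> outward_normals K (n K)"
    and ext: "\<And>K. K \<in> S \<Longrightarrow> C1_extension K w (g K) (J K)"
    and F: "\<And>K. K \<in> S \<Longrightarrow> F facet_of K"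
    and m: "\<And>K. K \<in> S \<Longrightarrow> n K F = m \<or> n K F = - m" and flat: "flat_face m F"
    and w: "w \<in> H0_div \<Omega>"
    and r: "r > 0" and x0: "x0 \<in> F" and hyper: "\<And>x. dist x0 x < r \<Longrightarrow> depth m F x = 0 \<Longrightarrow> x \<in> F"
    and other: "\<And>K H. K \<in> S \<Longrightarrow> H facet_of K \<Longrightarrow> H \<noteq> F \<Longrightarrow> H \<inter> ball x0 r = {}"
    and loc: "\<Omega> \<inter> frontier (\<Union>S) \<inter> ball x0 r = {}"
  shows "(\<Sum>K\<in>S. g K x0 \<bullet> n K F) = 0"
proof (rule ccontr)
  define h where "h y = (\<Sum>K\<in>S. g K y \<bullet> n K F)" for y
  assume "(\<Sum>K\<in>S. g K x0 \<bullet> n K F) \<noteq> 0"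
  then have h0: "h x0 \<noteq> 0" by (simp add: h_def)
  have cg: "continuous_on K (g K)" if "K \<in> S" for K
    using C1_extension_continuous[OF ext[OF that]] .
  have cJ: "continuous_on K (J K)" if "K \<in> S" for K
    using ext[OF that] by (simp add: C1_extension_def)
  have cgF: "continuous_on F (g K)" if "K \<in> S" for K
    using cg[OF that] facet_of_imp_subset[OF F[OF that]] by (rule continuous_on_subset)
  have ch: "continuous_on F h" unfolding h_def[abs_def] by (intro continuous_intros cgF)
  \<comment> \<open>The sign of h at \<open>x0\<close>, so that both cases are treated as
    positive.\<close>
  define \<sigma> where "\<sigma> = sgn (h x0)"
  have "0 < \<sigma> * h x0" using h0 by (simp add: \<sigma>_def sgn_mult_self_eq sgn_if)
  moreover have "continuous_on F (\<lambda>x. \<sigma> * h x)" by (intro continuous_intros ch)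
  ultimately obtain d where d0: "d > 0" "\<And>y. y \<in> F \<Longrightarrow> dist y x0 < d \<Longrightarrow> dist (\<sigma> * h y) (\<sigma> * h x0) < \<sigma> * h x0"
    using x0 unfolding continuous_on_iff by blast
  have d: "d > 0" "\<And>y. y \<in> F \<Longrightarrow> dist y x0 < d \<Longrightarrow> 0 < \<sigma> * h y"
    using d0 by (auto simp: dist_real_def abs_less_iff)
  \<comment> \<open>Halving r keeps the bumps strictly inside the ball; d is the radius on which h
    keeps its sign.\<close>
  define \<rho> where "\<rho> = min (r / 2) d"
  have \<rho>: "0 < \<rho>" "\<rho> < r" "\<rho> \<le> d" using r d by (auto simp: \<rho>_def)
  obtain \<phi> :: "nat \<Rightarrow> real^'n \<Rightarrow> real" and \<Phi> C where
    d\<phi>: "\<And>k x. (\<phi> k has_derivative (\<lambda>h. \<Phi> k x \<bullet> h)) (at x)"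
    and c\<Phi>: "\<And>k. continuous_on UNIV (\<Phi> k)"
    and \<phi>0: "\<And>k x. 0 \<le> \<phi> k x" and \<phi>C: "\<And>k x. \<phi> k x \<le> C"
    and supp: "\<And>k x. \<rho> \<le> dist x0 x \<Longrightarrow> \<phi> k x = 0 \<and> \<Phi> k x = 0"
    and \<phi>pos: "\<And>x. dist x0 x < \<rho> \<Longrightarrow> 0 < \<phi> 0 x"
    and \<phi>F: "\<And>k x. depth m F x = 0 \<Longrightarrow> \<phi> k x = \<phi> 0 x"
    and \<phi>lim: "\<And>x. depth m F x \<noteq> 0 \<Longrightarrow> (\<lambda>k. \<phi> k x) \<longlonglongrightarrow> 0"
    by (rule concentrating_bumps[OF \<rho>(1), of x0 m F], rule that, assumption+)
  have c\<phi>: "continuous_on A (\<phi> k)" for A k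
    using has_derivative_continuous[OF d\<phi>] by (intro continuous_at_imp_continuous_on) simp
  have c\<Phi>': "continuous_on A (\<Phi> k)" for A k by (rule continuous_on_subset[OF c\<Phi>]) simp
  have m\<phi> [measurable]: "\<phi> k \<in> borel_measurable borel" and m\<Phi> [measurable]: "\<Phi> k \<in> borel_measurable borel" for k
    using c\<phi> c\<Phi> by (auto intro: borel_measurable_continuous_onI)
  obtain q where q: "square_integrable \<Omega> q" and tr: "zero_normal_trace \<Omega> w q"
    using w by (auto simp: H0_div_def)
  have wm: "w \<in> borel_measurable (lebesgue_on \<Omega>)" using w by (simp add: H0_div_def square_integrable_def)
  define M where "M = \<Union>S"
  have closedK: "closed K" if "K \<in> S" for K using poly[OF that] by (rule polytope_imp_closed)
  have closedM: "closed M" using S closedK by (auto simp: M_def)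
  have mM [measurable]: "M \<in> sets borel" using closedM by simp
  have mK: "K \<in> sets borel" if "K \<in> S" for K using closedK[OF that] by simp
  have \<Omega>leb: "\<Omega> \<in> sets lebesgue" using \<Omega> by (simp add: lmeasurable_open fmeasurableD)

  have zero: "(LINT x|lebesgue. indicator \<Omega> x *\<^sub>R (w x \<bullet> (indicator M x *\<^sub>R \<Phi> k x) + q x * (indicator M x * \<phi> k x))) = 0" for k
  proof -
    obtain B where B: "\<And>x. x \<in> cball x0 \<rho> \<Longrightarrow> norm (\<Phi> k x) \<le> B"
      using compact_imp_bounded[OF compact_continuous_image[OF c\<Phi>'[of "cball x0 \<rho>" k] compact_cball]]
      by (auto simp: bounded_iff simp del: mem_cball)
    have "norm (\<Phi> k x) \<le> max 0 B" for x
      using B[of x] supp[of x k] by (cases "\<rho> \<le> dist x0 x") auto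
    then have "norm (indicator M x *\<^sub>R \<Phi> k x) \<le> max 0 B" for x by (auto simp: indicator_def)
    then have 1: "square_integrable \<Omega> (\<lambda>x. indicator M x *\<^sub>R \<Phi> k x)"
      by (intro square_integrable_bounded[OF \<Omega>]) measurable
    have "norm (indicator M x * \<phi> k x) \<le> C" for x
      using \<phi>0[of k x] \<phi>C[of k x] by (auto simp: indicator_def)
    then have 2: "square_integrable \<Omega> (\<lambda>x. indicator M x * \<phi> k x)"
      by (intro square_integrable_bounded[OF \<Omega>]) measurable
    have 3: "C1_with_gradient \<Omega> (\<lambda>x. indicator M x * \<phi> k x) (\<lambda>x. indicator M x *\<^sub>R \<Phi> k x)"
      by (rule C1_with_gradient_cut[OF closedM _ \<rho>(2) d\<phi> c\<Phi> supp]) (use loc in \<open>simp add: M_def\<close>)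
    show ?thesis using tr 1 2 3 unfolding zero_normal_trace_def set_lebesgue_integral_def by blast
  qed

  define A where "A k x = (\<Sum>K\<in>S. indicator K x * (g K x \<bullet> \<Phi> k x + trace (J K x) * \<phi> k x))" for k x
  \<comment> \<open>The weak divergence minus the elementwise one. It only has to be integrable,
    since it is always multiplied by bumps that tend to zero almost everywhere.\<close>
  define t where "t x = indicator \<Omega> x * q x - (\<Sum>K\<in>S. indicator K x * trace (J K x))" for x
  have cT: "continuous_on K (\<lambda>x. trace (J K x))" if "K \<in> S" for K
    unfolding trace_def by (intro continuous_intros cJ[OF that])
  have intA: "integrable lborel (\<lambda>x. indicator K x * (g K x \<bullet> \<Phi> k x + trace (J K x) * \<phi> k x))" if "K \<in> S" for K k
    using borel_integrable_compact[OF polytope_imp_compact[OF poly[OF that]], of "\<lambda>x. g K x \<bullet> \<Phi> k x + trace (J K x) * \<phi> k x"]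
    by (simp add: continuous_intros cg cT c\<phi> c\<Phi>' that)
  have intA': "integrable lborel (A k)" for k
    unfolding A_def[abs_def] by (intro Bochner_Integration.integrable_sum intA)
  have intT: "integrable lborel (\<lambda>x. indicator K x * trace (J K x))" if "K \<in> S" for K
    using borel_integrable_compact[OF polytope_imp_compact[OF poly[OF that]] cT[OF that]] by simp
  have t: "integrable lebesgue t"
    unfolding t_def[abs_def] using intT
    by (intro Bochner_Integration.integrable_diff square_integrable_imp_integrable[OF \<Omega> q]
        Bochner_Integration.integrable_sum integrable_completion[THEN iffD2])
      (auto dest: borel_measurable_integrable)
  have M\<phi>: "(\<lambda>x. indicator M x * \<phi> k x) \<in> borel_measurable lebesgue" for k
    by (intro measurable_completion) simp
  have M\<Phi>: "(\<lambda>x. indicator M x *\<^sub>R \<Phi> k x) \<in> borel_measurable lebesgue" for k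
    by (intro measurable_completion) simp
  have intR: "integrable lebesgue (\<lambda>x. indicator M x * \<phi> k x * t x)" for k
  proof (rule Bochner_Integration.integrable_bound)
    show "integrable lebesgue (\<lambda>x. C * t x)" using t by simp
    show "(\<lambda>x. indicator M x * \<phi> k x * t x) \<in> borel_measurable lebesgue"
      by (rule borel_measurable_times[OF M\<phi> borel_measurable_integrable[OF t]])
    show "AE x in lebesgue. norm (indicator M x * \<phi> k x * t x) \<le> norm (C * t x)"
      using \<phi>0 \<phi>C by (intro AE_I2) (auto simp: abs_mult indicator_def intro!: mult_right_mono intro: order_trans[OF \<phi>C abs_ge_self])
  qed
  \<comment> \<open>The gradients of the bumps are not uniformly bounded, so they are collected in A
    and removed by the divergence theorem; the remainder contains only the bumps themselves, which
    are bounded by C.\<close>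
  have split: "0 = (LINT x|lborel. A k x) + (LINT x|lebesgue. indicator M x * \<phi> k x * t x)" for k
  proof -
    have "(LINT x|lebesgue. indicator \<Omega> x *\<^sub>R (w x \<bullet> (indicator M x *\<^sub>R \<Phi> k x) + q x * (indicator M x * \<phi> k x)))
        = (LINT x|lebesgue. A k x + indicator M x * \<phi> k x * t x)"
    proof (rule integral_cong_AE)
      have iw: "(\<lambda>x. indicator \<Omega> x *\<^sub>R w x) \<in> borel_measurable lebesgue"
        using wm \<Omega>leb by (subst (asm) borel_measurable_restrict_space_iff) auto
      have iq: "(\<lambda>x. indicator \<Omega> x * q x) \<in> borel_measurable lebesgue"
        using borel_measurable_integrable[OF square_integrable_imp_integrable[OF \<Omega> q]] .
      have "(\<lambda>x. (indicator \<Omega> x *\<^sub>R w x) \<bullet> (indicator M x *\<^sub>R \<Phi> k x) + (indicator \<Omega> x * q x) * (indicator M x * \<phi> k x)) \<in> borel_measurable lebesgue"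
        by (rule borel_measurable_add[OF borel_measurable_inner[OF iw M\<Phi>] borel_measurable_times[OF iq M\<phi>]])
      then show "(\<lambda>x. indicator \<Omega> x *\<^sub>R (w x \<bullet> (indicator M x *\<^sub>R \<Phi> k x) + q x * (indicator M x * \<phi> k x))) \<in> borel_measurable lebesgue"
        by (simp add: algebra_simps)
      show "(\<lambda>x. A k x + indicator M x * \<phi> k x * t x) \<in> borel_measurable lebesgue"
        by (rule borel_measurable_add[OF measurable_completion[OF borel_measurable_integrable[OF intA']]
              borel_measurable_integrable[OF intR]])
      have "AE x in lborel. \<forall>K\<in>S. x \<notin> frontier K"
        using S poly by (intro AE_finite_allI AE_lborel_negligible)
          (auto intro!: negligible_convex_frontier polytope_imp_convex)
      then have "AE x in lebesgue. \<forall>K\<in>S. x \<notin> frontier K" by (rule AE_completion)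
      then show "AE x in lebesgue. indicator \<Omega> x *\<^sub>R (w x \<bullet> (indicator M x *\<^sub>R \<Phi> k x) + q x * (indicator M x * \<phi> k x))
          = A k x + indicator M x * \<phi> k x * t x"
      proof eventually_elim
        fix x assume x: "\<forall>K\<in>S. x \<notin> frontier K"
        show "indicator \<Omega> x *\<^sub>R (w x \<bullet> (indicator M x *\<^sub>R \<Phi> k x) + q x * (indicator M x * \<phi> k x))
          = A k x + indicator M x * \<phi> k x * t x"
        proof (cases "x \<in> M")
          case False
          then have "A k x = 0" unfolding A_def M_def by (intro sum.neutral) auto
          then show ?thesis using False by simp
        next
          case True
          then obtain K where K: "K \<in> S" "x \<in> K" by (auto simp: M_def)
          have inS: "x \<in> interior L" if "L \<in> S" "x \<in> L" for L
            using x that closedK[OF that(1)] by (auto simp: frontier_def)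
          \<comment> \<open>Off the frontiers, a point of M lies in the interior of exactly one
            element, so each sum over S reduces to one term.\<close>
          have x\<Omega>: "x \<in> \<Omega>" using inS[OF K] sub[OF K(1)] by blast
          have wg: "w x = g K x" using ext[OF K(1)] inS[OF K] by (simp add: C1_extension_def)
          have ind: "indicator L x = (if L = K then 1 else 0 :: real)" if "L \<in> S" for L
            using inS[OF K] inS[OF that] disj[OF K(1) that] K by (auto simp: indicator_def)
          have single: "(\<Sum>L\<in>S. indicator L x * f L) = f K" for f :: "(real^'n) set \<Rightarrow> real"
          proof -
            have "(\<Sum>L\<in>S. indicator L x * f L) = (\<Sum>L\<in>S. if L = K then f L else 0)"
              by (rule sum.cong) (auto simp: ind)
            then show ?thesis using S K by (simp add: sum.delta)
          qed
          show ?thesis using True x\<Omega> unfolding A_def t_def single wg by (simp add: algebra_simps)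
        qed
      qed
    qed
    also have "\<dots> = (LINT x|lebesgue. A k x) + (LINT x|lebesgue. indicator M x * \<phi> k x * t x)"
      using intA'[of k] intR[of k]
      by (intro Bochner_Integration.integral_add) (auto intro: integrable_completion[THEN iffD2] dest: borel_measurable_integrable)
    also have "(LINT x|lebesgue. A k x) = (LINT x|lborel. A k x)"
      using intA'[of k] by (intro integral_completion) (auto dest: borel_measurable_integrable)
    finally show ?thesis using zero[of k] by simp
  qed

  \<comment> \<open>Facets other than F miss the ball that carries the bumps, and on F all bumps
    coincide; hence the value does not depend on k.\<close>
  have face: "(LINT x|lborel. A k x) = (LINT x:F|face_measure m F. h x * \<phi> 0 x)" for k
  proof -
    have "(LINT x|lborel. A k x) = (\<Sum>K\<in>S. LINT x:K|lborel. g K x \<bullet> \<Phi> k x + trace (J K x) * \<phi> k x)"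
      unfolding A_def set_lebesgue_integral_def
      by (subst Bochner_Integration.integral_sum) (auto intro: intA)
    also have "\<dots> = (\<Sum>K\<in>S. LINT x:F|face_measure m F. (g K x \<bullet> n K F) * \<phi> 0 x)"
    proof (rule sum.cong)
      fix K assume K: "K \<in> S"
      have "(LINT x:K|lborel. g K x \<bullet> \<Phi> k x + trace (J K x) * \<phi> k x)
          = (\<Sum>H | H facet_of K. LINT x:H|face_measure (n K H) H. (g K x \<bullet> n K H) * \<phi> k x)"
        by (rule gauss_weighted[OF poly[OF K] int[OF K] n[OF K]])
          (use ext[OF K] cJ[OF K] d\<phi> c\<Phi>' in \<open>auto simp: C1_extension_def intro: has_derivative_at_withinI\<close>)
      also have "\<dots> = (\<Sum>H | H facet_of K. if H = F then (LINT x:F|face_measure (n K F) F. (g K x \<bullet> n K F) * \<phi> k x) else 0)"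
      proof (rule sum.cong)
        fix H assume "H \<in> {H. H facet_of K}"
        then have H: "H facet_of K" by simp
        show "(LINT x:H|face_measure (n K H) H. (g K x \<bullet> n K H) * \<phi> k x)
          = (if H = F then (LINT x:F|face_measure (n K F) F. (g K x \<bullet> n K F) * \<phi> k x) else 0)"
        proof (cases "H = F")
          case False
          have "\<phi> k x = 0" if "x \<in> H" for x
          proof -
            have "x \<notin> ball x0 r" using other[OF K H False] that by blast
            then show ?thesis using supp \<rho>(2) by simp
          qed
          then have "(\<lambda>x. indicator H x *\<^sub>R ((g K x \<bullet> n K H) * \<phi> k x)) = (\<lambda>x. 0)"
            by (auto simp: indicator_def)
          then show ?thesis using False by (simp add: set_lebesgue_integral_def)
        qed simp
      qed simp
      also have "\<dots> = (LINT x:F|face_measure (n K F) F. (g K x \<bullet> n K F) * \<phi> k x)"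
        using F[OF K] finite_polytope_facets[OF poly[OF K]] by (simp add: sum.delta)
      also have "\<dots> = (LINT x:F|face_measure m F. (g K x \<bullet> n K F) * \<phi> k x)"
      proof -
        have c: "continuous_on F (\<lambda>x. (g K x \<bullet> n K F) * \<phi> k x)" by (intro continuous_intros cgF[OF K] c\<phi>)
        have "(LINT x:F|face_measure (n K F) F. f x) = (LINT x:F|face_measure m F. f x)" if "continuous_on F f" for f :: "real^'n \<Rightarrow> real"
          using m[OF K] face_integral_minus[OF flat that] by (elim disjE) simp_all
        from this[OF c] show ?thesis .
      qed
      also have "\<dots> = (LINT x:F|face_measure m F. (g K x \<bullet> n K F) * \<phi> 0 x)"
        unfolding set_lebesgue_integral_def
        by (rule Bochner_Integration.integral_cong)
          (auto simp: indicator_def intro!: \<phi>F depth_on_face[OF flat])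
      finally show "(LINT x:K|lborel. g K x \<bullet> \<Phi> k x + trace (J K x) * \<phi> k x)
        = (LINT x:F|face_measure m F. (g K x \<bullet> n K F) * \<phi> 0 x)" .
    qed simp
    also have "\<dots> = (LINT x:F|face_measure m F. h x * \<phi> 0 x)"
    proof -
      have "set_integrable (face_measure m F) F (\<lambda>x. (g K x \<bullet> n K F) * \<phi> 0 x)" if "K \<in> S" for K
        by (intro face_integrable[OF flat] continuous_intros cgF[OF that] c\<phi>)
      then show ?thesis unfolding set_lebesgue_integral_def h_def sum_distrib_right scaleR_sum_right set_integrable_def
        by (subst Bochner_Integration.integral_sum) auto
    qed
    finally show ?thesis .
  qed

  have "(\<lambda>k. LINT x|lebesgue. indicator M x * \<phi> k x * t x) \<longlonglongrightarrow> (LINT x|(lebesgue :: (real^'n) measure). (0::real))"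
  proof (rule integral_dominated_convergence)
    show "integrable lebesgue (\<lambda>x. C * \<bar>t x\<bar>)" using t by simp
    show "(\<lambda>x. indicator M x * \<phi> k x * t x) \<in> borel_measurable lebesgue" for k
      using intR by (auto dest: borel_measurable_integrable)
    show "AE x in lebesgue. norm (indicator M x * \<phi> k x * t x) \<le> C * \<bar>t x\<bar>" for k
      using \<phi>0 \<phi>C order_trans[OF \<phi>0 \<phi>C]
      by (intro AE_I2) (auto simp: abs_mult indicator_def intro!: mult_right_mono)
    have "m \<noteq> 0" using flat by (auto simp: flat_face_def)
    from AE_completion[OF AE_depth_neq[OF this, of F 0]]
    show "AE x in lebesgue. (\<lambda>k. indicator M x * \<phi> k x * t x) \<longlonglongrightarrow> 0"
    proof eventually_elim
      fix x assume "depth m F x \<noteq> 0"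
      then have "(\<lambda>k. indicator M x * \<phi> k x * t x) \<longlonglongrightarrow> indicator M x * 0 * t x"
        by (intro tendsto_intros \<phi>lim)
      then show "(\<lambda>k. indicator M x * \<phi> k x * t x) \<longlonglongrightarrow> 0" by simp
    qed
  qed simp
  moreover have "(LINT x|lebesgue. indicator M x * \<phi> k x * t x) = - (LINT x:F|face_measure m F. h x * \<phi> 0 x)" for k
    using split[of k] face[of k] by linarith
  ultimately have I0: "(LINT x:F|face_measure m F. h x * \<phi> 0 x) = 0"
    by (simp add: LIMSEQ_const_iff)
  have "0 < (LINT x:F|face_measure m F. \<sigma> * (h x * \<phi> 0 x))"
  proof (rule face_integral_pos[OF flat _ _ \<rho>(1) x0])
    show "continuous_on F (\<lambda>x. \<sigma> * (h x * \<phi> 0 x))" by (intro continuous_intros ch c\<phi>)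
    show "0 \<le> \<sigma> * (h x * \<phi> 0 x)" if "x \<in> F" for x
    proof (cases "dist x0 x < \<rho>")
      case True
      then have "0 < (\<sigma> * h x) * \<phi> 0 x" using d(2)[OF that] \<rho>(3) \<phi>pos by (simp add: dist_commute)
      then show ?thesis by (simp add: mult.assoc)
    next
      case False
      then show ?thesis using supp[of x 0] by simp
    qed
    show "x \<in> F \<and> 0 < \<sigma> * (h x * \<phi> 0 x)" if "depth m F x = 0" "dist x0 x < \<rho>" for x
    proof -
      have xF: "x \<in> F" using hyper that \<rho> by simp
      then have "0 < (\<sigma> * h x) * \<phi> 0 x" using d(2)[OF xF] that \<rho>(3) \<phi>pos by (simp add: dist_commute)
      then show ?thesis using xF by (simp add: mult.assoc)
    qed
  qed
  then show False using I0 by simp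
qed

subsection \<open>Meshes\<close>

text \<open>Every face of a polyhedron is exposed, and for a facet the exposing vector is nonzero,
  since F is neither empty nor K.\<close>

lemma outward_normal_exists:
  fixes K :: "(real^'n::finite) set"
  assumes K: "polytope K" and F: "F facet_of K"
  shows "\<exists>v. norm v = 1 \<and> (\<forall>x\<in>F. \<forall>y\<in>K. v \<bullet> (y - x) \<le> 0)"
proof -
  have "F exposed_face_of K"
    using exposed_face_of_polyhedron[OF polytope_imp_polyhedron[OF K]] F facet_of_imp_face_of by blast
  then obtain a b where ab: "K \<subseteq> {x. a \<bullet> x \<le> b}" "F = K \<inter> {x. a \<bullet> x = b}"
    by (auto simp: exposed_face_of_def)
  have "a \<noteq> 0"
  proof
    assume "a = 0"
    then have "F = {} \<or> F = K" using ab by auto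
    then show False using F by (auto simp: facet_of_def)
  qed
  have "(a /\<^sub>R norm a) \<bullet> (y - x) \<le> 0" if "x \<in> F" "y \<in> K" for x y
    using that ab by (auto simp: inner_diff_right intro!: mult_left_mono)
  then show ?thesis using \<open>a \<noteq> 0\<close> by (intro exI[of _ "a /\<^sub>R norm a"]) auto
qed

lemma has_outward_normals:
  fixes K :: "(real^'n::finite) set"
  assumes "polytope K"
  obtains v where "outward_normals K v"
  using outward_normal_exists[OF assms] unfolding outward_normals_def by metis

text \<open>A facet of two neighbours fills a ball around each of its relative interior points, so there
  is no room for a third element.\<close>

lemma facet_of_third_element:
  fixes K L M :: "(real^'n::finite) set"
  assumes poly: "polytope K" "polytope L" "polytope M"
    and int: "interior K \<noteq> {}" "interior L \<noteq> {}" "interior M \<noteq> {}"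
    and n: "outward_normals K n" "outward_normals L l" and opp: "l F = - n F"
    and F: "F facet_of K" "F facet_of L" "F facet_of M"
    and disj: "interior K \<inter> interior M = {}" "interior L \<inter> interior M = {}"
  shows False
proof -
  obtain v where v: "outward_normals M v" using has_outward_normals[OF poly(3)] .
  have "convex F" using F(1) poly(1) by (meson face_of_imp_convex facet_of_imp_face_of polytope_imp_convex)
  then obtain x0 where x0: "x0 \<in> rel_interior F"
    using F(1) rel_interior_eq_empty by (auto simp: facet_of_def)
  then have x0F: "x0 \<in> F" using rel_interior_subset by blast
  obtain r1 where r1: "r1 > 0" "\<And>x. dist x0 x < r1 \<Longrightarrow> x \<in> interior K \<longleftrightarrow> 0 < depth (n F) F x"
    using facet_half_ball[OF poly(1) int(1) n(1) F(1) x0] by metis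
  obtain r2 where r2: "r2 > 0" "\<And>x. dist x0 x < r2 \<Longrightarrow> x \<in> interior L \<longleftrightarrow> 0 < depth (l F) F x"
    using facet_half_ball[OF poly(2) int(2) n(2) F(2) x0] by metis
  obtain r3 where r3: "r3 > 0" "\<And>x. dist x0 x < r3 \<Longrightarrow> x \<in> interior M \<longleftrightarrow> 0 < depth (v F) F x"
    using facet_half_ball[OF poly(3) int(3) v F(3) x0] by metis
  define r where "r = min r1 (min r2 r3)"
  have r: "r > 0" "r \<le> r1" "r \<le> r2" "r \<le> r3" using r1 r2 r3 by (auto simp: r_def)
  \<comment> \<open>The part of a small ball inside M. It is open and nonempty, so it is not
    contained in the hyperplane of F; any of its points off that hyperplane lies in K or in L, whose
    normals are opposite.\<close>
  let ?U = "ball x0 r \<inter> {x. 0 < depth (v F) F x}"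
  have oU: "open ?U" by (intro open_Int open_ball open_Collect_less continuous_intros)
  have nv: "norm (v F) = 1" using v F(3) by (simp add: outward_normals_def)
  have fl: "flat_face (v F) F" by (rule facet_flat[OF poly(3) int(3) v F(3)])
  have "x0 + (- (r / 2)) *\<^sub>R v F \<in> ?U"
    using r nv depth_on_face[OF fl x0F] by (simp only: Int_iff mem_Collect_eq depth_normal[OF nv]) (simp add: dist_norm)
  then have "\<not> negligible ?U" using open_not_negligible[OF oU] by blast
  moreover have "negligible {x. depth (n F) F x = 0}"
  proof -
    have "norm (n F) = 1" using n(1) F(1) by (simp add: outward_normals_def)
    then have "n F \<noteq> 0" by auto
    then have "negligible {x. n F \<bullet> x = n F \<bullet> (SOME p. p \<in> F)}" by (intro negligible_hyperplane) simp
    then show ?thesis by (rule negligible_subset) (auto simp: depth_def inner_diff_right)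
  qed
  ultimately have "\<not> ?U \<subseteq> {x. depth (n F) F x = 0}" using negligible_subset by metis
  then obtain x where x: "x \<in> ?U" "depth (n F) F x \<noteq> 0" using subsetI[of ?U "{x. depth (n F) F x = 0}"] unfolding mem_Collect_eq by metis
  then have "x \<in> interior M" using r3(2) r by simp
  moreover have "x \<in> interior K \<or> x \<in> interior L"
    using x r1(2)[of x] r2(2)[of x] r opp by (auto simp: depth_minus)
  ultimately show False using disj by blast
qed

text \<open>Points just beyond F are in \<Omega> but not in K, hence in other elements, whose finite
  union is closed and so contains \<open>x0\<close>. The element L found there meets K in a proper
  face of K that contains F, and by dimension that face is F.\<close>

lemma mesh_neighbour:
  fixes \<Omega> :: "(real^'n::finite) set"
  assumes \<Omega>: "open \<Omega>" and mesh: "mesh \<Omega> T" and K: "K \<in> T" and F: "F facet_of K" and inside: "rel_interior F \<subseteq> \<Omega>"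
  obtains L where "L \<in> T" "L \<noteq> K" "F facet_of L"
proof -
  have poly: "polytope L" and int: "interior L \<noteq> {}" if "L \<in> T" for L
    using mesh that by (auto simp: mesh_def)
  have cl: "closed L" "convex L" if "L \<in> T" for L
    using poly[OF that] by (auto simp: polytope_imp_closed polytope_imp_convex)
  obtain n where n: "outward_normals K n" using has_outward_normals[OF poly[OF K]] .
  have nF: "norm (n F) = 1" using n F by (simp add: outward_normals_def)
  have "convex F" using F cl(2)[OF K] by (meson face_of_imp_convex facet_of_imp_face_of)
  then obtain x0 where x0: "x0 \<in> rel_interior F"
    using F rel_interior_eq_empty by (auto simp: facet_of_def)
  have x0F: "x0 \<in> F" using x0 rel_interior_subset by blast
  have fl: "flat_face (n F) F" by (rule facet_flat[OF poly[OF K] int[OF K] n F])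
  obtain r where r: "r > 0" "ball x0 r \<subseteq> \<Omega>" using \<Omega> inside x0 openE by blast
  have "x0 \<in> closure (\<Union>(T - {K}))"
    unfolding closure_approachable
  proof (intro allI impI)
    fix e :: real assume e: "e > 0"
    \<comment> \<open>Small enough for the point beyond F to stay in \<Omega> and within e of
      \<open>x0\<close>.\<close>
    define s where "s = min e r / 2"
    have s: "0 < s" "s < e" "s < r" using e r by (auto simp: s_def min_def)
    let ?y = "x0 + s *\<^sub>R n F"
    have "?y \<in> \<Omega>" using r(2) s nF by (auto simp: dist_norm subset_iff)
    then have "?y \<in> \<Union>T" using mesh closure_subset by (auto simp: mesh_def)
    moreover have "depth (n F) F ?y = - s" using depth_normal[OF nF] depth_on_face[OF fl x0F] by simp
    then have "?y \<notin> K" using depth_nonneg[OF poly[OF K] int[OF K] n F, of ?y] s by auto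
    ultimately have "?y \<in> \<Union>(T - {K})" by blast
    moreover have "dist ?y x0 < e" using s nF by (simp add: dist_norm)
    ultimately show "\<exists>y\<in>\<Union>(T - {K}). dist y x0 < e" by blast
  qed
  moreover have "closed (\<Union>(T - {K}))" using mesh cl(1) by (auto simp: mesh_def intro!: closed_Union)
  ultimately obtain L where L: "L \<in> T" "L \<noteq> K" "x0 \<in> L" by auto
  have KL: "(K \<inter> L) face_of K" "(K \<inter> L) face_of L" "interior K \<inter> interior L = {}"
    using mesh K L unfolding mesh_def by metis+
  have F1: "F face_of K" "F \<subseteq> K" using facet_of_imp_face_of[OF F] facet_of_imp_subset[OF F] .
  have "(K \<inter> L) \<inter> rel_interior F \<noteq> {}" using x0 x0F F1 L by blast
  then have FKL: "F \<subseteq> K \<inter> L" by (rule subset_of_face_of[OF KL(1) F1(2)])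
  have "K \<inter> L \<noteq> K"
  proof
    assume "K \<inter> L = K"
    then have "interior K \<subseteq> interior L" by (intro interior_mono) blast
    then show False using KL(3) int[OF K] by blast
  qed
  then have lt: "aff_dim (K \<inter> L) < aff_dim K" by (rule face_of_aff_dim_lt[OF cl(2)[OF K] KL(1)])
  have FfKL: "F face_of (K \<inter> L)" by (rule face_of_subset[OF F1(1) FKL]) blast
  have "F = K \<inter> L"
  proof (rule ccontr)
    assume "F \<noteq> K \<inter> L"
    then have "aff_dim F < aff_dim (K \<inter> L)"
      using face_of_aff_dim_lt[OF _ FfKL] cl(2)[OF K] cl(2)[OF L(1)] convex_Int by blast
    then show False using lt F by (simp add: facet_of_def)
  qed
  moreover have "aff_dim K = aff_dim L"
    using int[OF K] int[OF L(1)] affine_hull_nonempty_interior aff_dim_eq_full by metis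
  ultimately have "F facet_of L" using KL(2) F by (auto simp: facet_of_def)
  then show ?thesis using that L by blast
qed

section \<open>One-sided limits and the energy balance of a single element\<close>

lemma side_tendsto:
  fixes K :: "(real^'n::finite) set"
  assumes ext: "C1_extension K w g J" and x: "x \<in> K"
  shows "(w \<longlongrightarrow> g x) (at x within interior K)"
proof -
  have "(g \<longlongrightarrow> g x) (at x within K)"
    using C1_extension_continuous[OF ext] x by (simp add: continuous_on_def)
  then have "(g \<longlongrightarrow> g x) (at x within interior K)"
    by (rule tendsto_within_subset) (rule interior_subset)
  then show ?thesis
    by (rule Lim_transform_eventually)
      (use ext in \<open>auto simp: C1_extension_def eventually_at_filter\<close>)
qed

text \<open>\<open>Lim\<close> yields a definite value only where limits are unique. A convex set
  with interior is contained in the closure of its interior, so every point of K is a limit point of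
  it.\<close>

lemma nontrivial_side:
  fixes K :: "(real^'n::finite) set"
  assumes K: "polytope K" "interior K \<noteq> {}" and x: "x \<in> K"
  shows "\<not> trivial_limit (at x within interior K)"
proof (cases "x \<in> interior K")
  case True
  then show ?thesis using at_within_open[OF True open_interior] by simp
next
  case False
  have "x \<in> closure (interior K)"
    using convex_closure_interior[OF polytope_imp_convex[OF K(1)] K(2)] x closure_subset by blast
  then show ?thesis using False by (simp add: trivial_limit_within closure_def)
qed

lemma side_value_eq:
  fixes K :: "(real^'n::finite) set"
  assumes "polytope K" "interior K \<noteq> {}" "x \<in> K" "(w \<longlongrightarrow> l) (at x within interior K)"
  shows "side_value K w x = l"
  unfolding side_value_def using tendsto_Lim[OF nontrivial_side] assms by blast

lemma extension_jacobian:
  fixes K :: "(real^'n::finite) set"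
  assumes ext: "C1_extension K w g J" and x: "x \<in> interior K"
  shows "w x = g x" "jacobian w x = J x"
proof -
  show "w x = g x" using ext x by (simp add: C1_extension_def)
  have "(g has_derivative (\<lambda>h. J x *v h)) (at x)"
    using ext x at_within_interior[OF x] interior_subset unfolding C1_extension_def by (metis subsetD)
  then have "(w has_derivative (\<lambda>h. J x *v h)) (at x)"
    by (rule has_derivative_transform_within_open[OF _ open_interior x])
      (use ext in \<open>simp add: C1_extension_def\<close>)
  then show "jacobian w x = J x"
    unfolding jacobian_def using frechet_derivative_at matrix_of_matrix_vector_mul by metis
qed

lemma directional_eq: "jacobian v x = A \<Longrightarrow> directional \<beta> v x = A *v \<beta> x"
  by (simp add: directional_def matrix_vector_mult_def vec_eq_iff mult.commute)

lemma divergence_eq: "jacobian v x = A \<Longrightarrow> divergence v x = trace A"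
  by (simp add: divergence_def trace_def)

text \<open>Integrands built from the field are known only in the interior. The frontier of a convex
  set is null, so they may be replaced by continuous ones, for which \<open>lebesgue\<close> and
  \<open>lborel\<close> give the same integral.\<close>

lemma element_integral_cong:
  fixes K :: "(real^'n::finite) set" and f h :: "real^'n \<Rightarrow> real"
  assumes K: "polytope K" and f: "continuous_on K f" and eq: "\<And>x. x \<in> interior K \<Longrightarrow> h x = f x"
  shows "(LINT x:K|lebesgue. h x) = (LINT x:K|lborel. f x)"
proof -
  have c: "compact K" "convex K" using K by (auto simp: polytope_imp_compact polytope_imp_convex)
  have i: "integrable lborel (\<lambda>x. indicator K x *\<^sub>R f x)"
    using borel_integrable_compact[OF c(1) f] .
  have fa: "f absolutely_integrable_on K"
    unfolding set_integrable_def using i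
    by (intro integrable_completion[THEN iffD2]) (auto dest: borel_measurable_integrable)
  have neg: "negligible (frontier K)" using c(2) by (rule negligible_convex_frontier)
  have eq': "h x = f x" if "x \<in> K - frontier K" for x
    using that eq closure_closed[OF compact_imp_closed[OF c(1)]] by (auto simp: frontier_def)
  have ha: "h absolutely_integrable_on K" by (rule absolutely_integrable_spike[OF fa neg eq'])
  have "(LINT x:K|lebesgue. h x) = integral K h" using ha by (rule set_lebesgue_integral_eq_integral)
  also have "\<dots> = integral K f" by (rule integral_spike[OF neg]) (use eq' in simp)
  also have "\<dots> = (LINT x:K|lebesgue. f x)" using fa by (rule set_lebesgue_integral_eq_integral(2)[symmetric])
  also have "\<dots> = (LINT x:K|lborel. f x)" unfolding set_lebesgue_integral_def
    using i by (intro integral_completion) (auto dest: borel_measurable_integrable)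
  finally show ?thesis .
qed

text \<open>\<open>gauss_weighted\<close> for the field \<beta> with weight the squared length of w.
  The gradient of the weight is twice the transposed Jacobian applied to w, so its product with
  \<beta> is twice the convective term; the factor 1/2 of the form is what makes both volume terms
  one divergence.\<close>

lemma element_energy:
  fixes K :: "(real^'n::finite) set"
  assumes K: "polytope K" "interior K \<noteq> {}" and n: "outward_normals K n"
    and b: "C1_extension K \<beta> gb Jb" and w: "C1_extension K w g J"
  shows "(LINT x:K|lebesgue. directional \<beta> w x \<bullet> w x) + 1/2 * (LINT x:K|lebesgue. divergence \<beta> x * (w x \<bullet> w x))
    = (\<Sum>F | F facet_of K. 1/2 * (LINT x:F|face_measure (n F) F. (gb x \<bullet> n F) * (g x \<bullet> g x)))"
proof -
  note c = C1_extension_continuous[OF b] C1_extension_continuous[OF w]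
  have cJ: "continuous_on K Jb" "continuous_on K J" using b w by (auto simp: C1_extension_def)
  have mv: "continuous_on K (\<lambda>x. J x *v gb x)" "continuous_on K (\<lambda>x. g x v* J x)"
    unfolding matrix_vector_mult_def vector_matrix_mult_def by (intro continuous_intros c cJ)+
  have ct: "continuous_on K (\<lambda>x. trace (Jb x))" unfolding trace_def by (intro continuous_intros cJ)
  have 1: "(LINT x:K|lebesgue. directional \<beta> w x \<bullet> w x) = (LINT x:K|lborel. (J x *v gb x) \<bullet> g x)"
    by (rule element_integral_cong[OF K(1)])
      (auto intro!: continuous_intros mv c simp: extension_jacobian[OF b] extension_jacobian[OF w]
        directional_eq[OF extension_jacobian(2)[OF w]])
  have 2: "(LINT x:K|lebesgue. divergence \<beta> x * (w x \<bullet> w x)) = (LINT x:K|lborel. trace (Jb x) * (g x \<bullet> g x))"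
    by (rule element_integral_cong[OF K(1)])
      (auto intro!: continuous_intros ct c simp: extension_jacobian[OF w]
        divergence_eq[OF extension_jacobian(2)[OF b]])
  have i: "integrable lborel (\<lambda>x. indicator K x *\<^sub>R ((J x *v gb x) \<bullet> g x))"
     "integrable lborel (\<lambda>x. indicator K x *\<^sub>R (trace (Jb x) * (g x \<bullet> g x)))"
    by (intro borel_integrable_compact polytope_imp_compact K continuous_intros mv c ct)+
  have "(LINT x:K|lborel. gb x \<bullet> (2 *\<^sub>R (g x v* J x)) + trace (Jb x) * (g x \<bullet> g x))
      = (\<Sum>F | F facet_of K. LINT x:F|face_measure (n F) F. (gb x \<bullet> n F) * (g x \<bullet> g x))"
  proof (rule gauss_weighted[OF K n])
    fix x assume x: "x \<in> K"
    show "(gb has_derivative (\<lambda>h. Jb x *v h)) (at x within K)" using b x by (simp add: C1_extension_def)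
    have "(g has_derivative (\<lambda>h. J x *v h)) (at x within K)" using w x by (simp add: C1_extension_def)
    then show "((\<lambda>x. g x \<bullet> g x) has_derivative (\<lambda>h. (2 *\<^sub>R (g x v* J x)) \<bullet> h)) (at x within K)"
      by (intro has_derivative_eq_rhs[OF has_derivative_inner]) (auto simp: dot_lmul_matrix inner_commute[of "J x *v _"])
  qed (intro continuous_intros cJ mv)+
  moreover have "(LINT x:K|lborel. gb x \<bullet> (2 *\<^sub>R (g x v* J x)) + trace (Jb x) * (g x \<bullet> g x))
      = 2 * (LINT x:K|lborel. (J x *v gb x) \<bullet> g x) + (LINT x:K|lborel. trace (Jb x) * (g x \<bullet> g x))"
  proof -
    have "gb x \<bullet> (2 *\<^sub>R (g x v* J x)) = 2 * ((J x *v gb x) \<bullet> g x)" for x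
      using dot_lmul_matrix[of "g x" "J x" "gb x"] by (simp add: inner_commute)
    then show ?thesis unfolding set_lebesgue_integral_def using i
      by (simp add: scaleR_add_right distrib_left mult.left_commute[of _ 2])
  qed
  ultimately show ?thesis unfolding 1 2 by (simp add: sum_divide_distrib[symmetric])
qed

text \<open>The discriminant inequality, including q = 0. It yields Cauchy-Schwarz for a form that
  is only semidefinite.\<close>

lemma quadratic_nonneg_imp:
  fixes p c q :: real
  assumes "\<And>a. 0 \<le> p + 2 * a * c + a\<^sup>2 * q" and q: "0 \<le> q"
  shows "c\<^sup>2 \<le> p * q"
proof (cases "q = 0")
  case True
  have "c = 0"
  proof (rule ccontr)
    assume "c \<noteq> 0"
    \<comment> \<open>With q = 0 the polynomial is affine in a; this a gives it the value
      -1.\<close>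
    then have "2 * (- (p + 1) / (2 * c)) * c = - (p + 1)" by (simp add: field_simps)
    then show False using assms(1)[of "- (p + 1) / (2 * c)"] True by simp
  qed
  then show ?thesis using True by simp
next
  case False
  then have "0 < q" using q by simp
  \<comment> \<open>The minimizer of the quadratic polynomial.\<close>
  then show ?thesis using assms(1)[of "- c / q"]
    by (simp add: field_simps power2_eq_square)
qed

text \<open>An exchange of summation: each face in I is counted by exactly two elements, and all
  other facets contribute zero.\<close>

lemma interior_face_sum_rearrange:
  fixes T :: "(real^'n::finite) set set" and a :: "(real^'n) set \<Rightarrow> (real^'n) set \<Rightarrow> real"
  assumes T: "finite T" "\<And>K. K \<in> T \<Longrightarrow> polytope K"
    and faces: "\<And>F. F \<in> I \<Longrightarrow> {K \<in> T. F facet_of K} = {Kp F, Km F}" "\<And>F. F \<in> I \<Longrightarrow> Kp F \<noteq> Km F"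
    and zero: "\<And>K F. K \<in> T \<Longrightarrow> F facet_of K \<Longrightarrow> F \<notin> I \<Longrightarrow> a K F = 0"
  shows "(\<Sum>K\<in>T. \<Sum>F | F facet_of K. a K F) = (\<Sum>F\<in>I. a (Kp F) F + a (Km F) F)"
proof -
  have "I \<subseteq> (\<Union>K\<in>T. {F. F facet_of K})" using faces(1) by blast
  then have I: "finite I" by (rule finite_subset) (use T finite_polytope_facets in auto)
  have "(\<Sum>K\<in>T. \<Sum>F | F facet_of K. a K F) = (\<Sum>K\<in>T. \<Sum>F | F \<in> I \<and> F facet_of K. a K F)"
    by (intro sum.cong refl sum.mono_neutral_right) (use T finite_polytope_facets zero in auto)
  also have "\<dots> = (\<Sum>F\<in>I. \<Sum>K | K \<in> T \<and> F facet_of K. a K F)"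
    by (rule sum.swap_restrict[OF T(1) I])
  also have "\<dots> = (\<Sum>F\<in>I. a (Kp F) F + a (Km F) F)"
    by (rule sum.cong) (simp_all add: faces)
  finally show ?thesis .
qed

section \<open>Normal components and energy on a fixed mesh\<close>

context
  fixes \<Omega> :: "(real^'n::finite) set" and T :: "(real^'n) set set"
    and Kp Km :: "(real^'n) set \<Rightarrow> (real^'n) set" and nF :: "(real^'n) set \<Rightarrow> real^'n"
    and W :: "(real^'n \<Rightarrow> real^'n) set"
  assumes dom: "polyhedral_domain \<Omega>" and mesh: "mesh \<Omega> T"
    and orient: "face_orientation \<Omega> T Kp Km nF" and W: "discrete_velocity_space \<Omega> T W"
begin

lemma open_dom: "open \<Omega>" and bounded_dom: "bounded \<Omega>"
  using dom by (auto simp: polyhedral_domain_def)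

lemma element: "polytope K" "interior K \<noteq> {}" "interior K \<subseteq> \<Omega>" if "K \<in> T"
  using mesh that by (auto simp: mesh_def)

lemma finite_mesh: "finite T"
  using mesh by (simp add: mesh_def)

lemma elements_disjoint: "K \<in> T \<Longrightarrow> L \<in> T \<Longrightarrow> K \<noteq> L \<Longrightarrow> interior K \<inter> interior L = {}"
  using mesh by (simp add: mesh_def)

lemma interior_face:
  assumes "F \<in> interior_faces \<Omega> T"
  shows "Kp F \<in> T" "Km F \<in> T" "Kp F \<noteq> Km F" "F facet_of Kp F" "F facet_of Km F" "norm (nF F) = 1"
    "\<And>x y. x \<in> F \<Longrightarrow> y \<in> Kp F \<Longrightarrow> nF F \<bullet> (y - x) \<le> 0"
    "\<And>x y. x \<in> F \<Longrightarrow> y \<in> Km F \<Longrightarrow> nF F \<bullet> (y - x) \<ge> 0"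
    "rel_interior F \<subseteq> \<Omega>"
  using orient assms unfolding face_orientation_def interior_faces_def by blast+

text \<open>Tied to the prescribed \<open>nF\<close> on interior faces, so that the outward normals
  of the two sides are opposite by construction; arbitrary outward normals elsewhere.\<close>

definition mesh_normal :: "(real^'n) set \<Rightarrow> (real^'n) set \<Rightarrow> real^'n" where
  "mesh_normal K F = (if F \<in> interior_faces \<Omega> T \<and> K = Kp F then nF F
     else if F \<in> interior_faces \<Omega> T \<and> K = Km F then - nF F
     else SOME v. norm v = 1 \<and> (\<forall>x\<in>F. \<forall>y\<in>K. v \<bullet> (y - x) \<le> 0))"

lemma mesh_normal_interior:
  assumes F: "F \<in> interior_faces \<Omega> T"
  shows "mesh_normal (Kp F) F = nF F" "mesh_normal (Km F) F = - nF F"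
  using F interior_face(3)[OF F] by (auto simp: mesh_normal_def)

lemma mesh_normal_outward:
  assumes K: "K \<in> T"
  shows "outward_normals K (mesh_normal K)"
  unfolding outward_normals_def
proof (intro allI impI)
  fix F assume F: "F facet_of K"
  show "norm (mesh_normal K F) = 1 \<and> (\<forall>x\<in>F. \<forall>y\<in>K. mesh_normal K F \<bullet> (y - x) \<le> 0)"
  proof (cases "F \<in> interior_faces \<Omega> T \<and> (K = Kp F \<or> K = Km F)")
    case True
    then have I: "F \<in> interior_faces \<Omega> T" by simp
    from True show ?thesis
      using interior_face(6-8)[OF I] mesh_normal_interior[OF I] by fastforce
  next
    case False
    then have "mesh_normal K F = (SOME v. norm v = 1 \<and> (\<forall>x\<in>F. \<forall>y\<in>K. v \<bullet> (y - x) \<le> 0))"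
      by (auto simp: mesh_normal_def)
    then show ?thesis using someI_ex[OF outward_normal_exists[OF element(1)[OF K] F]] by simp
  qed
qed

text \<open>The orientation names two elements at a face; a third would overlap one of them.\<close>

lemma interior_face_elements:
  assumes F: "F \<in> interior_faces \<Omega> T"
  shows "{K \<in> T. F facet_of K} = {Kp F, Km F}"
proof -
  have "M = Kp F \<or> M = Km F" if M: "M \<in> T" "F facet_of M" for M
  proof (rule ccontr)
    note f = interior_face[OF F]
    assume ne: "\<not> (M = Kp F \<or> M = Km F)"
    show False
    proof (rule facet_of_third_element[of "Kp F" "Km F" M "mesh_normal (Kp F)" "mesh_normal (Km F)" F])
      show "mesh_normal (Km F) F = - mesh_normal (Kp F) F" by (simp add: mesh_normal_interior[OF F])
      show "interior (Kp F) \<inter> interior M = {}" "interior (Km F) \<inter> interior M = {}"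
        using elements_disjoint[OF f(1) M(1)] elements_disjoint[OF f(2) M(1)] ne by blast+
    qed (intro f M element mesh_normal_outward)+
  qed
  then show ?thesis using interior_face(1,2,4,5)[OF F] by blast
qed

text \<open>By conformity a facet not contained in the frontier has its relative interior in
  \<Omega>, and then it has a neighbour, which makes it an interior face.\<close>

lemma boundary_facet:
  assumes K: "K \<in> T" and F: "F facet_of K" and nI: "F \<notin> interior_faces \<Omega> T"
  shows "F \<subseteq> frontier \<Omega>"
proof (rule ccontr)
  assume "\<not> ?thesis"
  then have "rel_interior F \<subseteq> \<Omega>" using mesh K F unfolding mesh_def by blast
  moreover from mesh_neighbour[OF open_dom mesh K F this] obtain L where "L \<in> T" "L \<noteq> K" "F facet_of L" .
  ultimately have "F \<in> interior_faces \<Omega> T" using K F by (auto simp: interior_faces_def)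
  then show False using nI by simp
qed

lemma closure_rel_interior_facet: "K \<in> T \<Longrightarrow> F facet_of K \<Longrightarrow> closure (rel_interior F) = F"
proof -
  assume K: "K \<in> T" and F: "F facet_of K"
  have "flat_face (mesh_normal K F) F"
    by (rule facet_flat[OF element(1,2)[OF K] mesh_normal_outward[OF K] F])
  then have "convex F" "closed F" by (auto simp: flat_face_def compact_imp_closed)
  then show ?thesis by (simp add: convex_closure_rel_interior)
qed

lemma facet_extension_continuous:
  assumes "K \<in> T" "F facet_of K" "C1_extension K w g J"
  shows "continuous_on F g"
  using C1_extension_continuous[OF assms(3)] facet_of_imp_subset[OF assms(2)] by (rule continuous_on_subset)

text \<open>\<open>normal_trace_sum_zero\<close> with S = {K}: the test function vanishes outside K,
  so an element across a crack does not interfere. Relative interior points are dense in F, and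
  continuity gives the rest.\<close>

lemma normal_zero_boundary:
  assumes w: "w \<in> H0_div \<Omega>" and K: "K \<in> T" and F: "F facet_of K" and nI: "F \<notin> interior_faces \<Omega> T"
    and ext: "C1_extension K w g J" and x: "x \<in> F"
  shows "g x \<bullet> mesh_normal K F = 0"
proof -
  note poly = element[OF K] and n = mesh_normal_outward[OF K]
  have fl: "flat_face (mesh_normal K F) F" by (rule facet_flat[OF poly(1,2) n F])
  have "g x0 \<bullet> mesh_normal K F = 0" if x0: "x0 \<in> rel_interior F" for x0
  proof -
    obtain r where r: "r > 0" "\<And>x. dist x0 x < r \<Longrightarrow> x \<in> K \<longleftrightarrow> 0 \<le> depth (mesh_normal K F) F x"
      "\<And>x. dist x0 x < r \<Longrightarrow> x \<in> interior K \<longleftrightarrow> 0 < depth (mesh_normal K F) F x"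
      "\<And>H. H facet_of K \<Longrightarrow> H \<noteq> F \<Longrightarrow> H \<inter> ball x0 r = {}"
      by (rule facet_half_ball[OF poly(1,2) n F x0]) (rule that, assumption+)
    have hyper: "x \<in> F" if "dist x0 x < r" "depth (mesh_normal K F) F x = 0" for x
      using that r(2)[OF that(1)] mem_facet_iff[OF poly(1,2) n F, of x] by simp
    have "(\<Sum>L\<in>{K}. g x0 \<bullet> mesh_normal L F) = 0"
    proof (rule normal_trace_sum_zero[where J="\<lambda>_. J" and g="\<lambda>_. g", OF open_dom bounded_dom _ _ _ _ _ _ _ _ _ fl w r(1) _ hyper])
      show "x0 \<in> F" using x0 rel_interior_subset by blast
      \<comment> \<open>Near \<open>x0\<close> the frontier of K lies in F, which is part of the
        frontier of \<Omega>, and an open set is disjoint from its frontier.\<close>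
      show "\<Omega> \<inter> frontier (\<Union>{K}) \<inter> ball x0 r = {}"
      proof (rule ccontr)
        assume "\<Omega> \<inter> frontier (\<Union>{K}) \<inter> ball x0 r \<noteq> {}"
        then obtain y where y: "y \<in> \<Omega>" "y \<in> frontier K" "dist x0 y < r" by auto
        have "y \<in> K" "y \<notin> interior K"
          using y(2) closure_closed[OF polytope_imp_closed[OF poly(1)]] by (auto simp: frontier_def)
        then have "depth (mesh_normal K F) F y = 0" using r(2,3)[OF y(3)] by simp
        then have "y \<in> frontier \<Omega>" using hyper[OF y(3)] boundary_facet[OF K F nI] by blast
        then show False using y(1) open_dom by (simp add: frontier_def interior_open)
      qed
    qed (use poly n ext F r(4) in auto)
    then show ?thesis by simp
  qed
  moreover have "continuous_on F (\<lambda>x. g x \<bullet> mesh_normal K F)"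
    by (intro continuous_intros facet_extension_continuous[OF K F ext])
  ultimately show ?thesis
    using continuous_constant_on_closure[of "rel_interior F" "\<lambda>x. g x \<bullet> mesh_normal K F" 0 x]
      x closure_rel_interior_facet[OF K F] by simp
qed

text \<open>\<open>normal_trace_sum_zero\<close> with the two neighbours of F: their half-balls fill
  a ball, so the frontier of the union is away from \<open>x0\<close>, and with opposite normals the
  sum of fluxes is the difference of the two normal components.\<close>

lemma normal_continuous_interior:
  assumes w: "w \<in> H0_div \<Omega>" and F: "F \<in> interior_faces \<Omega> T"
    and ext: "\<And>K. K \<in> T \<Longrightarrow> C1_extension K w (g K) (J K)" and x: "x \<in> F"
  shows "g (Kp F) x \<bullet> nF F = g (Km F) x \<bullet> nF F"
proof -
  note f = interior_face[OF F]
  note nrm = mesh_normal_interior[OF F]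
  note P = element[OF f(1)] and M = element[OF f(2)]
  note np = mesh_normal_outward[OF f(1)] and nm = mesh_normal_outward[OF f(2)]
  have fl: "flat_face (nF F) F" using facet_flat[OF P(1,2) np f(4)] by (simp add: nrm)
  have "g (Kp F) x0 \<bullet> nF F - g (Km F) x0 \<bullet> nF F = 0" if x0: "x0 \<in> rel_interior F" for x0
  proof -
    obtain r1 where r1: "r1 > 0" "\<And>x. dist x0 x < r1 \<Longrightarrow> x \<in> Kp F \<longleftrightarrow> 0 \<le> depth (mesh_normal (Kp F) F) F x"
      "\<And>H. H facet_of Kp F \<Longrightarrow> H \<noteq> F \<Longrightarrow> H \<inter> ball x0 r1 = {}"
      by (rule facet_half_ball[OF P(1,2) np f(4) x0]) (rule that, assumption+)
    obtain r2 where r2: "r2 > 0" "\<And>x. dist x0 x < r2 \<Longrightarrow> x \<in> Km F \<longleftrightarrow> 0 \<le> depth (mesh_normal (Km F) F) F x"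
      "\<And>H. H facet_of Km F \<Longrightarrow> H \<noteq> F \<Longrightarrow> H \<inter> ball x0 r2 = {}"
      by (rule facet_half_ball[OF M(1,2) nm f(5) x0]) (rule that, assumption+)
    define r where "r = min r1 r2"
    have r: "r > 0" "r \<le> r1" "r \<le> r2" using r1 r2 by (auto simp: r_def)
    have hyper: "x \<in> F" if "dist x0 x < r" "depth (nF F) F x = 0" for x
      using that r r1(2)[of x] mem_facet_iff[OF P(1,2) np f(4), of x] by (simp add: nrm)
    have "ball x0 r \<subseteq> \<Union>{Kp F, Km F}"
      using r1(2) r2(2) r by (auto simp: nrm depth_minus)
    then have "ball x0 r \<subseteq> interior (\<Union>{Kp F, Km F})" by (rule interior_maximal) simp
    then have loc: "\<Omega> \<inter> frontier (\<Union>{Kp F, Km F}) \<inter> ball x0 r = {}" by (auto simp: frontier_def)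
    have "(\<Sum>L\<in>{Kp F, Km F}. g L x0 \<bullet> mesh_normal L F) = 0"
    proof (rule normal_trace_sum_zero[where J=J and m="nF F", OF open_dom bounded_dom _ _ _ _ _ _ _ _ _ fl w r(1) _ hyper _ loc])
      show "x0 \<in> F" using x0 rel_interior_subset by blast
      show "H \<inter> ball x0 r = {}" if "K \<in> {Kp F, Km F}" "H facet_of K" "H \<noteq> F" for K H
        using that r1(3)[of H] r2(3)[of H] subset_ball[OF r(2), of x0] subset_ball[OF r(3), of x0] by blast
      show "interior K \<inter> interior L = {}" if "K \<in> {Kp F, Km F}" "L \<in> {Kp F, Km F}" "K \<noteq> L" for K L
        using that elements_disjoint f by blast
    qed (use P M np nm ext f in \<open>auto simp: nrm\<close>)
    then show ?thesis using f(3) by (simp add: nrm)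
  qed
  moreover have "continuous_on F (\<lambda>x. g (Kp F) x \<bullet> nF F - g (Km F) x \<bullet> nF F)"
    by (intro continuous_intros facet_extension_continuous[OF f(1,4) ext[OF f(1)]]
        facet_extension_continuous[OF f(2,5) ext[OF f(2)]])
  ultimately show ?thesis
    using continuous_constant_on_closure[of "rel_interior F" "\<lambda>x. g (Kp F) x \<bullet> nF F - g (Km F) x \<bullet> nF F" 0 x]
      x closure_rel_interior_facet[OF f(1,4)] by simp
qed

lemma velocity_extension: "w \<in> W \<Longrightarrow> \<exists>g J. \<forall>K\<in>T. C1_extension K w (g K) (J K)"
proof -
  assume "w \<in> W"
  then have "\<forall>K\<in>T. \<exists>g J. C1_extension K w g J"
    using W by (simp add: discrete_velocity_space_def C1_up_to_boundary_def C1_extension_def)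
  then show ?thesis by metis
qed

lemma velocity_H0_div: "w \<in> W \<Longrightarrow> w \<in> H0_div \<Omega>"
  using W by (auto simp: discrete_velocity_space_def)

lemma face_flat: "F \<in> interior_faces \<Omega> T \<Longrightarrow> flat_face (nF F) F"
proof -
  assume F: "F \<in> interior_faces \<Omega> T"
  note f = interior_face[OF F]
  show ?thesis using facet_flat[OF element(1,2)[OF f(1)] mesh_normal_outward[OF f(1)] f(4)]
    by (simp add: mesh_normal_interior[OF F])
qed

lemma side_value_extension:
  assumes "K \<in> T" "F facet_of K" "C1_extension K w g J" "x \<in> F"
  shows "side_value K w x = g x"
  using side_value_eq[OF element(1,2)[OF assms(1)] _ side_tendsto[OF assms(3)]]
    assms facet_of_imp_subset by blast

lemma side_value_continuous:
  assumes "K \<in> T" "F facet_of K" "w \<in> W"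
  shows "continuous_on F (side_value K w)"
proof -
  obtain g J where "\<forall>K\<in>T. C1_extension K w (g K) (J K)" using velocity_extension[OF assms(3)] by blast
  then have e: "C1_extension K w (g K) (J K)" using assms by blast
  show ?thesis
    using facet_extension_continuous[OF assms(1,2) e] side_value_extension[OF assms(1,2) e]
    by (subst continuous_on_cong[OF refl]) auto
qed

lemma side_value_linear:
  assumes K: "K \<in> T" and F: "F facet_of K" and u: "u \<in> W" and v: "v \<in> W" and x: "x \<in> F"
  shows "side_value K (\<lambda>x. u x + v x) x = side_value K u x + side_value K v x"
    "side_value K (\<lambda>x. a *\<^sub>R u x) x = a *\<^sub>R side_value K u x"
proof -
  obtain g J where "\<forall>K\<in>T. C1_extension K u (g K) (J K)" using velocity_extension[OF u] by blast
  then have eu: "C1_extension K u (g K) (J K)" using K by blast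
  obtain g' J' where "\<forall>K\<in>T. C1_extension K v (g' K) (J' K)" using velocity_extension[OF v] by blast
  then have ev: "C1_extension K v (g' K) (J' K)" using K by blast
  have xK: "x \<in> K" using x facet_of_imp_subset[OF F] by blast
  note t = side_tendsto[OF eu xK] side_tendsto[OF ev xK]
  note s = side_value_extension[OF K F eu x] side_value_extension[OF K F ev x]
  show "side_value K (\<lambda>x. u x + v x) x = side_value K u x + side_value K v x"
    unfolding s by (rule side_value_eq[OF element(1,2)[OF K] xK]) (intro tendsto_intros t)
  show "side_value K (\<lambda>x. a *\<^sub>R u x) x = a *\<^sub>R side_value K u x"
    unfolding s by (rule side_value_eq[OF element(1,2)[OF K] xK]) (intro tendsto_intros t)
qed

lemma energy_identity:
  assumes \<beta>: "\<beta> \<in> W" and w: "w \<in> W"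
  shows "(\<Sum>K\<in>T. LINT x:K|lebesgue. directional \<beta> w x \<bullet> w x)
   + 1/2 * (\<Sum>K\<in>T. LINT x:K|lebesgue. divergence \<beta> x * (w x \<bullet> w x))
   = (\<Sum>F\<in>interior_faces \<Omega> T. LINT x:F|face_measure (nF F) F.
        (side_value (Kp F) \<beta> x \<bullet> nF F) * (jump (Kp F) (Km F) w x \<bullet> average (Kp F) (Km F) w x))"
proof -
  obtain gb Jb where b: "\<And>K. K \<in> T \<Longrightarrow> C1_extension K \<beta> (gb K) (Jb K)" using velocity_extension[OF \<beta>] by blast
  obtain g J where g: "\<And>K. K \<in> T \<Longrightarrow> C1_extension K w (g K) (J K)" using velocity_extension[OF w] by blast
  define a where "a K F = 1/2 * (LINT x:F|face_measure (mesh_normal K F) F. (gb K x \<bullet> mesh_normal K F) * (g K x \<bullet> g K x))" for K F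
  have "(\<Sum>K\<in>T. LINT x:K|lebesgue. directional \<beta> w x \<bullet> w x)
   + 1/2 * (\<Sum>K\<in>T. LINT x:K|lebesgue. divergence \<beta> x * (w x \<bullet> w x))
   = (\<Sum>K\<in>T. (LINT x:K|lebesgue. directional \<beta> w x \<bullet> w x) + 1/2 * (LINT x:K|lebesgue. divergence \<beta> x * (w x \<bullet> w x)))"
    by (simp add: sum.distrib sum_distrib_left)
  also have "\<dots> = (\<Sum>K\<in>T. \<Sum>F | F facet_of K. a K F)"
    unfolding a_def
    by (rule sum.cong) (simp_all only: element_energy[OF element(1,2) mesh_normal_outward b g])
  also have "\<dots> = (\<Sum>F\<in>interior_faces \<Omega> T. a (Kp F) F + a (Km F) F)"
  proof (rule interior_face_sum_rearrange[OF finite_mesh element(1) interior_face_elements interior_face(3)])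
    fix K F assume K: "K \<in> T" and F: "F facet_of K" and nI: "F \<notin> interior_faces \<Omega> T"
    have "gb K x \<bullet> mesh_normal K F = 0" if "x \<in> F" for x
      by (rule normal_zero_boundary[OF velocity_H0_div[OF \<beta>] K F nI b[OF K] that])
    then have "(\<lambda>x. indicator F x *\<^sub>R ((gb K x \<bullet> mesh_normal K F) * (g K x \<bullet> g K x))) = (\<lambda>x. 0)"
      by (auto simp: indicator_def)
    then show "a K F = 0" by (simp add: a_def set_lebesgue_integral_def)
  qed
  also have "\<dots> = (\<Sum>F\<in>interior_faces \<Omega> T. LINT x:F|face_measure (nF F) F.
        (side_value (Kp F) \<beta> x \<bullet> nF F) * (jump (Kp F) (Km F) w x \<bullet> average (Kp F) (Km F) w x))"
  proof (rule sum.cong)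
    fix F assume F: "F \<in> interior_faces \<Omega> T"
    note f = interior_face[OF F] and nrm = mesh_normal_interior[OF F] and fl = face_flat[OF F]
    note c = facet_extension_continuous[OF f(1,4) b[OF f(1)]] facet_extension_continuous[OF f(2,5) b[OF f(2)]]
      facet_extension_continuous[OF f(1,4) g[OF f(1)]] facet_extension_continuous[OF f(2,5) g[OF f(2)]]
    let ?p = "\<lambda>x. (gb (Kp F) x \<bullet> nF F) * (g (Kp F) x \<bullet> g (Kp F) x)"
    let ?m = "\<lambda>x. (gb (Km F) x \<bullet> (- nF F)) * (g (Km F) x \<bullet> g (Km F) x)"
    have cp: "continuous_on F ?p" and cm: "continuous_on F ?m" by (intro continuous_intros c)+
    have "a (Kp F) F + a (Km F) F = 1/2 * ((LINT x:F|face_measure (nF F) F. ?p x) + (LINT x:F|face_measure (nF F) F. ?m x))"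
      unfolding a_def nrm face_integral_minus[OF fl cm] by (simp add: distrib_left)
    also have "\<dots> = 1/2 * (LINT x:F|face_measure (nF F) F. ?p x + ?m x)"
      by (simp only: set_integral_add(2)[OF face_integrable[OF fl cp] face_integrable[OF fl cm]])
    also have "\<dots> = (LINT x:F|face_measure (nF F) F. 1/2 * (?p x + ?m x))" by simp
    also have "\<dots> = (LINT x:F|face_measure (nF F) F.
        (side_value (Kp F) \<beta> x \<bullet> nF F) * (jump (Kp F) (Km F) w x \<bullet> average (Kp F) (Km F) w x))"
      unfolding set_lebesgue_integral_def
    proof (rule Bochner_Integration.integral_cong)
      fix x
      have "1/2 * (?p x + ?m x) = (side_value (Kp F) \<beta> x \<bullet> nF F) * (jump (Kp F) (Km F) w x \<bullet> average (Kp F) (Km F) w x)"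
        if x: "x \<in> F"
      proof -
        note s = side_value_extension[OF f(1,4) b[OF f(1)] x] side_value_extension[OF f(1,4) g[OF f(1)] x]
          side_value_extension[OF f(2,5) g[OF f(2)] x]
        have "?p x + ?m x = (gb (Kp F) x \<bullet> nF F) * (g (Kp F) x \<bullet> g (Kp F) x - g (Km F) x \<bullet> g (Km F) x)"
          using normal_continuous_interior[OF velocity_H0_div[OF \<beta>] F b x] by (simp add: algebra_simps)
        \<comment> \<open>The polarization (a - b) . (a + b) / 2 = (a . a - b . b) / 2; the mixed
          products cancel.\<close>
        moreover have "jump (Kp F) (Km F) w x \<bullet> average (Kp F) (Km F) w x
            = 1/2 * (g (Kp F) x \<bullet> g (Kp F) x - g (Km F) x \<bullet> g (Km F) x)"
          unfolding jump_def average_def s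
          by (simp add: inner_diff_left inner_diff_right inner_add_left inner_add_right inner_commute)
        ultimately show ?thesis unfolding s by simp
      qed
      then show "indicat_real F x *\<^sub>R (1/2 * (?p x + ?m x)) = indicat_real F x *\<^sub>R
        ((side_value (Kp F) \<beta> x \<bullet> nF F) * (jump (Kp F) (Km F) w x \<bullet> average (Kp F) (Km F) w x))"
        by (auto simp: indicator_def)
    qed simp
    finally show "a (Kp F) F + a (Km F) F = (LINT x:F|face_measure (nF F) F.
        (side_value (Kp F) \<beta> x \<bullet> nF F) * (jump (Kp F) (Km F) w x \<bullet> average (Kp F) (Km F) w x))" .
  qed simp
  finally show ?thesis .
qed

section \<open>The dissipation as a semidefinite bilinear form\<close>

lemma jump_continuous:
  assumes F: "F \<in> interior_faces \<Omega> T" and u: "u \<in> W"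
  shows "continuous_on F (jump (Kp F) (Km F) u)"
  unfolding jump_def[abs_def]
  by (intro continuous_intros side_value_continuous interior_face[OF F] u)

lemma dissipation_integrand_integrable:
  assumes F: "F \<in> interior_faces \<Omega> T" and "\<beta> \<in> W" "u \<in> W" "v \<in> W"
  shows "set_integrable (face_measure (nF F) F) F
    (\<lambda>x. \<bar>side_value (Kp F) \<beta> x \<bullet> nF F\<bar> * (jump (Kp F) (Km F) u x \<bullet> jump (Kp F) (Km F) v x))"
  by (intro face_integrable[OF face_flat[OF F]] continuous_intros side_value_continuous jump_continuous
      interior_face[OF F] F assms)

text \<open>Holds for arbitrary fields: the integrand is nonnegative, and a nonintegrable one has
  integral 0 by convention.\<close>

lemma dissipation_nonneg:
  assumes "\<zeta> \<ge> 0"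
  shows "0 \<le> dissipation \<Omega> T Kp Km nF \<zeta> \<beta> u u"
  unfolding dissipation_def set_lebesgue_integral_def
  using assms by (intro mult_nonneg_nonneg sum_nonneg Bochner_Integration.integral_nonneg) auto

lemma dissipation_commute:
  "dissipation \<Omega> T Kp Km nF \<zeta> \<beta> u v = dissipation \<Omega> T Kp Km nF \<zeta> \<beta> v u"
  unfolding dissipation_def by (simp add: inner_commute)

lemma dissipation_linear:
  assumes \<beta>: "\<beta> \<in> W" and u: "u \<in> W" and v: "v \<in> W" and w: "w \<in> W"
  shows "dissipation \<Omega> T Kp Km nF \<zeta> \<beta> (\<lambda>x. u x + v x) w
      = dissipation \<Omega> T Kp Km nF \<zeta> \<beta> u w + dissipation \<Omega> T Kp Km nF \<zeta> \<beta> v w"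
    "dissipation \<Omega> T Kp Km nF \<zeta> \<beta> (\<lambda>x. a *\<^sub>R u x) w = a * dissipation \<Omega> T Kp Km nF \<zeta> \<beta> u w"
proof -
  let ?I = "\<lambda>F u. LINT x:F|face_measure (nF F) F.
      \<bar>side_value (Kp F) \<beta> x \<bullet> nF F\<bar> * (jump (Kp F) (Km F) u x \<bullet> jump (Kp F) (Km F) w x)"
  have "?I F (\<lambda>x. u x + v x) = ?I F u + ?I F v" if F: "F \<in> interior_faces \<Omega> T" for F
  proof -
    have j: "jump (Kp F) (Km F) (\<lambda>x. u x + v x) x = jump (Kp F) (Km F) u x + jump (Kp F) (Km F) v x" if "x \<in> F" for x
      using side_value_linear(1)[OF _ _ u v that] interior_face[OF F] by (simp add: jump_def)
    have "?I F (\<lambda>x. u x + v x) = (LINT x:F|face_measure (nF F) F.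
      \<bar>side_value (Kp F) \<beta> x \<bullet> nF F\<bar> * (jump (Kp F) (Km F) u x \<bullet> jump (Kp F) (Km F) w x)
      + \<bar>side_value (Kp F) \<beta> x \<bullet> nF F\<bar> * (jump (Kp F) (Km F) v x \<bullet> jump (Kp F) (Km F) w x))"
      unfolding set_lebesgue_integral_def
      by (rule Bochner_Integration.integral_cong)
        (auto simp: indicator_def j inner_add_left distrib_left)
    also have "\<dots> = ?I F u + ?I F v"
      by (intro set_integral_add dissipation_integrand_integrable[OF F \<beta>] u v w)
    finally show ?thesis .
  qed
  then show "dissipation \<Omega> T Kp Km nF \<zeta> \<beta> (\<lambda>x. u x + v x) w
      = dissipation \<Omega> T Kp Km nF \<zeta> \<beta> u w + dissipation \<Omega> T Kp Km nF \<zeta> \<beta> v w"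
    unfolding dissipation_def by (simp add: sum.distrib distrib_left)
  have "?I F (\<lambda>x. a *\<^sub>R u x) = a * ?I F u" if F: "F \<in> interior_faces \<Omega> T" for F
  proof -
    have j: "jump (Kp F) (Km F) (\<lambda>x. a *\<^sub>R u x) x = a *\<^sub>R jump (Kp F) (Km F) u x" if "x \<in> F" for x
      using side_value_linear(2)[OF _ _ u v that] interior_face[OF F] by (simp add: jump_def scaleR_diff_right)
    have "?I F (\<lambda>x. a *\<^sub>R u x) = (LINT x:F|face_measure (nF F) F.
      a * (\<bar>side_value (Kp F) \<beta> x \<bullet> nF F\<bar> * (jump (Kp F) (Km F) u x \<bullet> jump (Kp F) (Km F) w x)))"
      unfolding set_lebesgue_integral_def
      by (rule Bochner_Integration.integral_cong) (auto simp: indicator_def j)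
    then show ?thesis by simp
  qed
  then show "dissipation \<Omega> T Kp Km nF \<zeta> \<beta> (\<lambda>x. a *\<^sub>R u x) w = a * dissipation \<Omega> T Kp Km nF \<zeta> \<beta> u w"
    unfolding dissipation_def by (simp add: sum_distrib_left mult_ac)
qed

lemma velocity_subspace: "u \<in> W \<Longrightarrow> v \<in> W \<Longrightarrow> (\<lambda>x. u x + v x) \<in> W" "u \<in> W \<Longrightarrow> (\<lambda>x. a *\<^sub>R u x) \<in> W"
  using W by (auto simp: discrete_velocity_space_def function_subspace_def)

text \<open>The root of a positive semidefinite symmetric bilinear form is a seminorm, the triangle
  inequality being Cauchy-Schwarz.\<close>

lemma seminorm_beta:
  assumes \<zeta>: "\<zeta> \<ge> 0" and \<beta>: "\<beta> \<in> W"
  shows "seminorm_on W (beta_seminorm \<Omega> T Kp Km nF \<zeta> \<beta>)"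
proof -
  let ?D = "dissipation \<Omega> T Kp Km nF \<zeta> \<beta>"
  note lin = dissipation_linear[OF \<beta>] and com = dissipation_commute[of \<zeta> \<beta>] and nn = dissipation_nonneg[OF \<zeta>]
  have scale: "?D (\<lambda>x. a *\<^sub>R u x) (\<lambda>x. a *\<^sub>R u x) = a\<^sup>2 * ?D u u" if u: "u \<in> W" for a u
    using lin(2)[OF u u velocity_subspace(2)[OF u], where a=a] lin(2)[OF u u u, where a=a] com[of u "\<lambda>x. a *\<^sub>R u x"]
    by (simp add: power2_eq_square)
  have plus: "?D (\<lambda>x. u x + v x) (\<lambda>x. u x + v x) = ?D u u + 2 * ?D u v + ?D v v" if u: "u \<in> W" and v: "v \<in> W" for u v
    using lin(1)[OF u v velocity_subspace(1)[OF u v]] lin(1)[OF u v u] lin(1)[OF u v v]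
      com[of u "\<lambda>x. u x + v x"] com[of v "\<lambda>x. u x + v x"] com[of v u] by simp
  have tri: "sqrt (?D (\<lambda>x. u x + v x) (\<lambda>x. u x + v x)) \<le> sqrt (?D u u) + sqrt (?D v v)"
    if u: "u \<in> W" and v: "v \<in> W" for u v
  proof -
    have "(?D u v)\<^sup>2 \<le> ?D u u * ?D v v"
    \<comment> \<open>The polynomial in a is the dissipation of u + a v with itself.\<close>
    proof (rule quadratic_nonneg_imp[OF _ nn])
      fix a
      have "?D u (\<lambda>x. a *\<^sub>R v x) = a * ?D u v"
        using lin(2)[OF v v u, where a=a] com[of u "\<lambda>x. a *\<^sub>R v x"] com[of u v] by simp
      then show "0 \<le> ?D u u + 2 * a * ?D u v + a\<^sup>2 * ?D v v"
        using nn[of \<beta> "\<lambda>x. u x + a *\<^sub>R v x"] plus[OF u velocity_subspace(2)[OF v]] scale[OF v] by simp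
    qed
    then have "?D u v \<le> sqrt (?D u u * ?D v v)" by (rule real_le_rsqrt)
    then have "?D (\<lambda>x. u x + v x) (\<lambda>x. u x + v x) \<le> (sqrt (?D u u) + sqrt (?D v v))\<^sup>2"
      using plus[OF u v] nn[of \<beta> u] nn[of \<beta> v] by (simp add: power2_sum real_sqrt_mult)
    then show ?thesis using nn by (intro real_le_lsqrt) auto
  qed
  show ?thesis
    unfolding seminorm_on_def beta_seminorm_def
    using nn tri scale by (auto simp: real_sqrt_mult)
qed

end

theorem lemma6p3:
  fixes \<Omega> :: "(real^'n::finite) set"
    and T :: "(real^'n) set set"
    and Kp Km :: "(real^'n) set \<Rightarrow> (real^'n) set"
    and nF :: "(real^'n) set \<Rightarrow> real^'n"
    and W :: "(real^'n \<Rightarrow> real^'n) set"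
    and \<zeta> :: real
  assumes "CARD('n) = 2 \<or> CARD('n) = 3"
    and "polyhedral_domain \<Omega>"
    and "mesh \<Omega> T"
    and "face_orientation \<Omega> T Kp Km nF"
    and "discrete_velocity_space \<Omega> T W"
    and "\<zeta> \<ge> 0"
  shows "(\<forall>\<beta>\<in>W. \<forall>w\<in>W.
            conv_form \<Omega> T Kp Km nF \<zeta> \<beta> w w = (beta_seminorm \<Omega> T Kp Km nF \<zeta> \<beta> w)\<^sup>2)
       \<and> (\<forall>\<beta>\<in>W. seminorm_on W (beta_seminorm \<Omega> T Kp Km nF \<zeta> \<beta>))"
proof (intro conjI ballI)
  fix \<beta> w assume "\<beta> \<in> W" "w \<in> W"
  then show "conv_form \<Omega> T Kp Km nF \<zeta> \<beta> w w = (beta_seminorm \<Omega> T Kp Km nF \<zeta> \<beta> w)\<^sup>2"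
    \<comment> \<open>The volume terms cancel the face term, and nonnegativity of what is left makes
      the square of its root equal to it.\<close>
    using energy_identity[OF assms(2-5)] dissipation_nonneg[OF assms(2-6)]
    by (simp add: conv_form_def beta_seminorm_def)
next
  fix \<beta> assume "\<beta> \<in> W"
  then show "seminorm_on W (beta_seminorm \<Omega> T Kp Km nF \<zeta> \<beta>)"
    by (rule seminorm_beta[OF assms(2-6)])
qed

end
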